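(* Let $G$ be a finitely generated nilpotent group and let $\mathcal V$ be the variety that it generates. The connected component of $G$ for the relation $\rightsquigarrow$ coincides with the set of (isomorphism classes of finitely generated) groups generating $\mathcal V$ if and only if $G/\mathrm{Torsion}(G)$ generates $\mathcal V$. If this is not the case, then the set of (isomorphism classes of finitely generated) groups generating $\mathcal V$ consists of infinitely many connected components for the relation $\rightsquigarrow$.
   Context: For finitely generated groups $G,H$, write $G\rightsquigarrow H$ ("$G$ preforms $H$") if there exist a finite generating set $T$ of $H$ and a sequence $S_1,S_2,\dots$ of finite generating sets of $G$, with bijections $S_n\to T$, such that for every $R\in\mathbb N$ and all $n$ large enough the balls of radius $R$ around the identity in the Cayley graphs of $(G,S_n)$ and $(H,T)$ are isomorphic as rooted graphs with edges labelled by generators, labels being identified via $S_n\to T$. View $\rightsquigarrow$ as the edge set of an oriented graph whose vertices are the isomorphism classes of finitely generated groups; connected components are those of the underlying unoriented graph. The variety generated by a group is determined by the set of identities (words $w(x_1,\dots,x_n)$ in a free group with $w(g_1,\dots,g_n)=1$ for all choices of $g_i$ in the group) that it satisfies; a group generates $\mathcal V$ if the variety it generates is $\mathcal V$. $\mathrm{Torsion}(G)$ is the subgroup of torsion elements of the nilpotent group $G$. *)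

theory Defs
  imports "HOL-Algebra.Algebra"
begin

section \<open>Finitely generated groups and their Cayley graphs\<close>

definition finite_generating_set :: "('a, 'b) monoid_scheme \<Rightarrow> 'a set \<Rightarrow> bool" where
  "finite_generating_set G S \<longleftrightarrow> finite S \<and> S \<subseteq> carrier G \<and> generate G S = carrier G"

definition fg_group :: "('a, 'b) monoid_scheme \<Rightarrow> bool" where
  "fg_group G \<longleftrightarrow> group G \<and> (\<exists>S. finite_generating_set G S)"

text \<open>A triple \<open>(g, s, h)\<close> is an edge from \<open>g\<close> to \<open>h\<close> labelled by the generator \<open>s\<close>.\<close>

definition cayley_edges :: "('a, 'b) monoid_scheme \<Rightarrow> 'a set \<Rightarrow> ('a \<times> 'a \<times> 'a) set" where
  "cayley_edges G S = {(g, s, g \<otimes>\<^bsub>G\<^esub> s) | g s. g \<in> carrier G \<and> s \<in> S}"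

text \<open>Distances in the Cayley graph ignore the orientation of the edges, so that the ball of
  radius \<open>R\<close> consists of the elements of word length at most \<open>R\<close> over \<open>S\<close> and its inverses.\<close>

definition cayley_adj :: "('a, 'b) monoid_scheme \<Rightarrow> 'a set \<Rightarrow> ('a \<times> 'a) set" where
  "cayley_adj G S = {(g, h). \<exists>s. (g, s, h) \<in> cayley_edges G S \<or> (h, s, g) \<in> cayley_edges G S}"

definition cayley_ball :: "('a, 'b) monoid_scheme \<Rightarrow> 'a set \<Rightarrow> nat \<Rightarrow> 'a set" where
  "cayley_ball G S R = {g. \<exists>k\<le>R. (\<one>\<^bsub>G\<^esub>, g) \<in> cayley_adj G S ^^ k}"

text \<open>Isomorphism of the rooted edge-labelled (induced) subgraphs on the two balls, the labels
  in \<open>S\<close> being identified with those in \<open>T\<close> via \<open>\<phi>\<close>.\<close>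

definition balls_isomorphic ::
  "('a, 'b) monoid_scheme \<Rightarrow> 'a set \<Rightarrow> ('c, 'd) monoid_scheme \<Rightarrow> 'c set \<Rightarrow> ('a \<Rightarrow> 'c) \<Rightarrow> nat \<Rightarrow> bool"
where
  "balls_isomorphic G S H T \<phi> R \<longleftrightarrow>
     (\<exists>f. bij_betw f (cayley_ball G S R) (cayley_ball H T R) \<and> f \<one>\<^bsub>G\<^esub> = \<one>\<^bsub>H\<^esub> \<and>
          (\<forall>x\<in>cayley_ball G S R. \<forall>y\<in>cayley_ball G S R. \<forall>s\<in>S.
             (x, s, y) \<in> cayley_edges G S \<longleftrightarrow> (f x, \<phi> s, f y) \<in> cayley_edges H T))"


section \<open>The relation \<open>preforms\<close>\<close>

definition preforms :: "('a, 'b) monoid_scheme \<Rightarrow> ('c, 'd) monoid_scheme \<Rightarrow> bool" where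
  "preforms G H \<longleftrightarrow>
     (\<exists>T. finite_generating_set H T \<and>
       (\<exists>(S :: nat \<Rightarrow> 'a set) (\<phi> :: nat \<Rightarrow> 'a \<Rightarrow> 'c).
          (\<forall>n. finite_generating_set G (S n) \<and> bij_betw (\<phi> n) (S n) T) \<and>
          (\<forall>R. \<forall>\<^sub>F n in sequentially. balls_isomorphic G (S n) H T (\<phi> n) R)))"

text \<open>Finitely generated groups are countable, hence isomorphic to groups whose carrier is a
  subset of \<open>nat\<close>; an isomorphism class is represented by the set of all such copies.\<close>

definition iso_class :: "('a, 'b) monoid_scheme \<Rightarrow> nat monoid set" where
  "iso_class G = {K. group K \<and> G \<cong> K}"

definition fg_classes :: "nat monoid set set" where
  "fg_classes = {iso_class K | K :: nat monoid. fg_group K}"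

definition preforms_class :: "nat monoid set \<Rightarrow> nat monoid set \<Rightarrow> bool" where
  "preforms_class C D \<longleftrightarrow>
     (\<exists>(K :: nat monoid) (L :: nat monoid). fg_group K \<and> fg_group L \<and> C = iso_class K \<and> D = iso_class L \<and>
        preforms K L)"

definition preforms_connected :: "(nat monoid set \<times> nat monoid set) set" where
  "preforms_connected =
     {(C, D). C \<in> fg_classes \<and> D \<in> fg_classes \<and> equivclp preforms_class C D}"

definition preforms_component :: "nat monoid set \<Rightarrow> nat monoid set set" where
  "preforms_component C = preforms_connected `` {C}"

definition preforms_components :: "nat monoid set set set" where
  "preforms_components = fg_classes // preforms_connected"


section \<open>Varieties\<close>

text \<open>A word is a list of letters \<open>x\<^sub>i\<close>, written \<open>(i, True)\<close>, and inverses \<open>x\<^sub>i\<^sup>-\<^sup>1\<close>, written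
  \<open>(i, False)\<close>. Words need not be reduced: free reduction does not change values in groups.\<close>

type_synonym word = "(nat \<times> bool) list"

fun word_value :: "('a, 'b) monoid_scheme \<Rightarrow> (nat \<Rightarrow> 'a) \<Rightarrow> word \<Rightarrow> 'a" where
  "word_value G x [] = \<one>\<^bsub>G\<^esub>"
| "word_value G x ((i, e) # w) = (if e then x i else inv\<^bsub>G\<^esub> (x i)) \<otimes>\<^bsub>G\<^esub> word_value G x w"

definition identities :: "('a, 'b) monoid_scheme \<Rightarrow> word set" where
  "identities G = {w. \<forall>x. range x \<subseteq> carrier G \<longrightarrow> word_value G x w = \<one>\<^bsub>G\<^esub>}"

text \<open>A variety of groups is a proper class; it is represented by the set of identities that
  determines it.\<close>

definition variety_generated :: "('a, 'b) monoid_scheme \<Rightarrow> word set" where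
  "variety_generated G = identities G"

definition generates_variety :: "('a, 'b) monoid_scheme \<Rightarrow> word set \<Rightarrow> bool" where
  "generates_variety G V \<longleftrightarrow> variety_generated G = V"

definition generating_classes :: "word set \<Rightarrow> nat monoid set set" where
  "generating_classes V = {iso_class K | K :: nat monoid. fg_group K \<and> generates_variety K V}"


section \<open>Nilpotent groups and torsion\<close>

fun lower_central :: "('a, 'b) monoid_scheme \<Rightarrow> nat \<Rightarrow> 'a set" where
  "lower_central G 0 = carrier G"
| "lower_central G (Suc n) = generate G
     {x \<otimes>\<^bsub>G\<^esub> y \<otimes>\<^bsub>G\<^esub> inv\<^bsub>G\<^esub> x \<otimes>\<^bsub>G\<^esub> inv\<^bsub>G\<^esub> y | x y. x \<in> lower_central G n \<and> y \<in> carrier G}"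

definition nilpotent_group :: "('a, 'b) monoid_scheme \<Rightarrow> bool" where
  "nilpotent_group G \<longleftrightarrow> group G \<and> (\<exists>n. lower_central G n = {\<one>\<^bsub>G\<^esub>})"

definition torsion :: "('a, 'b) monoid_scheme \<Rightarrow> 'a set" where
  "torsion G = {x \<in> carrier G. \<exists>n::nat. n > 0 \<and> x [^]\<^bsub>G\<^esub> n = \<one>\<^bsub>G\<^esub>}"

end

theory Submission
  imports Defs "HOL-Library.Countable_Set"
begin

text \<open>If \<open>G\<close> preforms \<open>H\<close> and one of them is nilpotent, then both are; as subgroups of finitely
  generated nilpotent groups are finitely generated, \<open>G\<close> is a quotient of \<open>H\<close>. So \<open>G\<close> and \<open>H\<close>
  have the same identities, and every word takes the same number of values in both. If \<open>w\<close> is an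
  identity of \<open>G/Torsion(G)\<close> but not of \<open>G\<close>, it has a finite number \<open>c \<ge> 2\<close> of values in \<open>G\<close>,
  and \<open>c\<^sup>m\<close> values in the direct power \<open>G\<^sup>m\<close>, which separates infinitely many components.

  If \<open>G/Torsion(G)\<close> generates the variety, then every group generating it preforms the relatively
  free groups of large rank. This needs generating tuples on which finitely many given words take
  nontrivial values. An element of infinite order survives, for each prime \<open>p\<close>, in a quotient in which
  all elements have \<open>p\<close>-power order, namely modulo a normal subgroup maximal among those containing none
  of its powers prime to \<open>p\<close>. Hence a word not vanishing on \<open>(u\<^sub>i v\<^sub>i\<^sup>n)\<close> at \<open>n = n\<^sub>0\<close> does not vanish
  on a whole residue class of \<open>n\<close> modulo a power of \<open>p\<close>, and different requirements on \<open>n\<close> are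
  combined by the Chinese remainder theorem. For generators \<open>g\<^sub>i\<close> the tuple has the form
  \<open>(g\<^sub>i a\<^sub>i\<^sup>n, g\<^sub>i b\<^sub>i\<^sup>m, \<dots>)\<close> with \<open>n\<close> even: then the first block contains, modulo commutators, an odd
  power of every element, and \<open>m\<close> can be chosen such that the first two blocks generate.\<close>

text \<open>Values are asked to have infinite order rather than to be nontrivial: an element of
  finite order can survive only in \<open>p\<close>-quotients for primes \<open>p\<close> dividing
  its order, whereas the modifications of a tuple use both primes 2 and 3. Each modification follows
  a path \<open>u i \<otimes> v i [^] n\<close> that passes through the old tuple at a known
  exponent, so that keeping the old properties is a congruence on \<open>n\<close> modulo a power of
  one prime, and the new property may constrain \<open>n\<close> only modulo numbers prime to it.

  Zorn's lemma alone makes only the centre of the quotient a \<open>p\<close>-group; finite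
  generation spreads this over the upper central series. For that reason the series is taken over an
  arbitrary normal subgroup.

  Generation is the real obstacle, since a tuple on which the words survive need not generate. In a
  nilpotent group it can be tested modulo commutators, where it becomes a divisibility condition on
  the second exponent. The divisor is odd because the first exponent is even, and so it does not
  interfere with a congruence modulo a power of 2.\<close>

declare mult_FactGroup [simp del] one_FactGroup [simp del]

section \<open>Commutators and the upper central series over a normal subgroup\<close>

definition gcomm :: "('a, 'b) monoid_scheme \<Rightarrow> 'a \<Rightarrow> 'a \<Rightarrow> 'a" where
  "gcomm G x y = x \<otimes>\<^bsub>G\<^esub> y \<otimes>\<^bsub>G\<^esub> inv\<^bsub>G\<^esub> x \<otimes>\<^bsub>G\<^esub> inv\<^bsub>G\<^esub> y"

text \<open>The preimage of the centre of \<open>G Mod N\<close>. Phrased by commutators in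
  \<open>G\<close> it is visibly monotone in \<open>N\<close>.\<close>

definition central_mod :: "('a, 'b) monoid_scheme \<Rightarrow> 'a set \<Rightarrow> 'a set" where
  "central_mod G N = {x \<in> carrier G. \<forall>y\<in>carrier G. gcomm G x y \<in> N}"

text \<open>The preimages of the upper central series of \<open>G Mod N\<close>;
  \<open>N = {\<one>}\<close> gives the usual series. By monotonicity in \<open>N\<close>, a series
  that exhausts \<open>G\<close> over \<open>{\<one>}\<close> also does so over every normal
  subgroup.\<close>

fun upper_central :: "('a, 'b) monoid_scheme \<Rightarrow> 'a set \<Rightarrow> nat \<Rightarrow> 'a set" where
  "upper_central G N 0 = N"
| "upper_central G N (Suc i) = central_mod G (upper_central G N i)"

lemma (in group) gcomm_closed [simp]:
  "\<lbrakk>x \<in> carrier G; y \<in> carrier G\<rbrakk> \<Longrightarrow> gcomm G x y \<in> carrier G"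
  by (simp add: gcomm_def)

lemma (in group) gcomm_eq:
  assumes "x \<in> carrier G" "y \<in> carrier G"
  shows "gcomm G x y = (x \<otimes> y) \<otimes> inv (y \<otimes> x)"
  using assms by (simp add: gcomm_def inv_mult_group m_assoc)

lemma (in group) gcomm_mult:
  assumes "x \<in> carrier G" "y \<in> carrier G"
  shows "gcomm G x y \<otimes> (y \<otimes> x) = x \<otimes> y"
  using assms by (simp add: gcomm_eq m_assoc)

lemma (in group) gcomm_one_iff:
  assumes "x \<in> carrier G" "y \<in> carrier G"
  shows "gcomm G x y = \<one> \<longleftrightarrow> x \<otimes> y = y \<otimes> x"
  using assms by (metis gcomm_closed gcomm_mult l_one m_closed r_cancel_one)

lemma (in group_hom) hom_gcomm:
  assumes "x \<in> carrier G" "y \<in> carrier G"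
  shows "h (gcomm G x y) = gcomm H (h x) (h y)"
  using assms by (simp add: gcomm_def)

lemma (in group) hom_Mod:
  assumes "N \<lhd> G"
  shows "group_hom G (G Mod N) ((#>) N)"
  using assms
  by (meson group.axioms(1) group_hom_axioms.intro group_hom_def is_group normal.factorgroup_is_group
      normal.r_coset_hom_Mod)

lemma (in group) coset_eq_iff:
  assumes "subgroup N G" "x \<in> carrier G" "y \<in> carrier G"
  shows "N #> x = N #> y \<longleftrightarrow> x \<otimes> inv y \<in> N"
  by (metis assms coset_join1 coset_join2 coset_mult_inv1 coset_mult_inv2 inv_closed m_closed subgroup.subset)

lemma (in group) coset_one_iff:
  assumes "N \<lhd> G" "x \<in> carrier G"
  shows "N #> x = \<one>\<^bsub>G Mod N\<^esub> \<longleftrightarrow> x \<in> N"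
proof -
  have "subgroup N G" using assms(1) by (rule normal_imp_subgroup)
  then show ?thesis
    using assms(2) by (metis FactGroup_def coset_join1 coset_join2 monoid.simps(2) subgroup.subset)
qed

lemma (in group) gcomm_in_normal_iff:
  assumes "N \<lhd> G" "x \<in> carrier G" "y \<in> carrier G"
  shows "gcomm G x y \<in> N \<longleftrightarrow>
    (N #> x) \<otimes>\<^bsub>G Mod N\<^esub> (N #> y) = (N #> y) \<otimes>\<^bsub>G Mod N\<^esub> (N #> x)"
proof -
  interpret q: group_hom G "G Mod N" "(#>) N" using assms(1) by (rule hom_Mod)
  have "gcomm G x y \<in> N \<longleftrightarrow> N #> gcomm G x y = \<one>\<^bsub>G Mod N\<^esub>"
    using coset_one_iff[OF assms(1)] assms by simp
  also have "\<dots> \<longleftrightarrow> gcomm (G Mod N) (N #> x) (N #> y) = \<one>\<^bsub>G Mod N\<^esub>"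
    using q.hom_gcomm assms by simp
  finally show ?thesis using q.H.gcomm_one_iff assms by simp
qed

lemma (in group) gcomm_swap:
  assumes "N \<lhd> G" "x \<in> carrier G" "y \<in> carrier G"
  shows "gcomm G x y \<in> N \<longleftrightarrow> gcomm G y x \<in> N"
  using assms by (simp add: gcomm_in_normal_iff eq_commute)

lemma (in group) subgroup_commuting:
  assumes "x \<in> carrier G"
  shows "subgroup {y \<in> carrier G. x \<otimes> y = y \<otimes> x} G"
proof (rule subgroupI)
  show "inv a \<in> {y \<in> carrier G. x \<otimes> y = y \<otimes> x}" if "a \<in> {y \<in> carrier G. x \<otimes> y = y \<otimes> x}" for a
    using that assms by (auto simp: inv_solve_left' inv_solve_right' m_assoc[symmetric])
      (metis inv_closed inv_comm inv_solve_left m_assoc m_closed)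
  show "a \<otimes> b \<in> {y \<in> carrier G. x \<otimes> y = y \<otimes> x}"
    if "a \<in> {y \<in> carrier G. x \<otimes> y = y \<otimes> x}" "b \<in> {y \<in> carrier G. x \<otimes> y = y \<otimes> x}" for a b
    using that assms by auto (metis m_assoc)
qed (use assms in auto)

lemma (in group_hom) subgroup_vimage:
  assumes "subgroup K H" shows "subgroup {x \<in> carrier G. h x \<in> K} G"
  by (rule G.subgroupI)
     (use assms in \<open>auto simp: subgroup.m_closed subgroup.m_inv_closed subgroup.one_closed intro!: exI[of _ "\<one>"]\<close>)

lemma (in group) subgroup_gcomm_right:
  assumes "N \<lhd> G" "x \<in> carrier G"
  shows "subgroup {y \<in> carrier G. gcomm G x y \<in> N} G"
proof -
  interpret q: group_hom G "G Mod N" "(#>) N" using assms(1) by (rule hom_Mod)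
  have "{y \<in> carrier G. gcomm G x y \<in> N} = {y \<in> carrier G. N #> y \<in> 
    {z \<in> carrier (G Mod N). (N #> x) \<otimes>\<^bsub>G Mod N\<^esub> z = z \<otimes>\<^bsub>G Mod N\<^esub> (N #> x)}}"
    using assms gcomm_in_normal_iff by auto
  then show ?thesis
    using q.subgroup_vimage[OF q.H.subgroup_commuting[of "N #> x"]] assms by simp
qed

text \<open>For fixed \<open>x\<close> the condition on \<open>y\<close> defines a subgroup, so
  generators suffice. This is where finite generation enters later: finitely many commutators decide
  centrality.\<close>

lemma (in group) central_modI_generate:
  assumes "N \<lhd> G" "x \<in> carrier G" "S \<subseteq> carrier G" "generate G S = carrier G"
    and "\<And>s. s \<in> S \<Longrightarrow> gcomm G x s \<in> N"
  shows "x \<in> central_mod G N"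
proof -
  have "generate G S \<subseteq> {y \<in> carrier G. gcomm G x y \<in> N}"
    using assms by (intro generate_subgroup_incl subgroup_gcomm_right) auto
  then show ?thesis using assms by (auto simp: central_mod_def)
qed

lemma (in group) subgroup_Int_family:
  assumes "\<And>i. i \<in> I \<Longrightarrow> subgroup (K i) G"
  shows "subgroup {x \<in> carrier G. \<forall>i\<in>I. x \<in> K i} G"
  by (rule subgroupI)
     (use assms in \<open>auto simp: subgroup.m_closed subgroup.m_inv_closed subgroup.one_closed intro!: exI[of _ "\<one>"]\<close>)

lemma (in group) normal_central_mod:
  assumes "N \<lhd> G" shows "central_mod G N \<lhd> G"
  unfolding normal_inv_iff
proof (intro conjI ballI)
  have eq: "central_mod G N = {x \<in> carrier G. \<forall>y\<in>carrier G. x \<in> {z \<in> carrier G. gcomm G y z \<in> N}}"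
    using gcomm_swap[OF assms] by (auto simp: central_mod_def)
  show "subgroup (central_mod G N) G"
    unfolding eq by (rule subgroup_Int_family) (rule subgroup_gcomm_right[OF assms])
  fix g x assume g: "g \<in> carrier G" and x: "x \<in> central_mod G N"
  interpret q: group_hom G "G Mod N" "(#>) N" using assms(1) by (rule hom_Mod)
  have xc: "x \<in> carrier G" and "gcomm G g x \<in> N"
    using x g gcomm_swap[OF assms] by (auto simp: central_mod_def)
  then have "(N #> g) \<otimes>\<^bsub>G Mod N\<^esub> (N #> x) = (N #> x) \<otimes>\<^bsub>G Mod N\<^esub> (N #> g)"
    using gcomm_in_normal_iff[OF assms] g by auto
  then have eq: "N #> (g \<otimes> x \<otimes> inv g) = N #> x"
    using g xc by (simp add: q.H.m_assoc)
  show "g \<otimes> x \<otimes> inv g \<in> central_mod G N"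
    unfolding central_mod_def
  proof (intro CollectI conjI ballI)
    fix y assume y: "y \<in> carrier G"
    have "gcomm G x y \<in> N" using x y by (simp add: central_mod_def)
    then show "gcomm G (g \<otimes> x \<otimes> inv g) y \<in> N"
      using gcomm_in_normal_iff[OF assms, of x y] gcomm_in_normal_iff[OF assms, of "g \<otimes> x \<otimes> inv g" y]
        y xc g by (simp add: eq del: q.hom_mult)
  qed (use g xc in auto)
qed

lemma (in group) normal_subset_central_mod:
  assumes "N \<lhd> G" shows "N \<subseteq> central_mod G N"
proof
  fix x assume x: "x \<in> N"
  interpret q: group_hom G "G Mod N" "(#>) N" using assms(1) by (rule hom_Mod)
  have sub: "subgroup N G" using assms by (rule normal_imp_subgroup)
  have xc: "x \<in> carrier G" using x sub by (meson subgroup.mem_carrier)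
  have "N #> x = \<one>\<^bsub>G Mod N\<^esub>" using x xc coset_one_iff[OF assms] by auto
  then show "x \<in> central_mod G N"
    using xc gcomm_in_normal_iff[OF assms xc] by (simp add: central_mod_def)
qed

lemma central_mod_mono: "N \<subseteq> M \<Longrightarrow> central_mod G N \<subseteq> central_mod G M"
  by (auto simp: central_mod_def)

lemma (in group) normal_upper_central: "N \<lhd> G \<Longrightarrow> upper_central G N i \<lhd> G"
  by (induction i) (auto simp: normal_central_mod)

lemma upper_central_mono: "N \<subseteq> M \<Longrightarrow> upper_central G N i \<subseteq> upper_central G M i"
  by (induction i) (auto simp: central_mod_mono)

text \<open>With \<open>c = gcomm G x y\<close> one has
  \<open>x \<otimes> y = c \<otimes> (y \<otimes> x)\<close>. Moving \<open>y\<close> through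
  \<open>n\<close> copies of \<open>x\<close> produces \<open>n\<close> copies of \<open>c\<close>,
  which can be collected because \<open>c\<close> commutes with \<open>x\<close>.\<close>

lemma (in group) gcomm_pow:
  assumes car: "x \<in> carrier G" "y \<in> carrier G" and c: "gcomm G x y \<otimes> x = x \<otimes> gcomm G x y"
  shows "gcomm G (x [^] (n::nat)) y = gcomm G x y [^] n"
proof -
  define c where "c = gcomm G x y"
  have cc: "c \<in> carrier G" and xy: "x \<otimes> y = c \<otimes> (y \<otimes> x)" and cx: "x \<otimes> c = c \<otimes> x"
    using car c gcomm_mult by (auto simp: c_def)
  have pw: "x [^] n \<otimes> c = c \<otimes> x [^] n" for n :: nat
    using group_commutes_pow[OF cx] car cc by simp
  have "x [^] n \<otimes> y = c [^] n \<otimes> (y \<otimes> x [^] n)" for n :: nat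
  proof (induction n)
    case (Suc n)
    have "x [^] Suc n \<otimes> y = x [^] n \<otimes> c \<otimes> y \<otimes> x"
      using car cc xy by (simp add: m_assoc)
    also have "\<dots> = c \<otimes> (x [^] n \<otimes> y) \<otimes> x"
      using car cc pw by (simp add: m_assoc)
    also have "\<dots> = c \<otimes> c [^] n \<otimes> (y \<otimes> (x [^] n \<otimes> x))"
      unfolding Suc.IH using car cc by (simp add: m_assoc)
    finally show ?case
      using cc car by (simp add: nat_pow_Suc2[symmetric] del: nat_pow_Suc)
  qed (use car in auto)
  then have "gcomm G (x [^] n) y \<otimes> (y \<otimes> x [^] n) = c [^] n \<otimes> (y \<otimes> x [^] n)"
    using gcomm_mult car by simp
  then show ?thesis
    using car cc by (simp add: c_def)
qed

lemma (in group) gcomm_pow_mod: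
  assumes N: "N \<lhd> G" and car: "x \<in> carrier G" "y \<in> carrier G"
    and c: "gcomm G x y \<in> central_mod G N"
  shows "gcomm G (x [^] (n::nat)) y \<otimes> inv (gcomm G x y [^] n) \<in> N"
proof -
  interpret q: group_hom G "G Mod N" "(#>) N" using N by (rule hom_Mod)
  have "gcomm G (gcomm G x y) x \<in> N" using c car by (auto simp: central_mod_def)
  then have "N #> gcomm G (x [^] n) y = N #> (gcomm G x y [^] n)"
    using gcomm_in_normal_iff[OF N] car
    by (simp add: q.hom_gcomm q.hom_nat_pow q.H.gcomm_pow)
  then show ?thesis
    using coset_eq_iff[OF normal_imp_subgroup[OF N]] car by auto
qed

section \<open>Normal subgroups avoiding powers of an element\<close>

text \<open>The product of \<open>N\<close> with the cyclic group of \<open>b\<close>. It is normal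
  once \<open>b\<close> is central modulo \<open>N\<close>, and serves both as the enlargement that
  contradicts maximality and as the step of a central chain.\<close>

definition cyclic_ext :: "('a, 'b) monoid_scheme \<Rightarrow> 'a set \<Rightarrow> 'a \<Rightarrow> 'a set" where
  "cyclic_ext G N b = {x \<in> carrier G. \<exists>k::int. N #>\<^bsub>G\<^esub> x = N #>\<^bsub>G\<^esub> (b [^]\<^bsub>G\<^esub> k)}"

lemma (in group) subset_cyclic_ext:
  assumes "N \<lhd> G" "b \<in> carrier G" shows "N \<subseteq> cyclic_ext G N b"
proof
  fix x assume x: "x \<in> N"
  have sub: "subgroup N G" using assms(1) by (rule normal_imp_subgroup)
  have xc: "x \<in> carrier G" using sub x by (rule subgroup.mem_carrier)
  have "N #> x = N #> (b [^] (0::int))"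
    using coset_join2[OF xc sub x] subgroup.subset[OF sub] by (simp add: coset_mult_one)
  then show "x \<in> cyclic_ext G N b"
    using xc unfolding cyclic_ext_def by blast
qed

lemma (in group) mem_cyclic_ext:
  assumes "b \<in> carrier G" shows "b \<in> cyclic_ext G N b"
proof -
  have "N #> b = N #> (b [^] (1::int))" using assms by (simp add: int_pow_1)
  then show ?thesis using assms unfolding cyclic_ext_def by blast
qed

lemma (in group) normal_cyclic_ext:
  assumes "N \<lhd> G" "b \<in> central_mod G N"
  shows "cyclic_ext G N b \<lhd> G"
  unfolding normal_inv_iff
proof (intro conjI ballI)
  interpret q: group_hom G "G Mod N" "(#>) N" using assms(1) by (rule hom_Mod)
  have bc: "b \<in> carrier G" using assms by (auto simp: central_mod_def)
  have "cyclic_ext G N b = {x \<in> carrier G. N #> x \<in> range (\<lambda>k::int. (N #> b) [^]\<^bsub>G Mod N\<^esub> k)}"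
    using bc by (auto simp: cyclic_ext_def q.hom_int_pow)
  then show "subgroup (cyclic_ext G N b) G"
    using q.subgroup_vimage[OF q.H.subgroup_of_powers[of "N #> b"]] bc by simp
  fix g x assume g: "g \<in> carrier G" and x: "x \<in> cyclic_ext G N b"
  then obtain k :: int where xc: "x \<in> carrier G" and k: "N #> x = N #> (b [^] k)"
    by (auto simp: cyclic_ext_def)
  have "b [^] k \<in> central_mod G N"
    using subgroup_int_pow_closed[OF normal_imp_subgroup[OF normal_central_mod[OF assms(1)]]] assms by blast
  then have "gcomm G (b [^] k) g \<in> N" using g by (auto simp: central_mod_def)
  then have "(N #> g) \<otimes>\<^bsub>G Mod N\<^esub> (N #> (b [^] k)) = (N #> (b [^] k)) \<otimes>\<^bsub>G Mod N\<^esub> (N #> g)"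
    using gcomm_in_normal_iff[OF assms(1)] g bc by simp
  then have "N #> (g \<otimes> x \<otimes> inv g) = N #> (b [^] k)"
    using g xc k bc by (simp add: q.H.m_assoc)
  then show "g \<otimes> x \<otimes> inv g \<in> cyclic_ext G N b"
    using g xc by (auto simp: cyclic_ext_def)
qed

section \<open>Unions of chains and maximal normal subgroups\<close>

lemma (in group) subgroup_Union_chain:
  assumes "\<C> \<noteq> {}" "\<And>K. K \<in> \<C> \<Longrightarrow> subgroup K G"
    and "\<And>K L. \<lbrakk>K \<in> \<C>; L \<in> \<C>\<rbrakk> \<Longrightarrow> K \<subseteq> L \<or> L \<subseteq> K"
  shows "subgroup (\<Union>\<C>) G"
proof (rule subgroupI)
  show "\<Union>\<C> \<subseteq> carrier G" using subgroup.subset[OF assms(2)] by blast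
  show "\<Union>\<C> \<noteq> {}" using assms(1) subgroup.one_closed[OF assms(2)] by blast
  show "inv a \<in> \<Union>\<C>" if "a \<in> \<Union>\<C>" for a
    using that subgroup.m_inv_closed[OF assms(2)] by blast
  show "a \<otimes> b \<in> \<Union>\<C>" if ab: "a \<in> \<Union>\<C>" "b \<in> \<Union>\<C>" for a b
  proof -
    obtain K L where "K \<in> \<C>" "a \<in> K" "L \<in> \<C>" "b \<in> L" using ab by blast
    then obtain P where "P \<in> \<C>" "a \<in> P" "b \<in> P" using assms(3) by blast
    then have "a \<otimes> b \<in> P" by (intro subgroup.m_closed[OF assms(2)])
    then show ?thesis using \<open>P \<in> \<C>\<close> by blast
  qed
qed

lemma (in group) normal_Union_chain:
  assumes "\<C> \<noteq> {}" "\<And>K. K \<in> \<C> \<Longrightarrow> K \<lhd> G"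
    and "\<And>K L. \<lbrakk>K \<in> \<C>; L \<in> \<C>\<rbrakk> \<Longrightarrow> K \<subseteq> L \<or> L \<subseteq> K"
  shows "\<Union>\<C> \<lhd> G"
  unfolding normal_inv_iff
proof (intro conjI ballI)
  show "subgroup (\<Union>\<C>) G"
    by (rule subgroup_Union_chain[OF assms(1) normal_imp_subgroup[OF assms(2)] assms(3)])
  fix g x assume "g \<in> carrier G" "x \<in> \<Union>\<C>"
  then show "g \<otimes> x \<otimes> inv g \<in> \<Union>\<C>"
    using normal_invE(2)[OF assms(2)] by blast
qed

lemma (in group) subgroup_nat_pow_closed:
  assumes "subgroup K G" "x \<in> K" shows "x [^] (n::nat) \<in> K"
  using subgroup_int_pow_closed[OF assms, of "int n"] unfolding int_pow_int .

text \<open>By maximality, adjoining a central \<open>z\<close> outside \<open>M\<close> brings in a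
  power of \<open>g\<close> prime to \<open>p\<close>, that is, some power of \<open>z\<close>
  equals such a power of \<open>g\<close> modulo \<open>M\<close>. If no \<open>p\<close>-power of
  \<open>z\<close> were in \<open>M\<close>, this would apply to \<open>z\<close> and to a high
  \<open>p\<close>-power of \<open>z\<close> alike; the two relations together put a power of
  \<open>g\<close> prime to \<open>p\<close> into \<open>M\<close>.\<close>

lemma (in group) exists_maximal_avoiding:
  assumes "normalization_semidom_class.prime p" "N \<lhd> G" "g \<in> carrier G" "\<And>m. \<not> int p dvd m \<Longrightarrow> g [^] (m::int) \<notin> N"
  obtains M where "M \<lhd> G" "N \<subseteq> M" "\<And>m. \<not> int p dvd m \<Longrightarrow> g [^] (m::int) \<notin> M"
    "\<And>z. z \<in> central_mod G M \<Longrightarrow> \<exists>a. z [^] (p ^ a) \<in> M"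
proof -
  define \<A> where "\<A> = {M. M \<lhd> G \<and> N \<subseteq> M \<and> (\<forall>m. \<not> int p dvd m \<longrightarrow> g [^] (m::int) \<notin> M)}"
  have "\<exists>M\<in>\<A>. \<forall>L\<in>\<A>. M \<subseteq> L \<longrightarrow> L = M"
  proof (rule subset_Zorn_nonempty)
    show "\<A> \<noteq> {}" using assms by (auto simp: \<A>_def)
    fix \<C> assume C: "\<C> \<noteq> {}" "subset.chain \<A> \<C>"
    then have sub: "\<C> \<subseteq> \<A>" and lin: "\<And>K L. \<lbrakk>K \<in> \<C>; L \<in> \<C>\<rbrakk> \<Longrightarrow> K \<subseteq> L \<or> L \<subseteq> K"
      by (auto simp: subset_chain_def)
    have "\<Union>\<C> \<lhd> G"
      using C(1) sub lin by (intro normal_Union_chain) (auto simp: \<A>_def)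
    then show "\<Union>\<C> \<in> \<A>" using C(1) sub by (auto simp: \<A>_def)
  qed
  then obtain M where M: "M \<in> \<A>" and max: "\<And>K. \<lbrakk>K \<in> \<A>; M \<subseteq> K\<rbrakk> \<Longrightarrow> K = M" by blast
  have Mn: "M \<lhd> G" and NM: "N \<subseteq> M" and av: "\<And>m. \<not> int p dvd m \<Longrightarrow> g [^] (m::int) \<notin> M"
    using M by (auto simp: \<A>_def)
  interpret q: group_hom G "G Mod M" "(#>) M" using Mn by (rule hom_Mod)
  have mem: "x \<in> M \<longleftrightarrow> M #> x = \<one>\<^bsub>G Mod M\<^esub>" if "x \<in> carrier G" for x
    using coset_one_iff[OF Mn that] by simp
  define \<gamma> where "\<gamma> = M #> g"
  have \<gamma>: "\<gamma> \<in> carrier (G Mod M)" using assms(3) by (simp add: \<gamma>_def)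
  have av': "\<gamma> [^]\<^bsub>G Mod M\<^esub> m \<noteq> \<one>\<^bsub>G Mod M\<^esub>" if "\<not> int p dvd m" for m :: int
    using av[OF that] mem[of "g [^] m"] assms(3) by (simp add: \<gamma>_def q.hom_int_pow)
  have ext: "\<exists>m k. \<not> int p dvd m \<and> \<gamma> [^]\<^bsub>G Mod M\<^esub> m = (M #> z) [^]\<^bsub>G Mod M\<^esub> (k::int)"
    if z: "z \<in> central_mod G M" "z \<notin> M" for z
  proof (rule ccontr)
    assume no: "\<not> ?thesis"
    have zc: "z \<in> carrier G" using z by (auto simp: central_mod_def)
    have "cyclic_ext G M z \<in> \<A>"
      using normal_cyclic_ext[OF Mn z(1)] subset_cyclic_ext[OF Mn zc] NM no assms(3) zc
      by (auto simp: \<A>_def cyclic_ext_def \<gamma>_def q.hom_int_pow)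
    then have "cyclic_ext G M z = M" using max subset_cyclic_ext[OF Mn zc] by blast
    then show False using z(2) mem_cyclic_ext[OF zc] by blast
  qed
  have "\<exists>a. z [^] (p ^ a) \<in> M" if z: "z \<in> central_mod G M" for z
  proof (rule ccontr)
    assume no: "\<not> (\<exists>a. z [^] (p ^ a) \<in> M)"
    define \<zeta> where "\<zeta> = M #> z"
    have zc: "z \<in> carrier G" using z by (auto simp: central_mod_def)
    have \<zeta>: "\<zeta> \<in> carrier (G Mod M)" using zc by (simp add: \<zeta>_def)
    have "z [^] (p ^ 0) \<notin> M" using no by blast
    then have "z \<notin> M" using zc by simp
    then obtain m s where m: "\<not> int p dvd m" and s: "\<gamma> [^]\<^bsub>G Mod M\<^esub> m = \<zeta> [^]\<^bsub>G Mod M\<^esub> (s::int)"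
      using ext[OF z] unfolding \<zeta>_def by blast
    have "s \<noteq> 0" using av'[OF m] unfolding s by (metis int_pow_0)
    then obtain b s' where s': "s = int p ^ b * s'" "\<not> int p dvd s'"
    proof -
      have "\<not> is_unit (int p)" using prime_gt_1_nat[OF assms(1)] by simp
      from multiplicity_decompose'[OF \<open>s \<noteq> 0\<close> this] that show ?thesis by blast
    qed
    \<comment> \<open>One factor \<open>p\<close> more than in \<open>s\<close>, so that the
      relation obtained from \<open>z'\<close> has an exponent of \<zeta> with strictly more factors
      \<open>p\<close>.\<close>
    define z' where "z' = z [^] (p ^ Suc b)"
    have "z' \<in> central_mod G M"
      unfolding z'_def using z normal_imp_subgroup[OF normal_central_mod[OF Mn]]
      by (intro subgroup_nat_pow_closed) auto
    moreover have "z' \<notin> M" using no unfolding z'_def by blast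
    ultimately obtain n t where n: "\<not> int p dvd n" and t: "\<gamma> [^]\<^bsub>G Mod M\<^esub> n = (M #> z') [^]\<^bsub>G Mod M\<^esub> (t::int)"
      using ext[of z'] by blast
    have z'eq: "M #> z' = \<zeta> [^]\<^bsub>G Mod M\<^esub> (int p ^ Suc b)"
    proof -
      have "M #> z' = \<zeta> [^]\<^bsub>G Mod M\<^esub> (p ^ Suc b)" using zc by (simp add: z'_def \<zeta>_def q.hom_nat_pow)
      also have "\<dots> = \<zeta> [^]\<^bsub>G Mod M\<^esub> int (p ^ Suc b)" by (rule int_pow_int[symmetric])
      finally show ?thesis by simp
    qed
    \<comment> \<open>Eliminating \<gamma> from the two relations kills \<zeta> to the exponent
      \<open>int p ^ b * u\<close>. Modulo \<open>p\<close>, \<open>u\<close> is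
      \<open>s' * n\<close>, hence prime to \<open>p\<close>.\<close>
    define u where "u = s' * n - int p * t * m"
    have "\<zeta> [^]\<^bsub>G Mod M\<^esub> (s * n) = \<gamma> [^]\<^bsub>G Mod M\<^esub> (m * n)"
      unfolding q.H.int_pow_pow[OF \<gamma>, symmetric] q.H.int_pow_pow[OF \<zeta>, symmetric] s ..
    also have "\<gamma> [^]\<^bsub>G Mod M\<^esub> (m * n) = \<zeta> [^]\<^bsub>G Mod M\<^esub> (int p ^ Suc b * t * m)"
      unfolding mult.commute[of m n] q.H.int_pow_pow[OF \<gamma>, symmetric] q.H.int_pow_pow[OF \<zeta>, symmetric] t z'eq ..
    finally have "\<zeta> [^]\<^bsub>G Mod M\<^esub> (s * n - int p ^ Suc b * t * m) = \<one>\<^bsub>G Mod M\<^esub>"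
      using \<zeta> by (simp add: q.H.int_pow_diff)
    moreover have "s * n - int p ^ Suc b * t * m = int p ^ b * u"
      by (simp add: s' u_def algebra_simps)
    ultimately have one: "\<zeta> [^]\<^bsub>G Mod M\<^esub> (int p ^ b * u) = \<one>\<^bsub>G Mod M\<^esub>" by simp
    have "\<gamma> [^]\<^bsub>G Mod M\<^esub> (m * u) = \<zeta> [^]\<^bsub>G Mod M\<^esub> (s * u)"
      unfolding q.H.int_pow_pow[OF \<gamma>, symmetric] q.H.int_pow_pow[OF \<zeta>, symmetric] s ..
    also have "s * u = (int p ^ b * u) * s'" by (simp add: s')
    also have "\<zeta> [^]\<^bsub>G Mod M\<^esub> \<dots> = \<one>\<^bsub>G Mod M\<^esub>"
      unfolding q.H.int_pow_pow[OF \<zeta>, of "int p ^ b * u" s', symmetric] one by (rule q.H.int_pow_one)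
    finally have "int p dvd m * u" using av' by blast
    moreover have "normalization_semidom_class.prime (int p)" using assms(1) by simp
    ultimately have "int p dvd u" using m by (simp add: prime_dvd_mult_iff)
    then have "int p dvd s' * n" unfolding u_def by (simp add: dvd_diff_left_iff mult.assoc)
    then show False using \<open>normalization_semidom_class.prime (int p)\<close> s'(2) n by (simp add: prime_dvd_mult_iff)
  qed
  then show ?thesis using that Mn NM av by blast
qed

lemma finite_uniform_bound:
  assumes "finite S" "\<And>s. s \<in> S \<Longrightarrow> \<exists>a::nat. P s a" "\<And>s a b. \<lbrakk>P s a; a \<le> b\<rbrakk> \<Longrightarrow> P s b"
  shows "\<exists>a. \<forall>s\<in>S. P s a"
  using assms(1,2)
proof (induction S rule: finite_induct)
  case (insert s S)
  then obtain a b where "P s a" "\<forall>s\<in>S. P s b" by blast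
  then have "\<forall>x\<in>insert s S. P x (max a b)" using assms(3) by (metis insert_iff max.cobounded1 max.cobounded2)
  then show ?case by blast
qed auto

lemma (in group) pow_power_mono:
  assumes "subgroup K G" "x \<in> carrier G" "x [^] (p ^ a :: nat) \<in> K" "a \<le> b"
  shows "x [^] (p ^ b) \<in> K"
proof -
  have "x [^] (p ^ b) = (x [^] (p ^ a)) [^] (p ^ (b - a))"
    using assms by (simp add: nat_pow_pow flip: power_add)
  then show ?thesis using assms subgroup_nat_pow_closed by simp
qed

text \<open>An element descends one level of the series after taking a \<open>p\<close>-power: its
  commutators with the finitely many generators lie one level lower, so by induction a common power
  \<open>p ^ a\<close> brings them down once more, and modulo that level \<open>[x^(p^a), s]\<close>
  equals \<open>[x, s]^(p^a)\<close>. At the bottom the centre is handled by the assumption.\<close>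

lemma (in group) upper_central_power:
  assumes S: "finite S" "S \<subseteq> carrier G" "generate G S = carrier G" and M: "M \<lhd> G"
    and Z: "\<And>z. z \<in> central_mod G M \<Longrightarrow> \<exists>a. z [^] (p ^ a :: nat) \<in> M"
  shows "x \<in> upper_central G M i \<Longrightarrow> \<exists>a. x [^] (p ^ a) \<in> M"
proof -
  have sub: "subgroup (upper_central G M i) G" for i
    using normal_imp_subgroup[OF normal_upper_central[OF M]] .
  have step: "\<exists>a. x [^] (p ^ a) \<in> upper_central G M i" if "x \<in> upper_central G M (Suc i)" for x i
    using that
  proof (induction i arbitrary: x)
    case (Suc i)
    have x: "x \<in> carrier G" "\<And>y. y \<in> carrier G \<Longrightarrow> gcomm G x y \<in> upper_central G M (Suc i)"
      using Suc.prems by (auto simp: central_mod_def)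
    have "\<exists>a. \<forall>s\<in>S. s \<in> carrier G \<longrightarrow> gcomm G x s [^] (p ^ a) \<in> upper_central G M i"
      using S x Suc.IH pow_power_mono[OF sub] by (intro finite_uniform_bound) auto
    then obtain a where a: "\<And>s. s \<in> S \<Longrightarrow> gcomm G x s [^] (p ^ a) \<in> upper_central G M i" using S(2) by blast
    have "gcomm G (x [^] (p ^ a)) s \<in> upper_central G M i" if s: "s \<in> S" for s
    proof -
      have sc: "s \<in> carrier G" using s S by blast
      have "gcomm G (x [^] (p ^ a)) s \<otimes> inv (gcomm G x s [^] (p ^ a)) \<in> upper_central G M i"
        using gcomm_pow_mod[OF normal_upper_central[OF M] x(1) sc] x(2)[OF sc] by simp
      then have "gcomm G (x [^] (p ^ a)) s \<otimes> inv (gcomm G x s [^] (p ^ a)) \<otimes> gcomm G x s [^] (p ^ a)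
        \<in> upper_central G M i"
        using a[OF s] sub subgroup.m_closed by metis
      then show ?thesis using x(1) sc by (simp add: m_assoc)
    qed
    then have "x [^] (p ^ a) \<in> central_mod G (upper_central G M i)"
      using central_modI_generate[OF normal_upper_central[OF M]] x S by simp
    then show ?case by auto
  qed (use Z in auto)
  show "x \<in> upper_central G M i \<Longrightarrow> \<exists>a. x [^] (p ^ a) \<in> M"
  proof (induction i arbitrary: x)
    case 0
    then have "x [^] (p ^ 0) \<in> M" using sub[of 0] subgroup.mem_carrier by fastforce
    then show ?case by blast
  next
    case (Suc i)
    then obtain a b where "(x [^] (p ^ a)) [^] (p ^ b) \<in> M" using step by blast
    moreover have "x \<in> carrier G" using sub[of "Suc i"] Suc.prems by (meson subgroup.mem_carrier)
    ultimately have "x [^] (p ^ (a + b)) \<in> M" by (simp add: nat_pow_pow power_add)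
    then show ?case by blast
  qed
qed

text \<open>As \<open>{\<one>}\<close> lies in the maximal \<open>M\<close>, the series over
  \<open>M\<close> also reaches \<open>G\<close>, so the \<open>p\<close>-power property of the
  centre of \<open>G Mod M\<close> extends to all elements.\<close>

lemma (in group) exists_p_quotient_avoiding:
  assumes "finite_generating_set G S" "upper_central G {\<one>} c = carrier G"
    and "normalization_semidom_class.prime p" "N \<lhd> G" "g \<in> carrier G" "\<And>m. \<not> int p dvd m \<Longrightarrow> g [^] (m::int) \<notin> N"
  obtains M where "M \<lhd> G" "N \<subseteq> M" "g \<notin> M" "\<And>x. x \<in> carrier G \<Longrightarrow> \<exists>a. x [^] (p ^ a) \<in> M"
proof -
  obtain M where M: "M \<lhd> G" "N \<subseteq> M" "\<And>m. \<not> int p dvd m \<Longrightarrow> g [^] (m::int) \<notin> M"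
    "\<And>z. z \<in> central_mod G M \<Longrightarrow> \<exists>a. z [^] (p ^ a) \<in> M"
    using exists_maximal_avoiding[OF assms(3-6)] by blast
  have "\<not> int p dvd 1" using assms(3) not_prime_unit by auto
  then have "g \<notin> M" using M(3)[of 1] assms(5) by simp
  moreover have "{\<one>} \<subseteq> M" using normal_imp_subgroup[OF M(1)] subgroup.one_closed by blast
  then have "carrier G \<subseteq> upper_central G M c" using assms(2) upper_central_mono by metis
  then have "\<exists>a. x [^] (p ^ a) \<in> M" if "x \<in> carrier G" for x
    using upper_central_power[of S M p x c] assms(1) M that by (auto simp: finite_generating_set_def)
  ultimately show ?thesis using that M by blast
qed

section \<open>Finitely generated nilpotent groups\<close>

locale fg_nilpotent_group = group +
  assumes finitely_generated: "\<exists>S. finite_generating_set G S"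
    and nilpotent: "\<exists>c. upper_central G {\<one>} c = carrier G"

section \<open>Powers and torsion elements\<close>

context group
begin

lemma subgroup_coprime_powers:
  assumes "subgroup K G" "x \<in> carrier G" "x [^] (i::int) \<in> K" "x [^] (j::int) \<in> K" "coprime i j"
  shows "x \<in> K"
proof -
  obtain u v where "u * i + v * j = 1"
    using bezout_int[of i j] assms(5) by (metis coprime_iff_gcd_eq_1)
  then have "x = x [^] (i * u + j * v)"
    using assms(2) by (simp add: int_pow_1 mult.commute)
  also have "\<dots> = (x [^] i) [^] u \<otimes> (x [^] j) [^] v"
    using assms(2) by (simp add: int_pow_mult int_pow_pow)
  also have "\<dots> \<in> K"
    by (intro subgroup.m_closed[OF assms(1)] subgroup_int_pow_closed[OF assms(1)] assms(3,4))
  finally show ?thesis .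
qed

lemma torsion_iff_int_pow:
  assumes "x \<in> carrier G"
  shows "x \<in> torsion G \<longleftrightarrow> (\<exists>m::int. m \<noteq> 0 \<and> x [^] m = \<one>)"
proof
  assume "x \<in> torsion G"
  then obtain n :: nat where "n > 0" "x [^] n = \<one>" by (auto simp: torsion_def)
  then have "int n \<noteq> 0 \<and> x [^] int n = \<one>" unfolding int_pow_int by simp
  then show "\<exists>m::int. m \<noteq> 0 \<and> x [^] m = \<one>" by blast
next
  assume "\<exists>m::int. m \<noteq> 0 \<and> x [^] m = \<one>"
  then obtain m :: int where m: "m \<noteq> 0" "x [^] m = \<one>" by blast
  have "x [^] int (nat \<bar>m\<bar>) = \<one>"
    using m assms by (cases "m \<ge> 0") (simp_all add: int_pow_neg)
  then have "x [^] nat \<bar>m\<bar> = \<one>" unfolding int_pow_int .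
  moreover have "nat \<bar>m\<bar> > 0" using m by simp
  ultimately show "x \<in> torsion G" using assms unfolding torsion_def by blast
qed

lemma conj_nat_pow:
  assumes "g \<in> carrier G" "x \<in> carrier G"
  shows "(g \<otimes> x \<otimes> inv g) [^] (n::nat) = g \<otimes> x [^] n \<otimes> inv g"
proof (induction n)
  case (Suc n)
  have "inv g \<otimes> (g \<otimes> y) = y" if "y \<in> carrier G" for y
    using that assms by (simp add: m_assoc[symmetric])
  then show ?case using Suc assms by (simp add: m_assoc)
qed (use assms in simp)

lemma int_pow_torsion:
  assumes "x \<in> carrier G" "x [^] (m::int) \<in> torsion G" "m \<noteq> 0"
  shows "x \<in> torsion G"
proof -
  obtain k :: int where "k \<noteq> 0" "(x [^] m) [^] k = \<one>"
    using assms torsion_iff_int_pow[of "x [^] m"] by auto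
  then have "x [^] (m * k) = \<one>" "m * k \<noteq> 0" using assms by (auto simp: int_pow_pow)
  then show ?thesis using torsion_iff_int_pow[OF assms(1)] by blast
qed

lemma generate_mono_subgroup:
  assumes "A \<subseteq> B" "B \<subseteq> carrier G" shows "generate G A \<subseteq> generate G B"
proof (rule generate_subgroup_incl)
  show "A \<subseteq> generate G B" using assms(1) generate.incl[of _ B G] by blast
  show "subgroup (generate G B) G" using assms(2) by (rule generate_is_subgroup)
qed

end

section \<open>The torsion subgroup and generation modulo commutators\<close>

context fg_nilpotent_group
begin

lemma p_quotient_avoiding:
  fixes p :: nat
  assumes "normalization_semidom_class.prime p" "N \<lhd> G" "g \<in> carrier G"
    and "\<And>m. \<not> int p dvd m \<Longrightarrow> g [^] (m::int) \<notin> N"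
  obtains M where "M \<lhd> G" "N \<subseteq> M" "g \<notin> M" "\<And>x. x \<in> carrier G \<Longrightarrow> \<exists>a. x [^] (p ^ a) \<in> M"
proof -
  obtain S c where "finite_generating_set G S" "upper_central G {\<one>} c = carrier G"
    using finitely_generated nilpotent by blast
  from exists_p_quotient_avoiding[OF this assms] that show ?thesis by blast
qed

text \<open>A product of infinite order would survive in a \<open>p\<close>-quotient for a prime
  \<open>p\<close> larger than the exponents killing the two factors. There both factors are killed
  by a number prime to \<open>p\<close> and by a power of \<open>p\<close>, so they are
  trivial.\<close>

lemma torsion_mult:
  assumes "x \<in> torsion G" "y \<in> torsion G" shows "x \<otimes> y \<in> torsion G"
proof (rule ccontr)
  assume no: "x \<otimes> y \<notin> torsion G"
  obtain i j :: nat where ij: "x \<in> carrier G" "y \<in> carrier G" "i > 0" "j > 0" "x [^] i = \<one>" "y [^] j = \<one>"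
    using assms by (auto simp: torsion_def)
  obtain p where p: "normalization_semidom_class.prime p" "p > i + j"
    using bigger_prime by blast
  have "(x \<otimes> y) [^] m \<notin> {\<one>}" if "\<not> int p dvd m" for m :: int
    using no ij that torsion_iff_int_pow[of "x \<otimes> y"] by (metis dvd_0_right m_closed singletonD)
  then obtain M where M: "M \<lhd> G" "x \<otimes> y \<notin> M" "\<And>x. x \<in> carrier G \<Longrightarrow> \<exists>a. x [^] (p ^ a) \<in> M"
    using p_quotient_avoiding[OF p(1) one_is_normal] ij by blast
  have sub: "subgroup M G" using M(1) by (rule normal_imp_subgroup)
  have "z \<in> M" if z: "z \<in> carrier G" "k > 0" "k < p" "z [^] k = \<one>" for z and k :: nat
  proof -
    obtain a where "z [^] int (p ^ a) \<in> M" using M(3)[OF z(1)] unfolding int_pow_int by blast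
    moreover have "z [^] int k \<in> M" using z(4) sub unfolding int_pow_int by (simp add: subgroup.one_closed)
    moreover have "coprime k p"
      using p(1) z(2,3) by (meson coprime_commute nat_dvd_not_less prime_imp_coprime)
    then have "coprime (int (p ^ a)) (int k)"
      unfolding coprime_int_iff by (simp add: coprime_commute coprime_power_right_iff)
    ultimately show ?thesis using subgroup_coprime_powers[OF sub z(1)] by blast
  qed
  then have "x \<in> M" "y \<in> M" using ij p by auto
  then show False using M(2) subgroup.m_closed[OF sub] by blast
qed

lemma normal_torsion: "torsion G \<lhd> G"
  unfolding normal_inv_iff
proof (intro conjI ballI)
  show "subgroup (torsion G) G"
  proof (rule subgroupI)
    show "torsion G \<subseteq> carrier G" by (auto simp: torsion_def)
    have "\<one> \<in> torsion G" by (auto simp: torsion_def intro!: exI[of _ 1])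
    then show "torsion G \<noteq> {}" by blast
    show "inv x \<in> torsion G" if "x \<in> torsion G" for x
      using that by (auto simp: torsion_def nat_pow_inv)
  qed (rule torsion_mult)
  show "g \<otimes> x \<otimes> inv g \<in> torsion G" if "g \<in> carrier G" "x \<in> torsion G" for g x
    using that by (force simp: torsion_def conj_nat_pow)
qed

lemma p_quotient_avoiding_torsion:
  fixes p :: nat
  assumes "normalization_semidom_class.prime p" "g \<in> carrier G" "g \<notin> torsion G"
  obtains M where "M \<lhd> G" "torsion G \<subseteq> M" "g \<notin> M" "\<And>x. x \<in> carrier G \<Longrightarrow> \<exists>a. x [^] (p ^ a) \<in> M"
proof -
  have "g [^] m \<notin> torsion G" if "\<not> int p dvd m" for m :: int
    using int_pow_torsion[OF assms(2)] assms(3) that by auto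
  from p_quotient_avoiding[OF assms(1) normal_torsion assms(2) this] that show ?thesis by blast
qed

text \<open>Descent along the upper central series. If \<open>A\<close> and the term
  \<open>Suc i\<close> generate \<open>G\<close>, let \<open>B\<close> be generated by
  \<open>A\<close> and the term \<open>i\<close>. Both \<open>A\<close> and the term
  \<open>Suc i\<close> normalise \<open>B\<close>, so \<open>B\<close> is normal; in the quotient
  \<open>A\<close> is trivial and the term \<open>Suc i\<close> central, so the quotient is abelian.
  Then \<open>B\<close> contains \<open>A\<close> and all commutators, hence is
  \<open>G\<close>.\<close>

lemma generate_eq_carrier_of_commutators:
  assumes A: "A \<subseteq> carrier G"
    and gen: "generate G (A \<union> {gcomm G x y | x y. x \<in> carrier G \<and> y \<in> carrier G}) = carrier G"
  shows "generate G A = carrier G"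
proof -
  have "generate G (A \<union> upper_central G {\<one>} i) = carrier G \<Longrightarrow> generate G A = carrier G" for i
  proof (induction i)
    case 0
    have "generate G (A \<union> {\<one>}) \<subseteq> generate G A"
      using A by (intro generate_subgroup_incl generate_is_subgroup) (auto intro: generate.incl generate.one)
    then show ?case using 0 generate_incl[OF A] by auto
  next
    case (Suc i)
    let ?Z = "upper_central G {\<one>}"
    define B where "B = generate G (A \<union> ?Z i)"
    have Zn: "?Z j \<lhd> G" for j by (rule normal_upper_central[OF one_is_normal])
    have Zs: "subgroup (?Z j) G" for j using Zn by (rule normal_imp_subgroup)
    have Bs: "subgroup B G"
      unfolding B_def using A Zs[of i] by (intro generate_is_subgroup) (auto dest: subgroup.mem_carrier)
    have AB: "A \<subseteq> B" and ZB: "?Z i \<subseteq> B" by (auto simp: B_def intro: generate.incl)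
    have conjA: "g \<otimes> b \<otimes> inv g \<in> B" if "g \<in> B" "b \<in> B" for g b
      using that Bs by (simp add: subgroup.m_closed subgroup.m_inv_closed)
    have conjZ: "g \<otimes> b \<otimes> inv g \<in> B" if g: "g \<in> ?Z (Suc i)" and b: "b \<in> B" for g b
    proof -
      have car: "g \<in> carrier G" "b \<in> carrier G" using g b Bs by (auto simp: central_mod_def subgroup.mem_carrier)
      have "gcomm G g b \<in> B" using g car ZB by (auto simp: central_mod_def)
      then have "gcomm G g b \<otimes> b \<in> B" using b Bs by (simp add: subgroup.m_closed)
      then show ?thesis using car by (simp add: gcomm_def m_assoc)
    qed
    have "B \<lhd> G"
      unfolding normal_inv_iff
    proof (intro conjI ballI Bs)
      fix g b assume "g \<in> carrier G" "b \<in> B"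
      then have "g \<in> generate G (A \<union> ?Z (Suc i))" using Suc.prems by simp
      then show "g \<otimes> b \<otimes> inv g \<in> B" using \<open>b \<in> B\<close>
      proof (induction g arbitrary: b rule: generate.induct)
        case one
        then show ?case using subgroup.mem_carrier[OF Bs] by simp
      next
        case (incl h)
        then show ?case using conjA conjZ AB by blast
      next
        case (inv h)
        then show ?case using conjA[of "inv h" b] conjZ[of "inv h" b] AB subgroup.m_inv_closed[OF Bs, of h]
            subgroup.m_inv_closed[OF Zs[of "Suc i"], of h] by blast
      next
        case (eng h1 h2)
        have "A \<union> ?Z (Suc i) \<subseteq> carrier G" using A subgroup.subset[OF Zs] by blast
        then have "h1 \<in> carrier G" "h2 \<in> carrier G" "b \<in> carrier G"
          using eng.hyps eng.prems generate_in_carrier[of "A \<union> ?Z (Suc i)"] subgroup.mem_carrier[OF Bs] by blast+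
        then have "h1 \<otimes> h2 \<otimes> b \<otimes> inv (h1 \<otimes> h2) = h1 \<otimes> (h2 \<otimes> b \<otimes> inv h2) \<otimes> inv h1"
          by (simp add: inv_mult_group m_assoc)
        then show ?case using eng by simp
      qed
    qed
    then have cs: "subgroup (central_mod G B) G" and Bc: "B \<subseteq> central_mod G B"
      using normal_imp_subgroup[OF normal_central_mod] normal_subset_central_mod by blast+
    have "A \<union> ?Z (Suc i) \<subseteq> central_mod G B"
      using AB Bc central_mod_mono[OF ZB] by auto
    then have "generate G (A \<union> ?Z (Suc i)) \<subseteq> central_mod G B"
      using cs by (rule generate_subgroup_incl)
    then have "carrier G \<subseteq> central_mod G B" unfolding Suc.prems .
    then have "A \<union> {gcomm G x y | x y. x \<in> carrier G \<and> y \<in> carrier G} \<subseteq> B"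
      using AB by (auto simp: central_mod_def)
    from generate_subgroup_incl[OF this Bs] have "carrier G \<subseteq> B" unfolding gen .
    then show ?case using Suc.IH subgroup.subset[OF Bs] by (simp add: B_def)
  qed
  moreover obtain c where c: "upper_central G {\<one>} c = carrier G" using nilpotent by blast
  have "generate G (A \<union> upper_central G {\<one>} c) = carrier G"
    using A c generate_incl[of "carrier G"] by (auto simp: Un_absorb1 intro: generate.incl)
  ultimately show ?thesis by blast
qed

end

section \<open>Central chains with cyclic factors\<close>

text \<open>Members of a polycyclic series with central steps. Finiteness of the torsion and finite
  generation of subgroups are both inductions along it.\<close>

inductive central_chain :: "('a, 'b) monoid_scheme \<Rightarrow> 'a set \<Rightarrow> bool" for G where
  trivial: "central_chain G {\<one>\<^bsub>G\<^esub>}"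
| extend: "central_chain G N \<Longrightarrow> b \<in> central_mod G N \<Longrightarrow> central_chain G (cyclic_ext G N b)"

lemma (in group) normal_central_chain: "central_chain G N \<Longrightarrow> N \<lhd> G"
  by (induction rule: central_chain.induct) (auto simp: one_is_normal normal_cyclic_ext)

lemma (in group) central_chain_insert_finite:
  assumes "finite A" "central_chain G N" "A \<subseteq> central_mod G N"
  shows "\<exists>M. central_chain G M \<and> N \<union> A \<subseteq> M"
  using assms
proof (induction A rule: finite_induct)
  case (insert a A)
  then obtain M where M: "central_chain G M" "N \<union> A \<subseteq> M" by auto
  then have "a \<in> central_mod G M" using insert.prems central_mod_mono[of N M G] by auto
  moreover have "a \<in> carrier G" using insert.prems by (auto simp: central_mod_def)
  ultimately have "central_chain G (cyclic_ext G M a)" "M \<subseteq> cyclic_ext G M a" "a \<in> cyclic_ext G M a"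
    using central_chain.extend[OF M(1)] subset_cyclic_ext[OF normal_central_chain[OF M(1)]]
      mem_cyclic_ext[of a M] by simp_all
  then show ?case using M(2) by blast
qed auto

section \<open>Existence of central chains and finiteness of torsion\<close>

context fg_nilpotent_group
begin

text \<open>The finite sets \<open>C i\<close> of left-normed commutators of weight
  \<open>i + 1\<close> in the generators are adjoined with the longest first. Commutators of
  \<open>C i\<close> with generators lie in \<open>C (Suc i)\<close>, so \<open>C i\<close> is
  central modulo a chain member containing \<open>C (Suc i)\<close>; the start is possible because
  \<open>C c\<close> is trivial.\<close>

lemma central_chain_carrier: "central_chain G (carrier G)"
proof -
  obtain S where S: "finite S" "S \<subseteq> carrier G" "generate G S = carrier G"
    using finitely_generated by (auto simp: finite_generating_set_def)
  obtain c where c: "upper_central G {\<one>} c = carrier G" using nilpotent by blast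
  define C where "C i = ((\<lambda>A. (\<lambda>(x, s). gcomm G x s) ` (A \<times> S)) ^^ i) S" for i :: nat
  have C: "finite (C i) \<and> C i \<subseteq> carrier G \<and> (i \<le> c \<longrightarrow> C i \<subseteq> upper_central G {\<one>} (c - i))" for i
  proof (induction i)
    case (Suc i)
    have "gcomm G x s \<in> upper_central G {\<one>} (c - Suc i)" if "x \<in> C i" "s \<in> S" "Suc i \<le> c" for x s
    proof -
      have "x \<in> upper_central G {\<one>} (Suc (c - Suc i))"
        using that Suc by (auto simp: Suc_diff_Suc simp del: upper_central.simps)
      then show ?thesis using that S by (auto simp: central_mod_def)
    qed
    moreover have "gcomm G x s \<in> carrier G" if "x \<in> C i" "s \<in> S" for x s
      using that Suc S(2) by (meson gcomm_closed subsetD)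
    moreover have "C (Suc i) = (\<lambda>(x, s). gcomm G x s) ` (C i \<times> S)" by (simp add: C_def)
    moreover have "finite (C i \<times> S)" using Suc S(1) by blast
    ultimately show ?case by (auto simp del: upper_central.simps)
  qed (use S c in \<open>auto simp: C_def\<close>)
  have "j \<le> c \<Longrightarrow> \<exists>N. central_chain G N \<and> C (c - j) \<subseteq> N" for j
  proof (induction j)
    case 0
    then show ?case using C[of c] central_chain.trivial[of G] by auto
  next
    case (Suc j)
    then obtain N where N: "central_chain G N" "C (c - j) \<subseteq> N" by auto
    have "Suc (c - Suc j) = c - j" using Suc.prems by simp
    then have "C (c - j) = (\<lambda>(x, s). gcomm G x s) ` (C (c - Suc j) \<times> S)"
      unfolding C_def by (metis comp_apply funpow.simps(2))
    then have "gcomm G x s \<in> N" if "x \<in> C (c - Suc j)" "s \<in> S" for x s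
      using N(2) that by blast
    then have "C (c - Suc j) \<subseteq> central_mod G N"
      using central_modI_generate[OF normal_central_chain[OF N(1)] _ S(2,3)] C[of "c - Suc j"] by blast
    from central_chain_insert_finite[OF _ N(1) this] C[of "c - Suc j"] show ?case by blast
  qed
  from this[of c] obtain N where N: "central_chain G N" "S \<subseteq> N" by (auto simp: C_def)
  then have "subgroup N G" using normal_central_chain normal_imp_subgroup by blast
  then have "N = carrier G"
    using S N generate_subgroup_incl[of S N] subgroup.subset by blast
  then show ?thesis using N by simp
qed

text \<open>If \<open>b\<close> has finite order modulo \<open>N\<close>, finitely many cosets are
  involved, and division by one torsion element of a coset injects the torsion of that coset into
  \<open>N\<close>. If \<open>b\<close> has infinite order modulo \<open>N\<close>, torsion elements
  of the extension lie in \<open>N\<close> already.\<close>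

lemma finite_torsion_Int_central_chain: "central_chain G N \<Longrightarrow> finite (torsion G \<inter> N)"
proof (induction rule: central_chain.induct)
  case (extend N b)
  have Nn: "N \<lhd> G" using extend normal_central_chain by blast
  have Ns: "subgroup N G" using Nn by (rule normal_imp_subgroup)
  have Ts: "subgroup (torsion G) G" using normal_torsion by (rule normal_imp_subgroup)
  have b: "b \<in> carrier G" using extend by (auto simp: central_mod_def)
  interpret q: group_hom G "G Mod N" "(#>) N" using Nn by (rule hom_Mod)
  show ?case
  proof (cases "\<exists>r::int. r > 0 \<and> b [^] r \<in> N")
    case True
    then obtain r :: int where r: "r > 0" "b [^] r \<in> N" by blast
    have "torsion G \<inter> cyclic_ext G N b \<subseteq> (\<Union>j\<in>{0..<r}. {x \<in> torsion G. N #> x = N #> b [^] j})"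
    proof
      fix x assume x: "x \<in> torsion G \<inter> cyclic_ext G N b"
      then obtain k :: int where k: "N #> x = N #> b [^] k" by (auto simp: cyclic_ext_def)
      have "b [^] k \<otimes> inv (b [^] (k mod r)) = b [^] (r * (k div r))"
        using b by (simp add: int_pow_diff[symmetric] minus_mod_eq_mult_div)
      also have "\<dots> = (b [^] r) [^] (k div r)" using b by (simp add: int_pow_pow)
      also have "\<dots> \<in> N" using subgroup_int_pow_closed[OF Ns r(2)] .
      finally have "N #> b [^] k = N #> b [^] (k mod r)"
        using coset_eq_iff[OF Ns, of "b [^] k" "b [^] (k mod r)"] b by simp
      then show "x \<in> (\<Union>j\<in>{0..<r}. {x \<in> torsion G. N #> x = N #> b [^] j})"
        using x k r by (intro UN_I[of "k mod r"]) auto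
    qed
    moreover have "finite {x \<in> torsion G. N #> x = N #> b [^] j}" (is "finite ?F") for j :: int
    proof (cases "?F = {}")
      case ne: False
      then obtain y where y: "y \<in> torsion G" "N #> y = N #> b [^] j" by blast
      then have yc: "y \<in> carrier G" by (simp add: torsion_def)
      have "(\<lambda>x. x \<otimes> inv y) ` ?F \<subseteq> torsion G \<inter> N"
      proof
        fix z assume "z \<in> (\<lambda>x. x \<otimes> inv y) ` ?F"
        then obtain x where x: "x \<in> torsion G" "N #> x = N #> y" "z = x \<otimes> inv y" using y by auto
        then have "x \<in> carrier G" by (simp add: torsion_def)
        then have "x \<otimes> inv y \<in> N" using x(2) yc coset_eq_iff[OF Ns] by blast
        then show "z \<in> torsion G \<inter> N"
          using x y subgroup.m_closed[OF Ts] subgroup.m_inv_closed[OF Ts] by auto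
      qed
      then have "finite ((\<lambda>x. x \<otimes> inv y) ` ?F)" using extend.IH finite_subset by blast
      moreover have "inj_on (\<lambda>x. x \<otimes> inv y) ?F"
        using yc by (auto simp: inj_on_def torsion_def)
      ultimately show ?thesis using finite_imageD by blast
    next
      case em: True
      show ?thesis unfolding em by simp
    qed
    ultimately show ?thesis by (meson finite_UN_I finite_atLeastLessThan_int finite_subset)
  next
    case False
    have "torsion G \<inter> cyclic_ext G N b \<subseteq> torsion G \<inter> N"
    proof
      fix x assume x: "x \<in> torsion G \<inter> cyclic_ext G N b"
      then obtain k :: int where xc: "x \<in> carrier G" and k: "N #> x = N #> b [^] k" by (auto simp: cyclic_ext_def)
      obtain m :: int where m: "m \<noteq> 0" "x [^] m = \<one>" using x xc torsion_iff_int_pow by auto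
      have "N #> b [^] (k * m) = N #> x [^] m"
        using k xc b by (simp add: int_pow_pow[symmetric] q.hom_int_pow[of "b [^] k"] q.hom_int_pow[of x])
      then have "b [^] (k * m) \<in> N"
        using m(2) coset_one_iff[OF Nn, of "b [^] (k * m)"] b by simp
      moreover from this have "b [^] (- (k * m)) \<in> N"
        using b subgroup.m_inv_closed[OF Ns] by (simp add: int_pow_neg)
      ultimately have "k * m = 0" using False by (metis linorder_neqE_linordered_idom neg_0_less_iff_less)
      then have "k = 0" using m by simp
      then have "N #> x = \<one>\<^bsub>G Mod N\<^esub>" using k by (simp only: int_pow_0 q.hom_one)
      then show "x \<in> torsion G \<inter> N" using x coset_one_iff[OF Nn xc] by blast
    qed
    then show ?thesis using extend.IH finite_subset by blast
  qed
qed simp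

lemma finite_torsion: "finite (torsion G)"
proof -
  have "torsion G \<inter> carrier G = torsion G" by (auto simp: torsion_def)
  then show ?thesis using finite_torsion_Int_central_chain[OF central_chain_carrier] by simp
qed

lemma torsion_exponent: "\<exists>e::nat. e > 0 \<and> (\<forall>x\<in>torsion G. x [^] e = \<one>)"
proof -
  have "\<exists>e. \<forall>x\<in>torsion G. x \<in> carrier G \<and> (\<exists>n::nat. 0 < n \<and> n \<le> e \<and> x [^] n = \<one>)"
  proof (rule finite_uniform_bound[OF finite_torsion])
    show "\<exists>e. x \<in> carrier G \<and> (\<exists>n::nat. 0 < n \<and> n \<le> e \<and> x [^] n = \<one>)" if "x \<in> torsion G" for x
      using that unfolding torsion_def by blast
    show "x \<in> carrier G \<and> (\<exists>n::nat. 0 < n \<and> n \<le> b \<and> x [^] n = \<one>)"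
      if "x \<in> carrier G \<and> (\<exists>n::nat. 0 < n \<and> n \<le> a \<and> x [^] n = \<one>)" "a \<le> b" for x and a b :: nat
      using that by (meson le_trans)
  qed
  then obtain e where e: "\<And>x. x \<in> torsion G \<Longrightarrow> x \<in> carrier G \<and> (\<exists>n::nat. 0 < n \<and> n \<le> e \<and> x [^] n = \<one>)" by blast
  \<comment> \<open>All orders are bounded by \<open>e\<close>, hence divide
    \<open>fact e\<close>.\<close>
  have "x [^] (fact e :: nat) = \<one>" if x: "x \<in> torsion G" for x
  proof -
    obtain n where n: "x \<in> carrier G" "0 < n" "n \<le> e" "x [^] n = \<one>" using e[OF x] by blast
    then have "n dvd fact e" by (simp add: dvd_fact)
    then obtain k where "fact e = n * k" by (auto simp: dvd_def)
    then show ?thesis using n by (simp add: nat_pow_pow[symmetric])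
  qed
  then show ?thesis by (intro exI[of _ "fact e"]) auto
qed

end

text \<open>The image of \<open>L\<close> in the cyclic factor is generated by the least positive
  exponent \<open>d\<close> of \<open>b\<close> that occurs. A lift \<open>l\<close> of it, together
  with generators of \<open>L \<inter> N\<close>, generates \<open>L\<close> by division with
  remainder.\<close>

lemma (in group) finite_generating_subgroup_of_central_chain:
  "central_chain G N \<Longrightarrow> subgroup L G \<Longrightarrow> L \<subseteq> N \<Longrightarrow> \<exists>A. finite A \<and> A \<subseteq> L \<and> generate G A = L"
proof (induction arbitrary: L rule: central_chain.induct)
  case trivial
  then have "L = {\<one>}" using subgroup.one_closed[OF trivial(1)] by blast
  then show ?case using generate_one by (intro exI[of _ "{\<one>}"]) simp
next
  case (extend N b)
  have Nn: "N \<lhd> G" using normal_central_chain[OF extend(1)] .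
  have Ns: "subgroup N G" using Nn by (rule normal_imp_subgroup)
  have b: "b \<in> carrier G" using extend(2) by (simp add: central_mod_def)
  interpret q: group_hom G "G Mod N" "(#>) N" using Nn by (rule hom_Mod)
  have Lc: "x \<in> carrier G" if "x \<in> L" for x using that extend.prems(1) by (meson subgroup.mem_carrier)
  have "subgroup (L \<inter> N) G" using Ns extend.prems(1) by (simp add: subgroups_Inter_pair)
  then obtain A where A: "finite A" "A \<subseteq> L \<inter> N" "generate G A = L \<inter> N"
    using extend.IH[of "L \<inter> N"] by blast
  define D where "D k \<longleftrightarrow> (\<exists>x\<in>L. N #> x = N #> b [^] (int k))" for k :: nat
  show ?case
  proof (cases "\<exists>k>0. D k")
    case False
    have "L \<subseteq> N"
    proof
      fix x assume x: "x \<in> L"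
      then obtain k :: int where k: "N #> x = N #> b [^] k" using extend.prems(2) unfolding cyclic_ext_def by blast
      \<comment> \<open>\<open>D\<close> speaks of natural exponents only; inverses cover the
        negative ones.\<close>
      have "N #> inv x = N #> b [^] (- k)"
        using k Lc[OF x] b q.hom_inv[of x] q.hom_inv[of "b [^] k"] by (simp only: int_pow_neg int_pow_closed)
      moreover have "inv x \<in> L" using x extend.prems(1) by (simp add: subgroup.m_inv_closed)
      ultimately have neg: "k \<le> 0 \<Longrightarrow> D (nat (- k))"
        unfolding D_def by (metis int_nat_eq neg_0_le_iff_le)
      have "k \<ge> 0 \<Longrightarrow> D (nat k)"
        using k x unfolding D_def by (metis int_nat_eq)
      moreover have "\<not> D (nat k)" if "k > 0"
      proof -
        have "nat k > 0" using that by simp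
        then show ?thesis using False by blast
      qed
      moreover have "\<not> D (nat (- k))" if "k < 0"
      proof -
        have "nat (- k) > 0" using that by simp
        then show ?thesis using False by blast
      qed
      ultimately have "k = 0" using neg by linarith
      then have "N #> x = \<one>\<^bsub>G Mod N\<^esub>" using k by (simp only: int_pow_0 q.hom_one)
      then show "x \<in> N" using coset_one_iff[OF Nn Lc[OF x]] by blast
    qed
    then have "L \<inter> N = L" by blast
    then show ?thesis using A by auto
  next
    case True
    define d where "d = (LEAST k. k > 0 \<and> D k)"
    have d: "d > 0" "D d" and dmin: "\<And>k. k > 0 \<Longrightarrow> D k \<Longrightarrow> d \<le> k"
      using LeastI_ex[OF True] unfolding d_def by (blast intro: Least_le)+
    from d(2) obtain l where l: "l \<in> L" "N #> l = N #> b [^] (int d)" unfolding D_def by blast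
    have AL: "insert l A \<subseteq> L" using l A by blast
    then have "generate G (insert l A) \<subseteq> L" using generate_subgroup_incl extend.prems(1) by blast
    moreover have "L \<subseteq> generate G (insert l A)"
    proof
      fix x assume x: "x \<in> L"
      then obtain k :: int where k: "N #> x = N #> b [^] k" using extend.prems(2) unfolding cyclic_ext_def by blast
      define y where "y = x \<otimes> inv (l [^] (k div int d))"
      have lp: "l [^] (k div int d) \<in> L" using subgroup_int_pow_closed[OF extend.prems(1) l(1)] .
      have yL: "y \<in> L"
        using x lp extend.prems(1) by (simp add: y_def subgroup.m_closed subgroup.m_inv_closed)
      have "N #> y = N #> b [^] (k - int d * (k div int d))"
        using k l Lc x lp b
        by (simp add: y_def int_pow_diff q.hom_int_pow[of l] q.hom_int_pow[of "b [^] int d"] int_pow_pow[symmetric])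
      also have "k - int d * (k div int d) = int (nat (k mod int d))"
        using d by (simp add: minus_mult_div_eq_mod)
      finally have y: "N #> y = N #> b [^] int (nat (k mod int d))" .
      then have "D (nat (k mod int d))" using yL unfolding D_def by blast
      moreover have "nat (k mod int d) < d" using d by (simp add: nat_less_iff)
      ultimately have "nat (k mod int d) = 0" using dmin[of "nat (k mod int d)"] by linarith
      then have "N #> y = \<one>\<^bsub>G Mod N\<^esub>" using y by (simp only: of_nat_0 int_pow_0 q.hom_one)
      then have "y \<in> L \<inter> N" using coset_one_iff[OF Nn Lc[OF yL]] yL by blast
      then have "y \<in> generate G (insert l A)"
        using A AL generate_mono_subgroup[of A "insert l A"] Lc by blast
      moreover have "subgroup (generate G (insert l A)) G"
        using AL Lc by (intro generate_is_subgroup) blast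
      moreover have "l \<in> generate G (insert l A)" by (simp add: generate.incl)
      ultimately have "y \<otimes> l [^] (k div int d) \<in> generate G (insert l A)"
        by (simp add: subgroup.m_closed subgroup_int_pow_closed)
      then show "x \<in> generate G (insert l A)"
        using Lc x lp by (simp add: y_def m_assoc)
    qed
    ultimately show ?thesis using AL A(1) by (intro exI[of _ "insert l A"]) auto
  qed
qed

lemma (in fg_nilpotent_group) subgroup_finitely_generated:
  assumes "subgroup L G" shows "\<exists>A. finite A \<and> A \<subseteq> L \<and> generate G A = L"
  using finite_generating_subgroup_of_central_chain[OF central_chain_carrier assms] assms subgroup.subset by blast

section \<open>Words\<close>

definition letters :: "word \<Rightarrow> nat set" where
  "letters w = fst ` set w"

definition word_inv :: "word \<Rightarrow> word" where
  "word_inv w = rev (map (\<lambda>(i, e). (i, \<not> e)) w)"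

definition word_subst :: "(nat \<Rightarrow> word) \<Rightarrow> word \<Rightarrow> word" where
  "word_subst v w = concat (map (\<lambda>(i, e). if e then v i else word_inv (v i)) w)"

lemma letters_simps [simp]:
  "letters [] = {}" "letters (l # w) = insert (fst l) (letters w)"
  "letters (w @ w') = letters w \<union> letters w'" "letters (word_inv w) = letters w"
  by (force simp: letters_def word_inv_def)+

lemma length_word_inv [simp]: "length (word_inv w) = length w"
  by (simp add: word_inv_def)

lemma finite_letters [simp]: "finite (letters w)"
  by (simp add: letters_def)

lemma letters_word_subst: "letters (word_subst v w) \<subseteq> (\<Union>i\<in>letters w. letters (v i))"
proof (induction w)
  case (Cons l w)
  then show ?case by (cases l) (auto simp: word_subst_def)
qed (simp add: word_subst_def)

lemma word_value_cong:
  "(\<And>i. i \<in> letters w \<Longrightarrow> x i = y i) \<Longrightarrow> word_value G x w = word_value G y w"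
proof (induction w)
  case (Cons l w)
  then show ?case by (cases l) auto
qed simp

section \<open>Evaluation of words\<close>

context group
begin

lemma word_value_closed [simp]:
  "(\<And>i. x i \<in> carrier G) \<Longrightarrow> word_value G x w \<in> carrier G"
proof (induction w)
  case (Cons l w)
  then show ?case by (cases l) auto
qed simp

lemma word_value_append:
  assumes "\<And>i. x i \<in> carrier G"
  shows "word_value G x (w @ w') = word_value G x w \<otimes> word_value G x w'"
proof (induction w)
  case (Cons l w)
  then show ?case using assms by (cases l) (auto simp: m_assoc)
qed (use assms in simp)

lemma word_value_inv:
  assumes "\<And>i. x i \<in> carrier G"
  shows "word_value G x (word_inv w) = inv (word_value G x w)"
proof (induction w)
  case (Cons l w)
  then show ?case
    using assms by (cases l) (auto simp: word_inv_def word_value_append inv_mult_group)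
qed (simp add: word_inv_def)

lemma word_value_subst:
  assumes "\<And>i. x i \<in> carrier G"
  shows "word_value G x (word_subst v w) = word_value G (\<lambda>i. word_value G x (v i)) w"
proof (induction w)
  case (Cons l w)
  then show ?case
    using assms by (cases l) (auto simp: word_subst_def word_value_append word_value_inv)
qed (simp add: word_subst_def)

lemma word_value_concat_replicate:
  assumes "\<And>i. x i \<in> carrier G"
  shows "word_value G x (concat (replicate n w)) = word_value G x w [^] n"
proof (induction n)
  case (Suc n)
  then show ?case using assms
    by (simp add: word_value_append nat_pow_Suc2[symmetric] del: nat_pow_Suc)
qed simp

lemma word_value_generate:
  assumes "\<And>i. x i \<in> carrier G" "letters w \<subseteq> I"
  shows "word_value G x w \<in> generate G (x ` I)"
  using assms(2)
proof (induction w)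
  case (Cons l w)
  obtain i e where l: "l = (i, e)" by (cases l)
  have "(if e then x i else inv (x i)) \<in> generate G (x ` I)"
    using Cons.prems l by (auto intro: generate.incl generate.inv)
  then show ?case using Cons l by (simp add: generate.eng)
qed (simp add: generate.one)

lemma generate_word_value:
  assumes "\<And>i. x i \<in> carrier G"
  shows "generate G (x ` I) = {word_value G x w | w. letters w \<subseteq> I}"
proof (intro equalityI subsetI)
  fix g assume "g \<in> generate G (x ` I)"
  then have "\<exists>w. g = word_value G x w \<and> letters w \<subseteq> I"
  proof (induction rule: generate.induct)
    case one
    then show ?case by (intro exI[of _ "[]"]) simp
  next
    case (incl h)
    then obtain i where "i \<in> I" "h = x i" by blast
    then show ?case using assms by (intro exI[of _ "[(i, True)]"]) simp
  next
    case (inv h)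
    then obtain i where "i \<in> I" "h = x i" by blast
    then show ?case using assms by (intro exI[of _ "[(i, False)]"]) simp
  next
    case (eng h1 h2)
    then obtain v w where "h1 = word_value G x v" "letters v \<subseteq> I" "h2 = word_value G x w" "letters w \<subseteq> I"
      by blast
    then show ?case using assms by (intro exI[of _ "v @ w"]) (simp add: word_value_append)
  qed
  then show "g \<in> {word_value G x w | w. letters w \<subseteq> I}" by blast
next
  fix g assume "g \<in> {word_value G x w | w. letters w \<subseteq> I}"
  then show "g \<in> generate G (x ` I)" using word_value_generate[of x, OF assms] by blast
qed

end

lemma (in group_hom) hom_word_value:
  assumes "\<And>i. x i \<in> carrier G"
  shows "h (word_value G x w) = word_value H (\<lambda>i. h (x i)) w"
proof (induction w)
  case (Cons l w)
  then show ?case using assms by (cases l) auto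
qed simp

section \<open>Generating tuples avoiding finitely many identities\<close>

context fg_nilpotent_group
begin

text \<open>Modulo a suitable \<open>M\<close> the finitely many \<open>v i\<close> that occur in
  \<open>w\<close> have a common \<open>p\<close>-power exponent, so the value depends only on
  \<open>n\<close> modulo it. Since \<open>M\<close> contains the torsion, survival modulo
  \<open>M\<close> again means infinite order, which allows the lemma to be applied
  repeatedly.\<close>

lemma word_value_nontorsion_progression:
  fixes p :: nat and n0 :: int
  assumes p: "normalization_semidom_class.prime p"
    and uv: "\<And>i. u i \<in> carrier G" "\<And>i. v i \<in> carrier G"
    and nt: "word_value G (\<lambda>i. u i \<otimes> v i [^] n0) w \<notin> torsion G"
  shows "\<exists>a. \<forall>n. int (p ^ a) dvd n - n0 \<longrightarrow> word_value G (\<lambda>i. u i \<otimes> v i [^] n) w \<notin> torsion G"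
proof -
  have car: "u i \<otimes> v i [^] n \<in> carrier G" for i and n :: int using uv by simp
  obtain M where M: "M \<lhd> G" "torsion G \<subseteq> M" "word_value G (\<lambda>i. u i \<otimes> v i [^] n0) w \<notin> M"
      "\<And>x. x \<in> carrier G \<Longrightarrow> \<exists>a. x [^] (p ^ a) \<in> M"
    using p_quotient_avoiding_torsion[OF p word_value_closed[of "\<lambda>i. u i \<otimes> v i [^] n0", OF car] nt] by blast
  have Ms: "subgroup M G" using M(1) by (rule normal_imp_subgroup)
  interpret q: group_hom G "G Mod M" "(#>) M" using M(1) by (rule hom_Mod)
  have "\<exists>a. \<forall>i\<in>letters w. v i [^] (p ^ a :: nat) \<in> M"
  proof (rule finite_uniform_bound)
    show "\<exists>a. v i [^] (p ^ a) \<in> M" for i using M(4) uv by blast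
    show "v i [^] (p ^ b) \<in> M" if "v i [^] (p ^ a) \<in> M" "a \<le> b" for i a b
      using pow_power_mono[OF Ms uv(2)] that by blast
  qed simp
  then obtain a where a: "\<And>i. i \<in> letters w \<Longrightarrow> v i [^] int (p ^ a) \<in> M" unfolding int_pow_int by blast
  have "word_value G (\<lambda>i. u i \<otimes> v i [^] n) w \<notin> torsion G" if n: "int (p ^ a) dvd n - n0" for n
  proof -
    obtain k where k: "n - n0 = int (p ^ a) * k" using n by (auto simp: dvd_def)
    have "M #> (u i \<otimes> v i [^] n) = M #> (u i \<otimes> v i [^] n0)" if i: "i \<in> letters w" for i
    proof -
      have "v i [^] n \<otimes> inv (v i [^] n0) = v i [^] (int (p ^ a) * k)"
        unfolding k[symmetric] using uv by (simp only: int_pow_diff)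
      also have "\<dots> = (v i [^] int (p ^ a)) [^] k" by (rule int_pow_pow[OF uv(2), symmetric])
      also have "\<dots> \<in> M" using subgroup_int_pow_closed[OF Ms a[OF i]] .
      finally have "M #> v i [^] n = M #> v i [^] n0"
        using coset_eq_iff[OF Ms, of "v i [^] n" "v i [^] n0"] uv by blast
      then show ?thesis using uv by simp
    qed
    then have "M #> word_value G (\<lambda>i. u i \<otimes> v i [^] n) w = M #> word_value G (\<lambda>i. u i \<otimes> v i [^] n0) w"
      unfolding q.hom_word_value[of "\<lambda>i. u i \<otimes> v i [^] n", OF car]
        q.hom_word_value[of "\<lambda>i. u i \<otimes> v i [^] n0", OF car] by (rule word_value_cong)
    then have "word_value G (\<lambda>i. u i \<otimes> v i [^] n) w \<notin> M"
      using M(3) coset_one_iff[OF M(1) word_value_closed[of "\<lambda>i. u i \<otimes> v i [^] n", OF car]]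
        coset_one_iff[OF M(1) word_value_closed[of "\<lambda>i. u i \<otimes> v i [^] n0", OF car]] by metis
    then show ?thesis using M(2) by blast
  qed
  then show ?thesis by blast
qed

lemma word_values_nontorsion_progression:
  fixes p :: nat and n0 :: int
  assumes p: "normalization_semidom_class.prime p"
    and uv: "\<And>i. u i \<in> carrier G" "\<And>i. v i \<in> carrier G"
    and "finite \<Omega>" "\<And>w. w \<in> \<Omega> \<Longrightarrow> word_value G (\<lambda>i. u i \<otimes> v i [^] n0) w \<notin> torsion G"
  shows "\<exists>a. \<forall>w\<in>\<Omega>. \<forall>n. int (p ^ a) dvd n - n0 \<longrightarrow> word_value G (\<lambda>i. u i \<otimes> v i [^] n) w \<notin> torsion G"
proof (rule finite_uniform_bound[OF assms(4)])
  fix w assume "w \<in> \<Omega>"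
  then show "\<exists>a. \<forall>n. int (p ^ a) dvd n - n0 \<longrightarrow> word_value G (\<lambda>i. u i \<otimes> v i [^] n) w \<notin> torsion G"
    using word_value_nontorsion_progression[OF p, of u v, OF uv] assms(5) by blast
next
  fix w and a b :: nat
  assume *: "\<forall>n. int (p ^ a) dvd n - n0 \<longrightarrow> word_value G (\<lambda>i. u i \<otimes> v i [^] n) w \<notin> torsion G" "a \<le> b"
  have "p ^ a dvd p ^ b" using *(2) by (rule le_imp_power_dvd)
  then have "int (p ^ a) dvd int (p ^ b)" by (rule of_nat_dvd_iff[THEN iffD2])
  then show "\<forall>n. int (p ^ b) dvd n - n0 \<longrightarrow> word_value G (\<lambda>i. u i \<otimes> v i [^] n) w \<notin> torsion G"
    using *(1) dvd_trans by blast
qed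

text \<open>The path \<open>y i \<otimes> v i [^] n\<close> is \<open>y\<close> at 0 and
  \<open>z\<close> at 1. An exponent divisible by a high power of 2 keeps the words handled by
  \<open>y\<close>; congruent to 1 modulo a high power of 3, it also keeps the word handled by
  \<open>z\<close>.\<close>

lemma common_nontorsion_tuple:
  assumes "finite \<Omega>" "\<And>w. w \<in> \<Omega> \<Longrightarrow> \<exists>y. (\<forall>i. y i \<in> carrier G) \<and> word_value G y w \<notin> torsion G"
  shows "\<exists>y. (\<forall>i. y i \<in> carrier G) \<and> (\<forall>w\<in>\<Omega>. word_value G y w \<notin> torsion G)"
  using assms
proof (induction \<Omega> rule: finite_induct)
  case empty
  show ?case by (intro exI[of _ "\<lambda>_. \<one>"]) simp
next
  case (insert w \<Omega>)
  then obtain y z where y: "\<And>i. y i \<in> carrier G" "\<And>w. w \<in> \<Omega> \<Longrightarrow> word_value G y w \<notin> torsion G"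
    and z: "\<And>i. z i \<in> carrier G" "word_value G z w \<notin> torsion G" by (metis insertCI)
  define v where "v i = inv (y i) \<otimes> z i" for i
  have v: "v i \<in> carrier G" for i using y z by (simp add: v_def)
  have 0: "(\<lambda>i. y i \<otimes> v i [^] (0::int)) = y" using y by simp
  have 1: "(\<lambda>i. y i \<otimes> v i [^] (1::int)) = z"
    using y z by (auto simp: v_def int_pow_1 m_assoc[symmetric])
  obtain a where a: "\<And>w n. w \<in> \<Omega> \<Longrightarrow> int (2 ^ a) dvd n - 0 \<Longrightarrow> word_value G (\<lambda>i. y i \<otimes> v i [^] n) w \<notin> torsion G"
    using word_values_nontorsion_progression[OF two_is_prime_nat, of y v, OF y(1) v insert.hyps(1), of 0] y(2)
    unfolding 0 by blast
  have "normalization_semidom_class.prime (3::nat)" by simp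
  then obtain b where b: "\<And>n. int (3 ^ b) dvd n - 1 \<Longrightarrow> word_value G (\<lambda>i. y i \<otimes> v i [^] n) w \<notin> torsion G"
    using word_value_nontorsion_progression[of 3 y v 1 w, OF _ y(1) v] z(2) unfolding 1 by blast
  have "coprime (2 ^ a :: int) (3 ^ b)" by simp
  then obtain r s where rs: "r * 2 ^ a + s * 3 ^ b = (1::int)"
    using bezout_int[of "2 ^ a" "3 ^ b"] by (metis coprime_iff_gcd_eq_1)
  define n where "n = r * 2 ^ a"
  have "n - 1 = 3 ^ b * (- s)" using rs by (simp add: n_def algebra_simps)
  then have "int (2 ^ a) dvd n - 0" "int (3 ^ b) dvd n - 1" by (auto simp: n_def)
  then show ?case
    using a b y(1) v by (intro exI[of _ "\<lambda>i. y i \<otimes> v i [^] n"]) auto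
qed

text \<open>In a \<open>2\<close>-group quotient that is abelian and contains the perturbed generators \<open>g\<^sub>i c\<^sub>i\<^sup>n\<close>, every
  element is a square, hence trivial.\<close>

lemma odd_power_in_perturbation:
  fixes d :: nat and n :: int
  assumes g: "\<And>i. g i \<in> carrier G" and gen: "generate G (g ` {..<d}) = carrier G"
    and c: "\<And>i. c i \<in> carrier G" and n: "even n" and x: "x \<in> carrier G"
  shows "\<exists>m::int. odd m \<and> x [^] m \<in> generate G ((\<lambda>i. g i \<otimes> c i [^] n) ` {..<d} \<union>
    {gcomm G x y | x y. x \<in> carrier G \<and> y \<in> carrier G})" (is "\<exists>m. _ \<and> _ \<in> ?M")
proof (rule ccontr)
  assume no: "\<not> (\<exists>m::int. odd m \<and> x [^] m \<in> ?M)"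
  have Ms: "subgroup ?M G"
    using g c by (intro generate_is_subgroup) auto
  have comm: "gcomm G a b \<in> ?M" if "a \<in> carrier G" "b \<in> carrier G" for a b
    using that by (intro generate.incl) blast
  have Mn: "?M \<lhd> G"
    unfolding normal_inv_iff
  proof (intro conjI ballI Ms)
    fix a b assume ab: "a \<in> carrier G" "b \<in> ?M"
    then have bc: "b \<in> carrier G" using subgroup.mem_carrier[OF Ms] by blast
    have "gcomm G a b \<otimes> b \<in> ?M" using comm ab bc by (intro subgroup.m_closed[OF Ms])
    then show "a \<otimes> b \<otimes> inv a \<in> ?M" using ab bc by (simp add: gcomm_def m_assoc)
  qed
  have "x [^] m \<notin> ?M" if "\<not> int 2 dvd m" for m :: int
  proof -
    have "odd m" using that by simp
    then show ?thesis using no by blast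
  qed
  then obtain M where M: "M \<lhd> G" "?M \<subseteq> M" "x \<notin> M" "\<And>y. y \<in> carrier G \<Longrightarrow> \<exists>a. y [^] ((2::nat) ^ a) \<in> M"
    using p_quotient_avoiding[OF two_is_prime_nat Mn x] by blast
  interpret q: group_hom G "G Mod M" "(#>) M" using M(1) by (rule hom_Mod)
  have surj: "\<exists>y\<in>carrier G. z = M #> y" if "z \<in> carrier (G Mod M)" for z
    using that by (auto simp: carrier_FactGroup)
  interpret Q: comm_group "G Mod M"
  proof (rule q.H.group_comm_groupI)
    fix a b assume "a \<in> carrier (G Mod M)" "b \<in> carrier (G Mod M)"
    then obtain a' b' where "a' \<in> carrier G" "a = M #> a'" "b' \<in> carrier G" "b = M #> b'" using surj by meson
    then show "a \<otimes>\<^bsub>G Mod M\<^esub> b = b \<otimes>\<^bsub>G Mod M\<^esub> a"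
      using gcomm_in_normal_iff[OF M(1)] comm M(2) by blast
  qed
  have genQ: "K = carrier (G Mod M)" if K: "subgroup K (G Mod M)" "\<And>i. i < d \<Longrightarrow> M #> g i \<in> K" for K
  proof -
    have "(#>) M ` generate G (g ` {..<d}) = generate (G Mod M) ((#>) M ` g ` {..<d})"
      using g by (intro q.generate_img[symmetric]) auto
    also have "\<dots> \<subseteq> K" using K by (intro q.H.generate_subgroup_incl) auto
    finally have "carrier (G Mod M) \<subseteq> K" unfolding gen carrier_FactGroup .
    then show ?thesis using subgroup.subset[OF K(1)] by blast
  qed
  have subpow: "subgroup {y \<in> carrier (G Mod M). \<exists>z\<in>carrier (G Mod M). y = z [^]\<^bsub>G Mod M\<^esub> (k::int)} (G Mod M)" for k
  proof (rule q.H.subgroupI)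
    fix a assume "a \<in> {y \<in> carrier (G Mod M). \<exists>z\<in>carrier (G Mod M). y = z [^]\<^bsub>G Mod M\<^esub> k}"
    then obtain z where z: "z \<in> carrier (G Mod M)" "a = z [^]\<^bsub>G Mod M\<^esub> k" by blast
    then have "inv\<^bsub>G Mod M\<^esub> a = (inv\<^bsub>G Mod M\<^esub> z) [^]\<^bsub>G Mod M\<^esub> k" by (simp only: q.H.int_pow_inv)
    then show "inv\<^bsub>G Mod M\<^esub> a \<in> {y \<in> carrier (G Mod M). \<exists>z\<in>carrier (G Mod M). y = z [^]\<^bsub>G Mod M\<^esub> k}"
      using z q.H.inv_closed q.H.int_pow_closed by blast
  next
    fix a b assume "a \<in> {y \<in> carrier (G Mod M). \<exists>z\<in>carrier (G Mod M). y = z [^]\<^bsub>G Mod M\<^esub> k}"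
      "b \<in> {y \<in> carrier (G Mod M). \<exists>z\<in>carrier (G Mod M). y = z [^]\<^bsub>G Mod M\<^esub> k}"
    then obtain z z' where z: "z \<in> carrier (G Mod M)" "a = z [^]\<^bsub>G Mod M\<^esub> k"
      "z' \<in> carrier (G Mod M)" "b = z' [^]\<^bsub>G Mod M\<^esub> k" by blast
    then have "a \<otimes>\<^bsub>G Mod M\<^esub> b = (z \<otimes>\<^bsub>G Mod M\<^esub> z') [^]\<^bsub>G Mod M\<^esub> k" by (simp only: Q.int_pow_distrib)
    then show "a \<otimes>\<^bsub>G Mod M\<^esub> b \<in> {y \<in> carrier (G Mod M). \<exists>z\<in>carrier (G Mod M). y = z [^]\<^bsub>G Mod M\<^esub> k}"
      using z q.H.m_closed q.H.int_pow_closed by blast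
  next
    have "\<one>\<^bsub>G Mod M\<^esub> = \<one>\<^bsub>G Mod M\<^esub> [^]\<^bsub>G Mod M\<^esub> k" by (rule q.H.int_pow_one[symmetric])
    then show "{y \<in> carrier (G Mod M). \<exists>z\<in>carrier (G Mod M). y = z [^]\<^bsub>G Mod M\<^esub> k} \<noteq> {}"
      using q.H.one_closed by blast
  qed blast
  have square: "\<exists>z\<in>carrier (G Mod M). y = z [^]\<^bsub>G Mod M\<^esub> (2::int)" if "y \<in> carrier (G Mod M)" for y
  proof -
    have "{y \<in> carrier (G Mod M). \<exists>z\<in>carrier (G Mod M). y = z [^]\<^bsub>G Mod M\<^esub> (2::int)} = carrier (G Mod M)"
    proof (rule genQ[OF subpow])
      fix i assume i: "i < d"
      obtain k where k: "n = 2 * k" using n by blast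
      have "g i \<otimes> c i [^] n \<in> M" using i M(2) by (auto intro: generate.incl)
      then have "(M #> g i) \<otimes>\<^bsub>G Mod M\<^esub> (M #> c i) [^]\<^bsub>G Mod M\<^esub> n = \<one>\<^bsub>G Mod M\<^esub>"
        using coset_one_iff[OF M(1)] g c by (simp flip: q.hom_int_pow q.hom_mult)
      \<comment> \<open>With \<open>n = 2 * k\<close> the relation writes the generator as the
        square of the power \<open>- k\<close> of the image of \<open>c i\<close>.\<close>
      then have "M #> g i = inv\<^bsub>G Mod M\<^esub> ((M #> c i) [^]\<^bsub>G Mod M\<^esub> n)"
        using g c by (intro q.H.inv_equality[symmetric]) (auto)
      also have "\<dots> = ((M #> c i) [^]\<^bsub>G Mod M\<^esub> (- k)) [^]\<^bsub>G Mod M\<^esub> (2::int)"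
        using c by (simp add: k q.H.int_pow_pow mult.commute flip: q.H.int_pow_neg)
      finally show "M #> g i \<in> {y \<in> carrier (G Mod M). \<exists>z\<in>carrier (G Mod M). y = z [^]\<^bsub>G Mod M\<^esub> (2::int)}"
        using g c by (auto intro!: bexI[of _ "(M #> c i) [^]\<^bsub>G Mod M\<^esub> (- k)"])
    qed
    then show ?thesis using that by blast
  qed
  have root: "\<exists>z\<in>carrier (G Mod M). y = z [^]\<^bsub>G Mod M\<^esub> (2 ^ a :: int)" if "y \<in> carrier (G Mod M)" for y a
    using that
  proof (induction a arbitrary: y)
    case (Suc a)
    then obtain z z' where "z \<in> carrier (G Mod M)" "y = z [^]\<^bsub>G Mod M\<^esub> (2::int)"
      "z' \<in> carrier (G Mod M)" "z = z' [^]\<^bsub>G Mod M\<^esub> (2 ^ a :: int)" using square by meson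
    then show ?case by (intro bexI[of _ z']) (simp_all add: q.H.int_pow_pow mult.commute)
  qed (auto simp: q.H.int_pow_1)
  \<comment> \<open>In an abelian group a common exponent of the generators is one for the whole
    group. Every element is also a power with this exponent, hence trivial.\<close>
  have "\<exists>a. \<forall>i\<in>{..<d}. g i [^] ((2::nat) ^ a) \<in> M"
  proof (rule finite_uniform_bound)
    show "\<exists>a. g i [^] ((2::nat) ^ a) \<in> M" for i using M(4) g by blast
    show "g i [^] ((2::nat) ^ b) \<in> M" if "g i [^] ((2::nat) ^ a) \<in> M" "a \<le> b" for i a b
      using pow_power_mono[OF normal_imp_subgroup[OF M(1)] g] that by blast
  qed simp
  then obtain a where a: "\<And>i. i < d \<Longrightarrow> g i [^] int (2 ^ a) \<in> M" unfolding int_pow_int by blast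
  have "{y \<in> carrier (G Mod M). y [^]\<^bsub>G Mod M\<^esub> (2 ^ a :: int) = \<one>\<^bsub>G Mod M\<^esub>} = carrier (G Mod M)"
  proof (rule genQ)
    show "subgroup {y \<in> carrier (G Mod M). y [^]\<^bsub>G Mod M\<^esub> (2 ^ a :: int) = \<one>\<^bsub>G Mod M\<^esub>} (G Mod M)"
    proof (rule q.H.subgroupI)
      have "\<one>\<^bsub>G Mod M\<^esub> [^]\<^bsub>G Mod M\<^esub> (2 ^ a :: int) = \<one>\<^bsub>G Mod M\<^esub>" by simp
      then show "{y \<in> carrier (G Mod M). y [^]\<^bsub>G Mod M\<^esub> (2 ^ a :: int) = \<one>\<^bsub>G Mod M\<^esub>} \<noteq> {}"
        using q.H.one_closed by blast
    qed (auto simp: q.H.int_pow_inv Q.int_pow_distrib)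
    show "M #> g i \<in> {y \<in> carrier (G Mod M). y [^]\<^bsub>G Mod M\<^esub> (2 ^ a :: int) = \<one>\<^bsub>G Mod M\<^esub>}" if "i < d" for i
      using a[OF that] coset_one_iff[OF M(1), of "g i [^] int (2 ^ a)"] g by (simp add: q.hom_int_pow)
  qed
  moreover have Mx: "M #> x \<in> carrier (G Mod M)" using x by simp
  then obtain z where "z \<in> carrier (G Mod M)" "M #> x = z [^]\<^bsub>G Mod M\<^esub> (2 ^ a :: int)" using root by blast
  ultimately have "M #> x = \<one>\<^bsub>G Mod M\<^esub>" by auto
  then show False using M(3) coset_one_iff[OF M(1) x] by blast
qed

text \<open>Each of the first two blocks is replaced by generators times powers, the exponent 1
  giving back the tuple before the change. Survival of the words asks for an exponent congruent to 1
  modulo a prime power: 3 is used for the first block, leaving the exponent free to be even, and 2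
  for the second, leaving it free to be a multiple of an odd number. This needs \<open>d\<close>
  entries for each block, hence \<open>2 * d \<le> k\<close>.\<close>

lemma generating_nontorsion_tuple:
  fixes d k :: nat
  assumes g: "\<And>i. g i \<in> carrier G" and gen: "generate G (g ` {..<d}) = carrier G" and k: "2 * d \<le> k"
    and \<Omega>: "finite \<Omega>" "\<And>w. w \<in> \<Omega> \<Longrightarrow> \<exists>y. (\<forall>i. y i \<in> carrier G) \<and> word_value G y w \<notin> torsion G"
  shows "\<exists>s. (\<forall>i. s i \<in> carrier G) \<and> generate G (s ` {..<k}) = carrier G \<and>
    (\<forall>w\<in>\<Omega>. word_value G s w \<notin> torsion G)"
proof -
  let ?C = "{gcomm G x y | x y. x \<in> carrier G \<and> y \<in> carrier G}"
  obtain y where y: "\<And>i. y i \<in> carrier G" "\<And>w. w \<in> \<Omega> \<Longrightarrow> word_value G y w \<notin> torsion G"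
    using common_nontorsion_tuple[OF \<Omega>] by blast
  define u v where "u i = (if i < d then g i else y i)" and "v i = (if i < d then inv (g i) \<otimes> y i else \<one>)" for i
  have uv: "u i \<in> carrier G" "v i \<in> carrier G" for i using g y by (auto simp: u_def v_def)
  have 1: "(\<lambda>i. u i \<otimes> v i [^] (1::int)) = y"
    using g y by (auto simp: u_def v_def int_pow_1 m_assoc[symmetric])
  have "normalization_semidom_class.prime (3::nat)" by simp
  then obtain a where a: "\<And>w n. w \<in> \<Omega> \<Longrightarrow> int (3 ^ a) dvd n - 1 \<Longrightarrow> word_value G (\<lambda>i. u i \<otimes> v i [^] n) w \<notin> torsion G"
    using word_values_nontorsion_progression[of 3 u v \<Omega> 1, OF _ uv \<Omega>(1)] y(2) unfolding 1 by blast
  have "coprime (2::int) (3 ^ a)" by simp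
  then obtain r s where "r * 2 + s * 3 ^ a = (1::int)"
    using bezout_int[of 2 "3 ^ a"] by (metis coprime_iff_gcd_eq_1)
  then have "int (3 ^ a) dvd (r * 2) - 1"
    by (metis add_diff_cancel_left' dvd_minus_iff dvd_triv_right minus_diff_eq of_nat_numeral of_nat_power)
  then obtain n where n: "even n" "int (3 ^ a) dvd n - 1" by (metis dvd_triv_right)
  define y1 where "y1 i = u i \<otimes> v i [^] n" for i
  have y1: "y1 i \<in> carrier G" for i using uv by (simp add: y1_def)
  have nt1: "word_value G y1 w \<notin> torsion G" if "w \<in> \<Omega>" for w
    using a[OF that n(2)] unfolding y1_def .
  let ?M = "generate G (y1 ` {..<d} \<union> ?C)"
  have Ms: "subgroup ?M G" using y1 by (intro generate_is_subgroup) auto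
  have "(\<lambda>i. g i \<otimes> v i [^] n) ` {..<d} = y1 ` {..<d}" by (auto simp: y1_def u_def)
  then have odd: "\<exists>m::int. odd m \<and> x [^] m \<in> ?M" if "x \<in> carrier G" for x
    using odd_power_in_perturbation[of g d v n x, OF g gen uv(2) n(1) that] by simp
  \<comment> \<open>The second block occupies the indices from \<open>d\<close> to
    \<open>2 * d - 1\<close>, where \<open>i - d\<close> numbers the generators; other values of
    \<open>c\<close> do not enter the tuple.\<close>
  define c where "c i = inv (g (i - d)) \<otimes> y1 i" for i
  have c: "c i \<in> carrier G" for i using g y1 by (simp add: c_def)
  have "\<exists>D. \<forall>i. odd (D i :: int) \<and> c i [^] D i \<in> ?M"
    by (rule choice, rule allI, rule odd[OF c])
  then obtain D where D: "\<And>i. odd (D i :: int)" "\<And>i. c i [^] D i \<in> ?M" by blast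
  \<comment> \<open>A multiple of \<open>E\<close> as exponent puts the powers of all
    \<open>c i\<close> of the second block into \<open>?M\<close>, so that the generators themselves
    can be split off. As \<open>E\<close> is odd, some multiple of it is 1 modulo
    \<open>2 ^ b\<close>.\<close>
  define E where "E = (\<Prod>i\<in>{d..<2*d}. D i)"
  have "odd E" unfolding E_def using D(1) by (simp add: even_prod_iff)
  define u' v' where "u' i = (if i \<in> {d..<2*d} then g (i - d) else y1 i)"
    and "v' i = (if i \<in> {d..<2*d} then c i else \<one>)" for i
  have uv': "u' i \<in> carrier G" "v' i \<in> carrier G" for i using g y1 c by (auto simp: u'_def v'_def)
  have 1: "(\<lambda>i. u' i \<otimes> v' i [^] (1::int)) = y1"
    using g y1 by (auto simp: u'_def v'_def c_def int_pow_1 m_assoc[symmetric])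
  obtain b where b: "\<And>w n. w \<in> \<Omega> \<Longrightarrow> int (2 ^ b) dvd n - 1 \<Longrightarrow> word_value G (\<lambda>i. u' i \<otimes> v' i [^] n) w \<notin> torsion G"
    using word_values_nontorsion_progression[of 2 u' v' \<Omega> 1, OF two_is_prime_nat uv' \<Omega>(1)] nt1 unfolding 1 by blast
  have "coprime E (2 ^ b)" using \<open>odd E\<close> by simp
  then obtain r s where "r * E + s * 2 ^ b = 1"
    using bezout_int[of E "2 ^ b"] by (metis coprime_iff_gcd_eq_1)
  then have "r * E - 1 = 2 ^ b * (- s)" by (simp add: algebra_simps)
  then have rE: "int (2 ^ b) dvd r * E - 1" by simp
  define y2 where "y2 i = u' i \<otimes> v' i [^] (r * E)" for i
  have y2: "y2 i \<in> carrier G" for i using uv' by (simp add: y2_def)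
  have nt2: "word_value G y2 w \<notin> torsion G" if "w \<in> \<Omega>" for w
    using b[OF that rE] unfolding y2_def .
  let ?B = "generate G (y2 ` {..<k} \<union> ?C)"
  have Bs: "subgroup ?B G" using y2 by (intro generate_is_subgroup) auto
  have y2B: "y2 i \<in> ?B" if "i < k" for i using that by (auto intro: generate.incl)
  have "y1 i = y2 i" if "i < d" for i using that y1 by (simp add: y2_def u'_def v'_def)
  then have "y1 ` {..<d} \<subseteq> y2 ` {..<k}" using k by force
  then have MB: "?M \<subseteq> ?B" using y2 by (intro generate_mono_subgroup) auto
  have "g i \<in> ?B" if i: "i < d" for i
  proof -
    have "D (d + i) dvd E" unfolding E_def using i by (intro dvd_prodI) auto
    then obtain t where "r * E = D (d + i) * t" by (metis dvd_def dvd_mult)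
    then have "c (d + i) [^] (r * E) = (c (d + i) [^] D (d + i)) [^] t" using c by (simp add: int_pow_pow)
    then have cB: "c (d + i) [^] (r * E) \<in> ?B" using subgroup_int_pow_closed[OF Ms D(2)] MB by auto
    have "y2 (d + i) = g i \<otimes> c (d + i) [^] (r * E)" using i by (simp add: y2_def u'_def v'_def)
    then have "g i = y2 (d + i) \<otimes> inv (c (d + i) [^] (r * E))" using g c by (simp add: m_assoc)
    moreover have "y2 (d + i) \<in> ?B" using i k by (intro y2B) auto
    ultimately show ?thesis using subgroup.m_closed[OF Bs _ subgroup.m_inv_closed[OF Bs cB]] by simp
  qed
  then have "generate G (g ` {..<d}) \<subseteq> ?B" using Bs by (intro generate_subgroup_incl) auto
  then have "?B = carrier G" unfolding gen using subgroup.subset[OF Bs] by (rule antisym[rotated])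
  moreover have "y2 ` {..<k} \<subseteq> carrier G" using y2 by blast
  ultimately have "generate G (y2 ` {..<k}) = carrier G"
    by (rule generate_eq_carrier_of_commutators[rotated])
  then show ?thesis using y2 nt2 by blast
qed

end

section \<open>Limits of marked groups\<close>

lemma finite_words: "finite {w :: word. letters w \<subseteq> {..<k} \<and> length w \<le> M}"
proof -
  have "{w :: word. letters w \<subseteq> {..<k} \<and> length w \<le> M} \<subseteq> {w. set w \<subseteq> {..<k} \<times> UNIV \<and> length w \<le> M}"
    by (auto simp: letters_def)
  then show ?thesis
    by (rule finite_subset) (rule finite_lists_length_le, simp)
qed

text \<open>With \<open>M\<close> varying, these are the basic neighbourhoods in the space of groups
  marked by \<open>k\<close> generators.\<close>

definition same_relations ::
  "('a, 'b) monoid_scheme \<Rightarrow> (nat \<Rightarrow> 'a) \<Rightarrow> ('c, 'd) monoid_scheme \<Rightarrow> (nat \<Rightarrow> 'c) \<Rightarrow> nat \<Rightarrow> nat \<Rightarrow> bool"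
where
  "same_relations G s H t k M \<longleftrightarrow> (\<forall>w. letters w \<subseteq> {..<k} \<and> length w \<le> M \<longrightarrow>
     (word_value G s w = \<one>\<^bsub>G\<^esub> \<longleftrightarrow> word_value H t w = \<one>\<^bsub>H\<^esub>))"

lemma eventually_same_relations:
  assumes "\<And>w. letters w \<subseteq> {..<k} \<Longrightarrow>
    \<forall>\<^sub>F n in sequentially. word_value G (s n) w = \<one>\<^bsub>G\<^esub> \<longleftrightarrow> word_value H t w = \<one>\<^bsub>H\<^esub>"
  shows "\<forall>\<^sub>F n in sequentially. same_relations G (s n) H t k M"
proof -
  have "\<forall>\<^sub>F n in sequentially. \<forall>w\<in>{w. letters w \<subseteq> {..<k} \<and> length w \<le> M}.
    word_value G (s n) w = \<one>\<^bsub>G\<^esub> \<longleftrightarrow> word_value H t w = \<one>\<^bsub>H\<^esub>"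
    by (rule eventually_ball_finite[OF finite_words]) (use assms in blast)
  then show ?thesis by (rule eventually_mono) (simp add: same_relations_def)
qed

lemma same_relations_eq_iff:
  assumes "group G" "group H" "\<And>i. s i \<in> carrier G" "\<And>i. t i \<in> carrier H"
    and "same_relations G s H t k M" "letters v \<subseteq> {..<k}" "letters w \<subseteq> {..<k}" "length v + length w \<le> M"
  shows "word_value G s v = word_value G s w \<longleftrightarrow> word_value H t v = word_value H t w"
proof -
  interpret G: group G by fact
  interpret H: group H by fact
  have "word_value G s v = word_value G s w \<longleftrightarrow> word_value G s (v @ word_inv w) = \<one>\<^bsub>G\<^esub>"
    using assms(3) by (simp add: G.word_value_append G.word_value_inv) (metis G.inv_equality G.inv_inv G.r_inv G.word_value_closed G.inv_closed)
  also have "\<dots> \<longleftrightarrow> word_value H t (v @ word_inv w) = \<one>\<^bsub>H\<^esub>"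
    using assms(5-8) by (simp add: same_relations_def)
  also have "\<dots> \<longleftrightarrow> word_value H t v = word_value H t w"
    using assms(4) by (simp add: H.word_value_append H.word_value_inv) (metis H.inv_equality H.inv_inv H.r_inv H.word_value_closed H.inv_closed)
  finally show ?thesis .
qed

section \<open>Cayley balls as sets of word values\<close>

lemma (in group) cayley_adj_iff:
  assumes s: "\<And>i. s i \<in> carrier G" and g: "g \<in> carrier G"
  shows "(g, h) \<in> cayley_adj G (s ` {..<k}) \<longleftrightarrow> (\<exists>i e. i < k \<and> h = g \<otimes> word_value G s [(i, e)])"
proof
  assume "(g, h) \<in> cayley_adj G (s ` {..<k})"
  then obtain i where i: "i < k" "h = g \<otimes> s i \<or> (h \<in> carrier G \<and> g = h \<otimes> s i)"
    by (auto simp: cayley_adj_def cayley_edges_def)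
  then have "h = g \<otimes> s i \<or> h = g \<otimes> inv (s i)" using s by (auto simp: m_assoc)
  then have "h = g \<otimes> word_value G s [(i, True)] \<or> h = g \<otimes> word_value G s [(i, False)]" using s by simp
  then show "\<exists>i e. i < k \<and> h = g \<otimes> word_value G s [(i, e)]" using i(1) by blast
next
  assume "\<exists>i e. i < k \<and> h = g \<otimes> word_value G s [(i, e)]"
  then obtain i e where i: "i < k" "h = g \<otimes> word_value G s [(i, e)]" by blast
  show "(g, h) \<in> cayley_adj G (s ` {..<k})"
  proof (cases e)
    case True
    then have "(g, s i, h) \<in> cayley_edges G (s ` {..<k})"
      using i s g by (auto simp: cayley_edges_def)
    then show ?thesis by (auto simp: cayley_adj_def)
  next
    case False
    then have "h \<in> carrier G" "g = h \<otimes> s i" using i s g by (auto simp: m_assoc)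
    then have "(h, s i, g) \<in> cayley_edges G (s ` {..<k})"
      unfolding cayley_edges_def using i(1) by blast
    then show ?thesis by (auto simp: cayley_adj_def)
  qed
qed

lemma (in group) cayley_ball_words:
  assumes s: "\<And>i. s i \<in> carrier G"
  shows "cayley_ball G (s ` {..<k}) R = {word_value G s w | w. letters w \<subseteq> {..<k} \<and> length w \<le> R}"
proof -
  have rel: "(\<one>, g) \<in> cayley_adj G (s ` {..<k}) ^^ n \<longleftrightarrow>
    (\<exists>w. letters w \<subseteq> {..<k} \<and> length w = n \<and> g = word_value G s w)" for n g
  proof (induction n arbitrary: g)
    case (Suc n)
    show ?case
    proof
      assume "(\<one>, g) \<in> cayley_adj G (s ` {..<k}) ^^ Suc n"
      then obtain h where h: "(\<one>, h) \<in> cayley_adj G (s ` {..<k}) ^^ n" "(h, g) \<in> cayley_adj G (s ` {..<k})"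
        by auto
      then obtain w where w: "letters w \<subseteq> {..<k}" "length w = n" "h = word_value G s w" using Suc by blast
      then obtain i e where "i < k" "g = word_value G s w \<otimes> word_value G s [(i, e)]"
        using h(2) cayley_adj_iff[of s h g k, OF s] s word_value_closed[of s w] by blast
      then have "letters (w @ [(i, e)]) \<subseteq> {..<k}" "length (w @ [(i, e)]) = Suc n"
        "g = word_value G s (w @ [(i, e)])"
        using w s by (simp_all only: word_value_append) auto
      then show "\<exists>w. letters w \<subseteq> {..<k} \<and> length w = Suc n \<and> g = word_value G s w" by blast
    next
      assume "\<exists>w. letters w \<subseteq> {..<k} \<and> length w = Suc n \<and> g = word_value G s w"
      then obtain w where w: "letters w \<subseteq> {..<k}" "length w = Suc n" "g = word_value G s w" by blast
      then obtain v i e where v: "w = v @ [(i, e)]" by (metis length_Suc_conv_rev prod.exhaust)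
      then have "(\<one>, word_value G s v) \<in> cayley_adj G (s ` {..<k}) ^^ n" using w Suc by auto
      moreover have "g = word_value G s v \<otimes> word_value G s [(i, e)]" "i < k"
        using w v s by (simp_all only: word_value_append) auto
      then have "(word_value G s v, g) \<in> cayley_adj G (s ` {..<k})"
        using cayley_adj_iff[of s "word_value G s v" g k, OF s] s word_value_closed[of s v] by blast
      ultimately show "(\<one>, g) \<in> cayley_adj G (s ` {..<k}) ^^ Suc n" by auto
    qed
  qed auto
  show ?thesis unfolding cayley_ball_def rel by auto
qed

text \<open>Convergence of the marked groups \<open>(G, s n)\<close> to \<open>(H, t)\<close>.
  Markings are tuples, possibly with repetitions, instead of sets with bijections; entries from
  \<open>k\<close> on merely have to lie in the group, so that words can be evaluated without side
  conditions.\<close>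

definition marking_limit ::
  "('a, 'b) monoid_scheme \<Rightarrow> ('c, 'd) monoid_scheme \<Rightarrow> nat \<Rightarrow> (nat \<Rightarrow> 'c) \<Rightarrow> (nat \<Rightarrow> nat \<Rightarrow> 'a) \<Rightarrow> bool"
where
  "marking_limit G H k t s \<longleftrightarrow>
     (\<forall>i. t i \<in> carrier H) \<and> generate H (t ` {..<k}) = carrier H \<and>
     (\<forall>n i. s n i \<in> carrier G) \<and> (\<forall>n. generate G (s n ` {..<k}) = carrier G) \<and>
     (\<forall>w. letters w \<subseteq> {..<k} \<longrightarrow>
       (\<forall>\<^sub>F n in sequentially. word_value G (s n) w = \<one>\<^bsub>G\<^esub> \<longleftrightarrow> word_value H t w = \<one>\<^bsub>H\<^esub>))"

text \<open>All prefixes of \<open>w\<close> have values in the ball, so following the labelled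
  edges from the root determines \<open>f\<close> on them: it maps the value of a prefix in
  \<open>G\<close> to its value in \<open>H\<close>. Injectivity of \<open>f\<close> then decides
  whether the end point is the root.\<close>

lemma balls_isomorphic_word_value:
  assumes "group G" "group H" and s: "\<And>i. s i \<in> carrier G" and t: "\<And>i. t i \<in> carrier H"
    and \<phi>: "\<And>i. i < k \<Longrightarrow> \<phi> (s i) = t i"
    and iso: "balls_isomorphic G (s ` {..<k}) H (t ` {..<k}) \<phi> R"
    and w: "letters w \<subseteq> {..<k}" "length w \<le> R"
  shows "word_value G s w = \<one>\<^bsub>G\<^esub> \<longleftrightarrow> word_value H t w = \<one>\<^bsub>H\<^esub>"
proof -
  interpret G: group G by fact
  interpret H: group H by fact
  let ?B = "cayley_ball G (s ` {..<k}) R"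
  obtain f where f: "bij_betw f ?B (cayley_ball H (t ` {..<k}) R)" "f \<one>\<^bsub>G\<^esub> = \<one>\<^bsub>H\<^esub>"
    and edge: "\<And>x y a. x \<in> ?B \<Longrightarrow> y \<in> ?B \<Longrightarrow> a \<in> s ` {..<k} \<Longrightarrow>
      (x, a, y) \<in> cayley_edges G (s ` {..<k}) \<longleftrightarrow> (f x, \<phi> a, f y) \<in> cayley_edges H (t ` {..<k})"
    using iso unfolding balls_isomorphic_def by blast
  have ball: "word_value G s v \<in> ?B" if "letters v \<subseteq> {..<k}" "length v \<le> R" for v
    using that G.cayley_ball_words[of s k R, OF s] by blast
  have "f (word_value G s v) = word_value H t v" if "letters v \<subseteq> {..<k}" "length v \<le> R" for v
    using that
  proof (induction v rule: rev_induct)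
    case Nil
    then show ?case using f(2) by simp
  next
    case (snoc l v)
    obtain i e where l: "l = (i, e)" by (cases l)
    let ?x = "word_value G s v" and ?y = "word_value G s (v @ [l])"
    have i: "i < k" and v: "letters v \<subseteq> {..<k}" "length v \<le> R" using snoc.prems l by auto
    have x: "?x \<in> ?B" "?x \<in> carrier G" using ball v s by auto
    have y: "?y \<in> ?B" "?y \<in> carrier G" using ball[OF snoc.prems] s by auto
    have fx: "f ?x = word_value H t v" using snoc.IH v by blast
    have "f ?y \<in> cayley_ball H (t ` {..<k}) R" using f(1) y(1) bij_betwE by blast
    then have fy: "f ?y \<in> carrier H" unfolding H.cayley_ball_words[of t k R, OF t] using t by auto
    show ?case
    proof (cases e)
      case True
      then have "?y = ?x \<otimes>\<^bsub>G\<^esub> s i" using l s by (simp add: G.word_value_append)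
      then have "(?x, s i, ?y) \<in> cayley_edges G (s ` {..<k})" using x i by (auto simp: cayley_edges_def)
      then have "(f ?x, \<phi> (s i), f ?y) \<in> cayley_edges H (t ` {..<k})" using edge[OF x(1) y(1)] i by blast
      then have "f ?y = f ?x \<otimes>\<^bsub>H\<^esub> t i" using \<phi>[OF i] by (auto simp: cayley_edges_def)
      then show ?thesis using l True t fx by (simp add: H.word_value_append)
    next
      case False
      then have "?y = ?x \<otimes>\<^bsub>G\<^esub> inv\<^bsub>G\<^esub> s i" using l s by (simp add: G.word_value_append)
      then have "?x = ?y \<otimes>\<^bsub>G\<^esub> s i" using s x by (simp add: G.m_assoc)
      then have "(?y, s i, ?x) \<in> cayley_edges G (s ` {..<k})"
        unfolding cayley_edges_def using y i by blast
      then have "(f ?y, \<phi> (s i), f ?x) \<in> cayley_edges H (t ` {..<k})" using edge[OF y(1) x(1)] i by blast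
      then have "f ?x = f ?y \<otimes>\<^bsub>H\<^esub> t i" using \<phi>[OF i] by (auto simp: cayley_edges_def)
      then have "f ?y = f ?x \<otimes>\<^bsub>H\<^esub> inv\<^bsub>H\<^esub> t i" using t fy by (simp add: H.m_assoc)
      then show ?thesis using l False t fx by (simp add: H.word_value_append)
    qed
  qed
  then have fw: "f (word_value G s w) = word_value H t w" using w by blast
  have "inj_on f ?B" using f(1) by (rule bij_betw_imp_inj_on)
  moreover have "\<one>\<^bsub>G\<^esub> \<in> ?B" using ball[of "[]"] by simp
  ultimately show ?thesis using fw f(2) ball[OF w] by (metis inj_on_eq_iff)
qed

lemma preforms_imp_marking_limit:
  assumes "group G" "group H" "preforms G H"
  shows "\<exists>k t s. marking_limit G H k t s"
proof -
  interpret G: group G by fact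
  interpret H: group H by fact
  obtain T S \<phi> where T: "finite_generating_set H T"
    and S: "\<And>n. finite_generating_set G (S n)" and \<phi>: "\<And>n. bij_betw (\<phi> n) (S n) T"
    and balls: "\<And>R. \<forall>\<^sub>F n in sequentially. balls_isomorphic G (S n) H T (\<phi> n) R"
    using assms(3) unfolding preforms_def by blast
  define k where "k = card T"
  obtain t0 where t0: "bij_betw t0 {0..<k} T"
    using T ex_bij_betw_nat_finite[of T] unfolding finite_generating_set_def k_def by blast
  \<comment> \<open>The identity as default beyond \<open>k\<close> keeps the total tuples inside
    the groups.\<close>
  define t where "t i = (if i < k then t0 i else \<one>\<^bsub>H\<^esub>)" for i
  define s where "s n i = (if i < k then inv_into (S n) (\<phi> n) (t i) else \<one>\<^bsub>G\<^esub>)" for n i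
  have tT: "t ` {..<k} = T"
    using bij_betw_imp_surj_on[OF t0] unfolding atLeast0LessThan by (auto simp: t_def)
  then have t: "t i \<in> carrier H" for i
    using T by (cases "i < k") (auto simp: t_def finite_generating_set_def)
  have sS: "s n ` {..<k} = S n" for n
  proof -
    have "s n ` {..<k} = inv_into (S n) (\<phi> n) ` t ` {..<k}" by (auto simp: s_def)
    also have "\<dots> = S n" unfolding tT using bij_betw_imp_surj_on[OF bij_betw_inv_into[OF \<phi>]] .
    finally show ?thesis .
  qed
  then have s: "s n i \<in> carrier G" for n i
    using S[of n] by (cases "i < k") (auto simp: s_def finite_generating_set_def)
  have \<phi>s: "\<phi> n (s n i) = t i" if i: "i < k" for n i
  proof -
    have "t i \<in> T" using tT i by blast
    then show ?thesis using i bij_betw_inv_into_right[OF \<phi>] by (simp add: s_def)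
  qed
  have "\<forall>\<^sub>F n in sequentially. word_value G (s n) w = \<one>\<^bsub>G\<^esub> \<longleftrightarrow> word_value H t w = \<one>\<^bsub>H\<^esub>"
    if "letters w \<subseteq> {..<k}" for w
    using balls[of "length w"]
  proof (rule eventually_mono)
    fix n assume "balls_isomorphic G (S n) H T (\<phi> n) (length w)"
    then have "balls_isomorphic G (s n ` {..<k}) H (t ` {..<k}) (\<phi> n) (length w)"
      unfolding sS tT .
    then show "word_value G (s n) w = \<one>\<^bsub>G\<^esub> \<longleftrightarrow> word_value H t w = \<one>\<^bsub>H\<^esub>"
      using balls_isomorphic_word_value[of G H "s n" t k "\<phi> n", OF assms(1,2) s t \<phi>s] that by blast
  qed
  then have "marking_limit G H k t s"
    using s t S T unfolding marking_limit_def finite_generating_set_def sS tT by blast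
  then show ?thesis by blast
qed

text \<open>Coincidence of two vertices is a relation of length at most \<open>2 * R\<close>. An
  edge between vertices is an equality of a word of length at most \<open>R\<close> with one of
  length at most \<open>R + 1\<close>, whence \<open>2 * R + 1\<close>.\<close>

lemma same_relations_balls_isomorphic:
  assumes "group G" "group H" and s: "\<And>i. s i \<in> carrier G" and t: "\<And>i. t i \<in> carrier H"
    and \<phi>: "\<And>i. i < k \<Longrightarrow> \<phi> (s i) = t i"
    and same: "same_relations G s H t k (2 * R + 1)"
  shows "balls_isomorphic G (s ` {..<k}) H (t ` {..<k}) \<phi> R"
proof -
  interpret G: group G by fact
  interpret H: group H by fact
  let ?W = "{w. letters w \<subseteq> {..<k} \<and> length w \<le> R}"
  have BG: "cayley_ball G (s ` {..<k}) R = word_value G s ` ?W"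
    using G.cayley_ball_words[of s k R, OF s] by auto
  have BH: "cayley_ball H (t ` {..<k}) R = word_value H t ` ?W"
    using H.cayley_ball_words[of t k R, OF t] by auto
  have eq: "word_value G s v = word_value G s w \<longleftrightarrow> word_value H t v = word_value H t w"
    if "v \<in> ?W" "letters w \<subseteq> {..<k}" "length w \<le> Suc R" for v w
    using that by (intro same_relations_eq_iff[of G H s t k "2 * R + 1", OF assms(1,2) s t same]) auto
  define f where "f x = word_value H t (SOME w. w \<in> ?W \<and> word_value G s w = x)" for x
  have f: "f (word_value G s w) = word_value H t w" if w: "w \<in> ?W" for w
  proof -
    have "(SOME v. v \<in> ?W \<and> word_value G s v = word_value G s w) \<in> ?W \<and>
      word_value G s (SOME v. v \<in> ?W \<and> word_value G s v = word_value G s w) = word_value G s w"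
      by (rule someI_ex) (use w in blast)
    then show ?thesis unfolding f_def using eq w by auto
  qed
  have "bij_betw f (cayley_ball G (s ` {..<k}) R) (cayley_ball H (t ` {..<k}) R)"
    unfolding BG BH
  proof (rule bij_betw_imageI)
    show "inj_on f (word_value G s ` ?W)"
    proof (rule inj_onI)
      fix x y assume "x \<in> word_value G s ` ?W" "y \<in> word_value G s ` ?W" "f x = f y"
      then obtain v w where vw: "v \<in> ?W" "w \<in> ?W" "x = word_value G s v" "y = word_value G s w"
        "f (word_value G s v) = f (word_value G s w)" by blast
      then have "word_value H t v = word_value H t w" unfolding f[OF vw(1)] f[OF vw(2)] by blast
      then show "x = y" using eq[of v w] vw by simp
    qed
    show "f ` word_value G s ` ?W = word_value H t ` ?W"
      using f by (auto simp: image_image)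
  qed
  moreover have "f \<one>\<^bsub>G\<^esub> = \<one>\<^bsub>H\<^esub>" using f[of "[]"] by simp
  moreover have "(x, a, y) \<in> cayley_edges G (s ` {..<k}) \<longleftrightarrow> (f x, \<phi> a, f y) \<in> cayley_edges H (t ` {..<k})"
    if xya: "x \<in> cayley_ball G (s ` {..<k}) R" "y \<in> cayley_ball G (s ` {..<k}) R" "a \<in> s ` {..<k}" for x y a
  proof -
    obtain v w i where vw: "v \<in> ?W" "w \<in> ?W" "x = word_value G s v" "y = word_value G s w"
      and i: "i < k" "a = s i" using xya unfolding BG by blast
    have "(x, a, y) \<in> cayley_edges G (s ` {..<k}) \<longleftrightarrow> y = x \<otimes>\<^bsub>G\<^esub> s i"
      using i vw s by (auto simp: cayley_edges_def)
    also have "\<dots> \<longleftrightarrow> word_value G s w = word_value G s (v @ [(i, True)])"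
      using vw s by (simp add: G.word_value_append)
    also have "\<dots> \<longleftrightarrow> word_value H t w = word_value H t (v @ [(i, True)])"
      using eq[of w "v @ [(i, True)]"] vw i by simp
    also have "\<dots> \<longleftrightarrow> f y = f x \<otimes>\<^bsub>H\<^esub> t i"
      using vw t f by (simp add: H.word_value_append)
    also have "\<dots> \<longleftrightarrow> (f x, \<phi> a, f y) \<in> cayley_edges H (t ` {..<k})"
      using i vw t f \<phi> by (auto simp: cayley_edges_def)
    finally show ?thesis .
  qed
  ultimately show ?thesis unfolding balls_isomorphic_def by blast
qed

text \<open>Tuples may repeat entries, while generating sets have to correspond bijectively.
  Relations of length 2 decide which entries coincide, so once the first \<open>N\<close> markings
  are dropped, sending \<open>s n i\<close> to \<open>t i\<close> is well defined and
  bijective.\<close>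

lemma marking_limit_imp_preforms:
  assumes "group G" "group H" "marking_limit G H k t s"
  shows "preforms G H"
proof -
  interpret G: group G by fact
  interpret H: group H by fact
  have t: "\<And>i. t i \<in> carrier H" "generate H (t ` {..<k}) = carrier H"
    and s: "\<And>n i. s n i \<in> carrier G" "\<And>n. generate G (s n ` {..<k}) = carrier G"
    and ev: "\<And>w. letters w \<subseteq> {..<k} \<Longrightarrow>
      \<forall>\<^sub>F n in sequentially. word_value G (s n) w = \<one>\<^bsub>G\<^esub> \<longleftrightarrow> word_value H t w = \<one>\<^bsub>H\<^esub>"
    using assms(3) unfolding marking_limit_def by blast+
  have same: "\<forall>\<^sub>F n in sequentially. same_relations G (s n) H t k M" for M
    using eventually_same_relations[of k G s H t, OF ev] .
  obtain N where N: "\<And>n. n \<ge> N \<Longrightarrow> same_relations G (s n) H t k 2"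
    using same[of 2] unfolding eventually_sequentially by blast
  define S where "S n = s (n + N) ` {..<k}" for n
  define \<phi> where "\<phi> n x = t (SOME i. i < k \<and> s (n + N) i = x)" for n x
  have eq: "s (n + N) i = s (n + N) j \<longleftrightarrow> t i = t j" if "i < k" "j < k" for n i j
    using same_relations_eq_iff[of G H "s (n + N)" t k 2 "[(i, True)]" "[(j, True)]", OF assms(1,2) s(1) t(1) N]
      that s t by simp
  have \<phi>: "\<phi> n (s (n + N) i) = t i" if i: "i < k" for n i
  proof -
    have "(SOME j. j < k \<and> s (n + N) j = s (n + N) i) < k \<and>
      s (n + N) (SOME j. j < k \<and> s (n + N) j = s (n + N) i) = s (n + N) i"
      by (rule someI_ex) (use i in blast)
    then show ?thesis unfolding \<phi>_def using eq i by blast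
  qed
  have "bij_betw (\<phi> n) (S n) (t ` {..<k})" for n
  proof (rule bij_betw_imageI)
    show "inj_on (\<phi> n) (S n)"
      unfolding S_def using \<phi> eq by (auto simp: inj_on_def)
    show "\<phi> n ` S n = t ` {..<k}"
      unfolding S_def image_image using \<phi> by (intro image_cong) auto
  qed
  moreover have "finite_generating_set G (S n)" for n
    using s by (auto simp: S_def finite_generating_set_def)
  moreover have "finite_generating_set H (t ` {..<k})"
    using t by (auto simp: finite_generating_set_def)
  moreover have "\<forall>\<^sub>F n in sequentially. balls_isomorphic G (S n) H (t ` {..<k}) (\<phi> n) R" for R
  proof -
    have "\<forall>\<^sub>F n in sequentially. same_relations G (s (n + N)) H t k (2 * R + 1)"
      using same[of "2 * R + 1"] eventually_sequentially_seg[of "\<lambda>n. same_relations G (s n) H t k (2 * R + 1)" N]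
      by blast
    then show ?thesis
    proof (rule eventually_mono)
      fix n assume "same_relations G (s (n + N)) H t k (2 * R + 1)"
      then show "balls_isomorphic G (S n) H (t ` {..<k}) (\<phi> n) R"
        unfolding S_def
        using same_relations_balls_isomorphic[of G H "s (n + N)" t k "\<phi> n" R, OF assms(1,2) s(1) t(1) \<phi>] by blast
    qed
  qed
  ultimately show ?thesis unfolding preforms_def by blast
qed

section \<open>Nilpotency as an identity\<close>

text \<open>The commutator \<open>[...[x_0, x_1], ..., x_n]\<close> of weight \<open>n + 1\<close>,
  an identity of exactly the groups of nilpotency class at most \<open>n\<close>.\<close>

fun left_commutator :: "nat \<Rightarrow> word" where
  "left_commutator 0 = [(0, True)]"
| "left_commutator (Suc n) = left_commutator n @ [(Suc n, True)] @
     word_inv (left_commutator n) @ [(Suc n, False)]"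

lemma letters_left_commutator: "letters (left_commutator n) \<subseteq> {..n}"
proof (induction n)
  case (Suc n)
  then have "letters (left_commutator n) \<subseteq> {..Suc n}" by force
  then show ?case by simp
qed simp

lemma identitiesD:
  "\<lbrakk>w \<in> identities G; \<And>i. x i \<in> carrier G\<rbrakk> \<Longrightarrow> word_value G x w = \<one>\<^bsub>G\<^esub>"
  by (auto simp: identities_def)

lemma identitiesI:
  "(\<And>x. (\<And>i. x i \<in> carrier G) \<Longrightarrow> word_value G x w = \<one>\<^bsub>G\<^esub>) \<Longrightarrow> w \<in> identities G"
  by (auto simp: identities_def)

lemma (in group) word_value_left_commutator_Suc:
  assumes "\<And>i. x i \<in> carrier G"
  shows "word_value G x (left_commutator (Suc n)) = gcomm G (word_value G x (left_commutator n)) (x (Suc n))"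
  using assms by (simp add: word_value_append word_value_inv gcomm_def m_assoc)

lemma (in group) left_commutator_upper_central:
  assumes "upper_central G {\<one>} c = carrier G" and x: "\<And>i. x i \<in> carrier G"
  shows "i \<le> c \<Longrightarrow> word_value G x (left_commutator i) \<in> upper_central G {\<one>} (c - i)"
proof (induction i)
  case 0
  then show ?case using assms by simp
next
  case (Suc i)
  then have "word_value G x (left_commutator i) \<in> upper_central G {\<one>} (Suc (c - Suc i))"
    by (simp add: Suc_diff_Suc del: upper_central.simps)
  then have "gcomm G (word_value G x (left_commutator i)) (x (Suc i)) \<in> upper_central G {\<one>} (c - Suc i)"
    using x by (simp add: central_mod_def)
  then show ?case using word_value_left_commutator_Suc[of x i, OF x] by simp
qed

lemma (in group) left_commutator_identity:
  assumes "upper_central G {\<one>} c = carrier G"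
  shows "left_commutator c \<in> identities G"
proof (rule identitiesI)
  fix x :: "nat \<Rightarrow> 'a" assume x: "\<And>i. x i \<in> carrier G"
  have "word_value G x (left_commutator c) \<in> upper_central G {\<one>} (c - c)"
    using left_commutator_upper_central[OF assms x order_refl] .
  then show "word_value G x (left_commutator c) = \<one>" by simp
qed

text \<open>Inductively, the values of \<open>left_commutator (c - j)\<close> on generators lie in
  the term \<open>j\<close>, since centrality is tested on generators. With finitely many
  generators, nilpotency thus amounts to finitely many relations, which is what lets it pass from a
  limit back to the approximating group.\<close>

lemma (in group) upper_central_of_left_commutators:
  assumes S: "S \<subseteq> carrier G" "generate G S = carrier G"
    and one: "\<And>x. range x \<subseteq> S \<Longrightarrow> word_value G x (left_commutator c) = \<one>"
  shows "upper_central G {\<one>} c = carrier G"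
proof -
  have n: "upper_central G {\<one>} j \<lhd> G" for j by (rule normal_upper_central[OF one_is_normal])
  have main: "j \<le> c \<Longrightarrow> range x \<subseteq> S \<Longrightarrow> word_value G x (left_commutator (c - j)) \<in> upper_central G {\<one>} j" for j x
  proof (induction j arbitrary: x)
    case 0
    then show ?case using one by simp
  next
    case (Suc j)
    let ?m = "c - Suc j"
    have m: "c - j = Suc ?m" using Suc.prems by simp
    have xc: "x i \<in> carrier G" for i using Suc.prems S by blast
    have "gcomm G (word_value G x (left_commutator ?m)) s \<in> upper_central G {\<one>} j" if s: "s \<in> S" for s
    proof -
      \<comment> \<open>The shorter commutator uses only letters up to \<open>?m\<close>, so the
        next entry is free to be any generator.\<close>
      let ?y = "x(Suc ?m := s)"
      have yS: "range ?y \<subseteq> S" using s Suc.prems by auto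
      then have yc: "?y i \<in> carrier G" for i using S by blast
      have "word_value G ?y (left_commutator ?m) = word_value G x (left_commutator ?m)"
        by (rule word_value_cong) (use letters_left_commutator[of ?m] in auto)
      then have "word_value G ?y (left_commutator (c - j)) = gcomm G (word_value G x (left_commutator ?m)) s"
        unfolding m word_value_left_commutator_Suc[of ?y, OF yc] by simp
      moreover have "word_value G ?y (left_commutator (c - j)) \<in> upper_central G {\<one>} j"
        by (rule Suc.IH[OF _ yS]) (use Suc.prems(1) in simp)
      ultimately show ?thesis by simp
    qed
    then have "word_value G x (left_commutator ?m) \<in> central_mod G (upper_central G {\<one>} j)"
    by (intro central_modI_generate[OF n _ S] word_value_closed xc)
    then show ?case by simp
  qed
  have "S \<subseteq> upper_central G {\<one>} c"
  proof
    fix s assume "s \<in> S"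
    then show "s \<in> upper_central G {\<one>} c" using main[of c "\<lambda>_. s"] S by auto
  qed
  then have "generate G S \<subseteq> upper_central G {\<one>} c"
    using normal_imp_subgroup[OF n] by (rule generate_subgroup_incl)
  then show ?thesis using S(2) subgroup.subset[OF normal_imp_subgroup[OF n]] by blast
qed

lemma fg_nilpotent_groupI:
  assumes "group G" "finite_generating_set G S"
    and "\<And>x. range x \<subseteq> S \<Longrightarrow> word_value G x (left_commutator c) = \<one>\<^bsub>G\<^esub>"
  shows "fg_nilpotent_group G"
proof -
  interpret group G by fact
  have "upper_central G {\<one>\<^bsub>G\<^esub>} c = carrier G"
    using assms(2,3) by (intro upper_central_of_left_commutators[of S]) (auto simp: finite_generating_set_def)
  then show ?thesis using assms(2) by unfold_locales blast+
qed

lemma fg_nilpotent_group_of_identities: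
  fixes K :: "('c, 'd) monoid_scheme"
  assumes "fg_nilpotent_group G" "fg_group K" "identities G \<subseteq> identities K"
  shows "fg_nilpotent_group K"
proof -
  interpret G: fg_nilpotent_group G by fact
  obtain c where "upper_central G {\<one>\<^bsub>G\<^esub>} c = carrier G" using G.nilpotent by blast
  then have c: "left_commutator c \<in> identities K" using G.left_commutator_identity assms(3) by blast
  obtain S where S: "group K" "finite_generating_set K S" using assms(2) by (auto simp: fg_group_def)
  show ?thesis
  proof (rule fg_nilpotent_groupI[OF S])
    fix x :: "nat \<Rightarrow> 'c" assume "range x \<subseteq> S"
    then have "range x \<subseteq> carrier K" using S(2) unfolding finite_generating_set_def by blast
    then show "word_value K x (left_commutator c) = \<one>\<^bsub>K\<^esub>" using c unfolding identities_def by blast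
  qed
qed

lemma fg_nilpotent_group_of_nilpotent_group:
  assumes *: "fg_group G" "nilpotent_group G"
  shows "fg_nilpotent_group G"
proof -
  from *(1) interpret group G by (simp add: fg_group_def)
  obtain c where c: "lower_central G c = {\<one>\<^bsub>G\<^esub>}" using * by (auto simp: nilpotent_group_def)
  have lc: "lower_central G i \<subseteq> carrier G" for i
  proof (induction i)
    case (Suc i)
    have "{x \<otimes>\<^bsub>G\<^esub> y \<otimes>\<^bsub>G\<^esub> inv\<^bsub>G\<^esub> x \<otimes>\<^bsub>G\<^esub> inv\<^bsub>G\<^esub> y | x y. x \<in> lower_central G i \<and> y \<in> carrier G} \<subseteq> carrier G"
      using Suc by blast
    then show ?case using generate_incl by simp
  qed simp
  \<comment> \<open>The usual comparison of the two central series, started from the bottom of the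
    lower one.\<close>
  have "i \<le> c \<Longrightarrow> lower_central G (c - i) \<subseteq> upper_central G {\<one>\<^bsub>G\<^esub>} i" for i
  proof (induction i)
    case (Suc i)
    have e: "c - i = Suc (c - Suc i)" using Suc.prems by simp
    have "gcomm G x y \<in> upper_central G {\<one>\<^bsub>G\<^esub>} i" if xy: "x \<in> lower_central G (c - Suc i)" "y \<in> carrier G" for x y
    proof -
      have "gcomm G x y \<in> lower_central G (c - i)"
        unfolding e lower_central.simps gcomm_def using xy by (intro generate.incl) blast
      then show ?thesis using Suc by auto
    qed
    then show ?case using lc[of "c - Suc i"] by (auto simp: central_mod_def)
  qed (use c in simp)
  from this[of c] have "carrier G \<subseteq> upper_central G {\<one>\<^bsub>G\<^esub>} c" by simp
  then have "upper_central G {\<one>\<^bsub>G\<^esub>} c = carrier G"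
    using subgroup.subset[OF normal_imp_subgroup[OF normal_upper_central[OF one_is_normal]]] by blast
  then show ?thesis using * by unfold_locales (auto simp: fg_group_def)
qed

section \<open>Relatively free groups\<close>

text \<open>The constant value off the tuples of \<open>G\<close> makes equality of functions the
  same as equality of values on all tuples of \<open>G\<close>.\<close>

definition word_function :: "('a, 'b) monoid_scheme \<Rightarrow> word \<Rightarrow> (nat \<Rightarrow> 'a) \<Rightarrow> 'a" where
  "word_function G w = (\<lambda>x. if range x \<subseteq> carrier G then word_value G x w else \<one>\<^bsub>G\<^esub>)"

text \<open>The free group of rank \<open>k\<close> in the variety of \<open>G\<close>, realised as
  a group of word functions under pointwise multiplication: a word represents the unit exactly if it
  is an identity of \<open>G\<close>.\<close>

definition relatively_free :: "('a, 'b) monoid_scheme \<Rightarrow> nat \<Rightarrow> ((nat \<Rightarrow> 'a) \<Rightarrow> 'a) monoid" where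
  "relatively_free G k = \<lparr>carrier = {word_function G w | w. letters w \<subseteq> {..<k}},
     monoid.mult = (\<lambda>f g x. f x \<otimes>\<^bsub>G\<^esub> g x), one = (\<lambda>x. \<one>\<^bsub>G\<^esub>)\<rparr>"

definition free_generator :: "('a, 'b) monoid_scheme \<Rightarrow> nat \<Rightarrow> nat \<Rightarrow> (nat \<Rightarrow> 'a) \<Rightarrow> 'a" where
  "free_generator G k i = word_function G (if i < k then [(i, True)] else [])"

context group
begin

lemma word_function_append:
  "word_function G v \<otimes>\<^bsub>relatively_free G k\<^esub> word_function G w = word_function G (v @ w)"
  by (auto simp: relatively_free_def word_function_def fun_eq_iff image_subset_iff word_value_append)

lemma word_function_Nil: "word_function G [] = \<one>\<^bsub>relatively_free G k\<^esub>"
  by (auto simp: relatively_free_def word_function_def)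

lemma word_function_one_iff: "word_function G w = \<one>\<^bsub>relatively_free G k\<^esub> \<longleftrightarrow> w \<in> identities G"
  by (auto simp: relatively_free_def word_function_def identities_def fun_eq_iff)

lemma word_function_inv_append: "word_function G (word_inv w @ w) = word_function G []"
  by (auto simp: word_function_def fun_eq_iff image_subset_iff word_value_append word_value_inv)

lemma carrier_relatively_free:
  "carrier (relatively_free G k) = {word_function G w | w. letters w \<subseteq> {..<k}}"
  by (simp add: relatively_free_def)

lemma group_relatively_free: "group (relatively_free G k)"
proof (rule groupI)
  fix x y assume "x \<in> carrier (relatively_free G k)" "y \<in> carrier (relatively_free G k)"
  then obtain v w where "letters v \<subseteq> {..<k}" "letters w \<subseteq> {..<k}" "x = word_function G v" "y = word_function G w"
    unfolding carrier_relatively_free by blast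
  then show "x \<otimes>\<^bsub>relatively_free G k\<^esub> y \<in> carrier (relatively_free G k)"
    unfolding carrier_relatively_free by (auto simp: word_function_append intro!: exI[of _ "v @ w"])
next
  show "\<one>\<^bsub>relatively_free G k\<^esub> \<in> carrier (relatively_free G k)"
    unfolding carrier_relatively_free word_function_Nil[symmetric] by (auto intro!: exI[of _ "[]"])
next
  fix x y z assume "x \<in> carrier (relatively_free G k)" "y \<in> carrier (relatively_free G k)"
    "z \<in> carrier (relatively_free G k)"
  then show "x \<otimes>\<^bsub>relatively_free G k\<^esub> y \<otimes>\<^bsub>relatively_free G k\<^esub> z =
    x \<otimes>\<^bsub>relatively_free G k\<^esub> (y \<otimes>\<^bsub>relatively_free G k\<^esub> z)"
    unfolding carrier_relatively_free by (auto simp: word_function_append)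
next
  fix x assume x: "x \<in> carrier (relatively_free G k)"
  then obtain w where w: "letters w \<subseteq> {..<k}" "x = word_function G w"
    unfolding carrier_relatively_free by blast
  show "\<one>\<^bsub>relatively_free G k\<^esub> \<otimes>\<^bsub>relatively_free G k\<^esub> x = x"
    unfolding w word_function_Nil[symmetric] word_function_append by simp
  have "word_function G (word_inv w) \<otimes>\<^bsub>relatively_free G k\<^esub> x = \<one>\<^bsub>relatively_free G k\<^esub>"
    unfolding w word_function_append word_function_inv_append word_function_Nil[of k] ..
  moreover have "word_function G (word_inv w) \<in> carrier (relatively_free G k)"
    unfolding carrier_relatively_free using w(1) letters_simps(4)[of w] by blast
  ultimately show "\<exists>y\<in>carrier (relatively_free G k). y \<otimes>\<^bsub>relatively_free G k\<^esub> x = \<one>\<^bsub>relatively_free G k\<^esub>"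
    by blast
qed

lemma inv_word_function:
  assumes "letters w \<subseteq> {..<k}"
  shows "inv\<^bsub>relatively_free G k\<^esub> (word_function G w) = word_function G (word_inv w)"
proof (rule group.inv_equality[OF group_relatively_free])
  show "word_function G (word_inv w) \<otimes>\<^bsub>relatively_free G k\<^esub> word_function G w = \<one>\<^bsub>relatively_free G k\<^esub>"
    unfolding word_function_append word_function_inv_append word_function_Nil[of k] ..
  show "word_function G w \<in> carrier (relatively_free G k)"
    unfolding carrier_relatively_free using assms by blast
  show "word_function G (word_inv w) \<in> carrier (relatively_free G k)"
    unfolding carrier_relatively_free using assms letters_simps(4)[of w] by blast
qed

lemma free_generator_closed: "free_generator G k i \<in> carrier (relatively_free G k)"
proof -
  have "letters (if i < k then [(i, True)] else []) \<subseteq> {..<k}" by simp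
  then show ?thesis unfolding carrier_relatively_free free_generator_def by blast
qed

lemma word_value_free_generator:
  assumes "letters w \<subseteq> {..<k}"
  shows "word_value (relatively_free G k) (free_generator G k) w = word_function G w"
  using assms
proof (induction w)
  case (Cons l w)
  obtain i e where l: "l = (i, e)" by (cases l)
  have i: "i < k" using Cons.prems l by simp
  have "inv\<^bsub>relatively_free G k\<^esub> (word_function G [(i, True)]) = word_function G [(i, False)]"
    using inv_word_function[of "[(i, True)]" k] i by (simp add: word_inv_def)
  then have "(if e then free_generator G k i else inv\<^bsub>relatively_free G k\<^esub> (free_generator G k i)) =
    word_function G [(i, e)]"
    using i by (simp add: free_generator_def)
  then have "word_value (relatively_free G k) (free_generator G k) (l # w) =
    word_function G [(i, e)] \<otimes>\<^bsub>relatively_free G k\<^esub> word_function G w"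
    using Cons l by simp
  then show ?case using word_function_append[where v = "[(i, e)]" and w = w] l by simp
qed (simp add: word_function_Nil[of k])

lemma generate_free_generator:
  "generate (relatively_free G k) (free_generator G k ` {..<k}) = carrier (relatively_free G k)"
  unfolding group.generate_word_value[OF group_relatively_free, of "free_generator G k", OF free_generator_closed]
    carrier_relatively_free
proof (intro equalityI subsetI)
  fix x assume "x \<in> {word_value (relatively_free G k) (free_generator G k) w |w. letters w \<subseteq> {..<k}}"
  then obtain w where "x = word_value (relatively_free G k) (free_generator G k) w" "letters w \<subseteq> {..<k}" by blast
  then have "x = word_function G w" "letters w \<subseteq> {..<k}" by (simp_all add: word_value_free_generator)
  then show "x \<in> {word_function G w |w. letters w \<subseteq> {..<k}}" by blast
next
  fix x assume "x \<in> {word_function G w |w. letters w \<subseteq> {..<k}}"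
  then obtain w where "x = word_function G w" "letters w \<subseteq> {..<k}" by blast
  then have "x = word_value (relatively_free G k) (free_generator G k) w" "letters w \<subseteq> {..<k}"
    by (simp_all add: word_value_free_generator)
  then show "x \<in> {word_value (relatively_free G k) (free_generator G k) w |w. letters w \<subseteq> {..<k}}" by blast
qed

text \<open>The image in the relatively free group of the relations of the marked group
  \<open>(L, t)\<close>. If \<open>L\<close> satisfies the identities of \<open>G\<close>, it is the
  kernel of the induced map to \<open>L\<close>.\<close>

lemma subgroup_relations:
  assumes "group L" and t: "\<And>i. t i \<in> carrier L"
  shows "subgroup {word_function G w | w. letters w \<subseteq> {..<k} \<and> word_value L t w = \<one>\<^bsub>L\<^esub>} (relatively_free G k)"
    (is "subgroup ?N _")
proof (rule group.subgroupI[OF group_relatively_free])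
  interpret L: group L by fact
  show "?N \<subseteq> carrier (relatively_free G k)" unfolding carrier_relatively_free by blast
  have "word_function G [] \<in> ?N" by (auto intro!: exI[of _ "[]"])
  then show "?N \<noteq> {}" by blast
  fix x assume "x \<in> ?N"
  then obtain v where v: "x = word_function G v" "letters v \<subseteq> {..<k}" "word_value L t v = \<one>\<^bsub>L\<^esub>" by blast
  have "word_value L t (word_inv v) = \<one>\<^bsub>L\<^esub>" using v t by (simp add: L.word_value_inv)
  then show "inv\<^bsub>relatively_free G k\<^esub> x \<in> ?N"
    using v inv_word_function[OF v(2)] by (auto intro!: exI[of _ "word_inv v"])
  fix y assume "y \<in> ?N"
  then obtain w where w: "y = word_function G w" "letters w \<subseteq> {..<k}" "word_value L t w = \<one>\<^bsub>L\<^esub>" by blast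
  have "word_value L t (v @ w) = \<one>\<^bsub>L\<^esub>" using v w t by (simp add: L.word_value_append)
  then show "x \<otimes>\<^bsub>relatively_free G k\<^esub> y \<in> ?N"
    using v w word_function_append by (auto intro!: exI[of _ "v @ w"])
qed

end

text \<open>Only left commutators of free generators have to vanish; these are word functions of
  letter substitutions in an identity of \<open>G\<close>.\<close>

lemma (in fg_nilpotent_group) fg_nilpotent_relatively_free: "fg_nilpotent_group (relatively_free G k)"
proof -
  obtain c where "upper_central G {\<one>} c = carrier G" using nilpotent by blast
  then have c: "left_commutator c \<in> identities G" by (rule left_commutator_identity)
  have gen: "finite_generating_set (relatively_free G k) (free_generator G k ` {..<k})"
    unfolding finite_generating_set_def using generate_free_generator free_generator_closed by blast
  show ?thesis
  proof (rule fg_nilpotent_groupI[OF group_relatively_free gen])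
    fix x :: "nat \<Rightarrow> (nat \<Rightarrow> 'a) \<Rightarrow> 'a" assume "range x \<subseteq> free_generator G k ` {..<k}"
    then have "\<forall>i. \<exists>j. j < k \<and> x i = free_generator G k j" by blast
    then obtain j where j: "\<And>i. j i < k" "\<And>i. x i = free_generator G k (j i)" by metis
    define w where "w = word_subst (\<lambda>i. [(j i, True)]) (left_commutator c)"
    have w: "letters w \<subseteq> {..<k}" unfolding w_def using letters_word_subst[of "\<lambda>i. [(j i, True)]"] j by fastforce
    have "w \<in> identities G"
    proof (rule identitiesI)
      fix y :: "nat \<Rightarrow> 'a" assume y: "\<And>i. y i \<in> carrier G"
      have "word_value G y w = word_value G (\<lambda>i. y (j i)) (left_commutator c)"
        unfolding w_def word_value_subst[of y, OF y] using y by simp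
      then show "word_value G y w = \<one>" using identitiesD[OF c, of "\<lambda>i. y (j i)"] y by simp
    qed
    interpret F: group "relatively_free G k" by (rule group_relatively_free)
    have "word_value (relatively_free G k) x (left_commutator c) =
      word_value (relatively_free G k) (free_generator G k) w"
      unfolding w_def F.word_value_subst[of "free_generator G k", OF free_generator_closed]
      using free_generator_closed j by (intro word_value_cong) simp
    also have "\<dots> = \<one>\<^bsub>relatively_free G k\<^esub>"
      unfolding word_value_free_generator[OF w] word_function_one_iff by fact
    finally show "word_value (relatively_free G k) x (left_commutator c) = \<one>\<^bsub>relatively_free G k\<^esub>" .
  qed
qed

section \<open>Invariants of the relation\<close>

definition word_values :: "('a, 'b) monoid_scheme \<Rightarrow> word \<Rightarrow> 'a set" where
  "word_values G w = {word_value G x w | x. range x \<subseteq> carrier G}"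

lemma (in group) one_mem_word_values: "\<one> \<in> word_values G w"
proof -
  have "word_value G (\<lambda>_. \<one>) w = \<one>"
  proof (induction w)
    case (Cons l w)
    then show ?case by (cases l) simp
  qed simp
  then show ?thesis unfolding word_values_def by (intro CollectI exI[of _ "\<lambda>_. \<one>"]) auto
qed

section \<open>Word values along a limit of markings\<close>

lemma marking_limitD:
  assumes "marking_limit G H k t s"
  shows "t i \<in> carrier H" "generate H (t ` {..<k}) = carrier H"
    "s n i \<in> carrier G" "generate G (s n ` {..<k}) = carrier G"
    "letters w \<subseteq> {..<k} \<Longrightarrow>
       \<forall>\<^sub>F n in sequentially. word_value G (s n) w = \<one>\<^bsub>G\<^esub> \<longleftrightarrow> word_value H t w = \<one>\<^bsub>H\<^esub>"
  using assms unfolding marking_limit_def by blast+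

lemma (in group) tuple_of_words:
  assumes t: "\<And>i. t i \<in> carrier G" "generate G (t ` {..<k}) = carrier G" and x: "range x \<subseteq> carrier G"
  obtains v where "\<And>i. letters (v i) \<subseteq> {..<k}" "x = (\<lambda>i. word_value G t (v i))"
proof -
  have "\<forall>i. \<exists>v. letters v \<subseteq> {..<k} \<and> x i = word_value G t v"
    using x t(2) unfolding generate_word_value[of t, OF t(1)] by blast
  then obtain v where "\<And>i. letters (v i) \<subseteq> {..<k}" "\<And>i. x i = word_value G t (v i)" by metis
  then show ?thesis using that[of v] by auto
qed

lemma (in group) word_values_words:
  assumes t: "\<And>i. t i \<in> carrier G" "generate G (t ` {..<k}) = carrier G"
  shows "word_values G w = {word_value G t (word_subst v w) | v. \<forall>i. letters (v i) \<subseteq> {..<k}}"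
proof (intro equalityI subsetI)
  fix g assume "g \<in> word_values G w"
  then obtain x where x: "range x \<subseteq> carrier G" "g = word_value G x w" by (auto simp: word_values_def)
  obtain v where "\<And>i. letters (v i) \<subseteq> {..<k}" "x = (\<lambda>i. word_value G t (v i))"
    using tuple_of_words[of t k x, OF t x(1)] by blast
  moreover from this have "g = word_value G t (word_subst v w)"
    using x(2) word_value_subst[of t v w, OF t(1)] by simp
  ultimately show "g \<in> {word_value G t (word_subst v w) | v. \<forall>i. letters (v i) \<subseteq> {..<k}}" by blast
next
  fix g assume "g \<in> {word_value G t (word_subst v w) | v. \<forall>i. letters (v i) \<subseteq> {..<k}}"
  then obtain v where "g = word_value G (\<lambda>i. word_value G t (v i)) w"
    using word_value_subst[of t, OF t(1)] by blast
  then show "g \<in> word_values G w" using t(1) unfolding word_values_def by (intro CollectI exI conjI) auto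
qed

lemma identities_iff_word_values:
  "w \<in> identities G \<longleftrightarrow> word_values G w \<subseteq> {\<one>\<^bsub>G\<^esub>}"
  by (auto simp: identities_def word_values_def)

lemma letters_word_subst_le:
  "(\<And>i. letters (v i) \<subseteq> {..<k}) \<Longrightarrow> letters (word_subst v w) \<subseteq> {..<k}"
  using letters_word_subst by blast

text \<open>Finitely many distinct values of \<open>w\<close> in \<open>H\<close> come from words
  obtained by substitution into \<open>w\<close>. Under a late marking these words take distinct
  values in \<open>G\<close>, and they are again values of \<open>w\<close>.\<close>

lemma marking_limit_word_values_le:
  assumes "group G" "group H" and lim: "marking_limit G H k t s" and fin: "finite (word_values G w)"
  shows "finite (word_values H w) \<and> card (word_values H w) \<le> card (word_values G w)"
proof -
  interpret G: group G by fact
  interpret H: group H by fact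
  note D = marking_limitD[OF lim]
  have "card A \<le> card (word_values G w)" if A: "finite A" "A \<subseteq> word_values H w" for A
  proof -
    have "\<exists>u. letters u \<subseteq> {..<k} \<and> word_value H t u = a \<and> (\<forall>n. word_value G (s n) u \<in> word_values G w)"
      if a: "a \<in> A" for a
    proof -
      obtain v where v: "\<And>i. letters (v i) \<subseteq> {..<k}" "a = word_value H t (word_subst v w)"
        using A(2) a unfolding H.word_values_words[of t k w, OF D(1,2)] by blast
      moreover have "word_value G (s n) (word_subst v w) \<in> word_values G w" for n
        using v(1) unfolding G.word_values_words[of "s n" k w, OF D(3,4)] by blast
      ultimately show ?thesis using letters_word_subst_le[of v k w] by blast
    qed
    then obtain u where u: "\<And>a. a \<in> A \<Longrightarrow> letters (u a) \<subseteq> {..<k}" "\<And>a. a \<in> A \<Longrightarrow> word_value H t (u a) = a"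
      "\<And>a n. a \<in> A \<Longrightarrow> word_value G (s n) (u a) \<in> word_values G w" by metis
    define M where "M = 2 * (\<Sum>a\<in>A. length (u a))"
    obtain n where n: "same_relations G (s n) H t k M"
      using eventually_happens[OF eventually_same_relations[of k G s H t M, OF D(5)]] by auto
    have "inj_on (\<lambda>a. word_value G (s n) (u a)) A"
    proof (rule inj_onI)
      fix a b assume ab: "a \<in> A" "b \<in> A" "word_value G (s n) (u a) = word_value G (s n) (u b)"
      have "length (u c) \<le> (\<Sum>a\<in>A. length (u a))" if "c \<in> A" for c
        using member_le_sum[OF that _ A(1), of "\<lambda>a. length (u a)"] by simp
      then have "length (u a) + length (u b) \<le> M" using ab(1,2) unfolding M_def by (metis add_mono mult_2)
      then have "word_value H t (u a) = word_value H t (u b)"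
        using same_relations_eq_iff[of G H "s n" t k M "u a" "u b", OF assms(1,2) D(3,1) n u(1)[OF ab(1)] u(1)[OF ab(2)]]
          ab(3) by blast
      then show "a = b" using u(2) ab by metis
    qed
    then show ?thesis by (rule card_inj_on_le) (use u(3) fin in auto)
  qed
  then show ?thesis using finite_if_finite_subsets_card_bdd by meson
qed

text \<open>Every substitution into an identity of \<open>G\<close> is a relation of all its
  markings, hence of the limit.\<close>

lemma marking_limit_identities:
  assumes "group G" "group H" and lim: "marking_limit G H k t s"
  shows "identities G \<subseteq> identities H"
proof
  interpret G: group G by fact
  interpret H: group H by fact
  note D = marking_limitD[OF lim]
  fix w assume w: "w \<in> identities G"
  show "w \<in> identities H"
    unfolding identities_iff_word_values H.word_values_words[of t k w, OF D(1,2)]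
  proof clarify
    fix v :: "nat \<Rightarrow> word" assume v: "\<forall>i. letters (v i) \<subseteq> {..<k}"
    have "word_value G (s n) (word_subst v w) = \<one>\<^bsub>G\<^esub>" for n
      using w v unfolding identities_iff_word_values G.word_values_words[of "s n" k w, OF D(3,4)] by blast
    moreover have "letters (word_subst v w) \<subseteq> {..<k}" using v letters_word_subst_le[of v k w] by blast
    ultimately show "word_value H t (word_subst v w) = \<one>\<^bsub>H\<^esub>"
      using eventually_happens[OF D(5)[of "word_subst v w"]] by simp
  qed
qed

text \<open>The only use of finite presentability: the kernel of the marking of \<open>H\<close> in the relatively free
  group of \<open>G\<close> is finitely generated, so it dies in \<open>G\<close> under a sufficiently late marking.\<close>

lemma marking_limit_quotient:
  assumes "fg_nilpotent_group G" "group H" and lim: "marking_limit G H k t s"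
  shows "\<exists>n. \<forall>w. letters w \<subseteq> {..<k} \<longrightarrow> word_value H t w = \<one>\<^bsub>H\<^esub> \<longrightarrow> word_value G (s n) w = \<one>\<^bsub>G\<^esub>"
proof -
  interpret G: fg_nilpotent_group G by fact
  interpret H: group H by fact
  interpret F: fg_nilpotent_group "relatively_free G k" by (rule G.fg_nilpotent_relatively_free)
  note D = marking_limitD[OF lim]
  let ?N = "{word_function G w | w. letters w \<subseteq> {..<k} \<and> word_value H t w = \<one>\<^bsub>H\<^esub>}"
  let ?P = "\<lambda>n. {word_function G w | w. letters w \<subseteq> {..<k} \<and> word_value G (s n) w = \<one>\<^bsub>G\<^esub>}"
  obtain A where A: "finite A" "A \<subseteq> ?N" "generate (relatively_free G k) A = ?N"
    using F.subgroup_finitely_generated[OF G.subgroup_relations[of H t k, OF assms(2) D(1)]] by blast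
  have "\<forall>\<^sub>F n in sequentially. a \<in> ?P n" if a: "a \<in> A" for a
  proof -
    obtain w where w: "a = word_function G w" "letters w \<subseteq> {..<k}" "word_value H t w = \<one>\<^bsub>H\<^esub>"
      using A(2) a by blast
    show ?thesis using D(5)[OF w(2)] by (rule eventually_mono) (use w in blast)
  qed
  then have "\<forall>\<^sub>F n in sequentially. \<forall>a\<in>A. a \<in> ?P n" by (intro eventually_ball_finite[OF A(1)] ballI)
  from eventually_happens'[OF sequentially_bot this] obtain n where n: "\<forall>a\<in>A. a \<in> ?P n" ..
  then have "A \<subseteq> ?P n" unfolding subset_eq .
  from F.generate_subgroup_incl[OF this G.subgroup_relations[of G "s n" k, OF G.is_group D(3)]]
  have N: "?N \<subseteq> ?P n" unfolding A(3) .
  have "word_value G (s n) w = \<one>\<^bsub>G\<^esub>" if w: "letters w \<subseteq> {..<k}" "word_value H t w = \<one>\<^bsub>H\<^esub>" for w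
  proof -
    have "word_function G w \<in> ?P n" using N w by blast
    then obtain v where v: "word_function G w = word_function G v" "word_value G (s n) v = \<one>\<^bsub>G\<^esub>" by blast
    have "range (s n) \<subseteq> carrier G" using D(3) by blast
    \<comment> \<open>Equal word functions agree on every tuple of \<open>G\<close>, in particular
      on the marking.\<close>
    then show ?thesis using fun_cong[OF v(1), of "s n"] v(2) by (simp add: word_function_def)
  qed
  then show ?thesis by blast
qed

text \<open>The implication between relations defines an epimorphism from \<open>H\<close> to
  \<open>G\<close> sending \<open>t\<close> to \<open>s\<close>. It maps values of \<open>w\<close>
  onto values of \<open>w\<close>; only this effect and the image of the unit are retained.\<close>

lemma quotient_word_values_le:
  assumes "group G" "group H" and t: "\<And>i. t i \<in> carrier H" "generate H (t ` {..<k}) = carrier H"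
    and s: "\<And>i. s i \<in> carrier G" "generate G (s ` {..<k}) = carrier G"
    and quot: "\<And>w. \<lbrakk>letters w \<subseteq> {..<k}; word_value H t w = \<one>\<^bsub>H\<^esub>\<rbrakk> \<Longrightarrow> word_value G s w = \<one>\<^bsub>G\<^esub>"
  shows "\<exists>f. word_values G w = f ` word_values H w \<and> f \<one>\<^bsub>H\<^esub> = \<one>\<^bsub>G\<^esub>"
proof -
  interpret G: group G by fact
  interpret H: group H by fact
  have eq: "word_value G s u = word_value G s v"
    if "letters u \<subseteq> {..<k}" "letters v \<subseteq> {..<k}" "word_value H t u = word_value H t v" for u v
  proof -
    have "word_value H t (u @ word_inv v) = \<one>\<^bsub>H\<^esub>"
      using that t(1) by (simp add: H.word_value_append H.word_value_inv)
    then have "word_value G s u \<otimes>\<^bsub>G\<^esub> inv\<^bsub>G\<^esub> word_value G s v = \<one>\<^bsub>G\<^esub>"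
      using quot[of "u @ word_inv v"] that s(1) by (simp add: G.word_value_append G.word_value_inv)
    then show ?thesis using s(1) by (metis G.inv_equality G.inv_inv G.word_value_closed G.inv_closed)
  qed
  define f where "f h = word_value G s (SOME u. letters u \<subseteq> {..<k} \<and> word_value H t u = h)" for h
  have f: "f (word_value H t u) = word_value G s u" if u: "letters u \<subseteq> {..<k}" for u
  proof -
    have "letters (SOME v. letters v \<subseteq> {..<k} \<and> word_value H t v = word_value H t u) \<subseteq> {..<k} \<and>
      word_value H t (SOME v. letters v \<subseteq> {..<k} \<and> word_value H t v = word_value H t u) = word_value H t u"
      by (rule someI_ex) (use u in blast)
    then show ?thesis unfolding f_def using eq u by blast
  qed
  have "word_values G w = f ` word_values H w"
    unfolding G.word_values_words[of s k w, OF s] H.word_values_words[of t k w, OF t]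
  proof (intro equalityI subsetI)
    fix g assume "g \<in> {word_value G s (word_subst v w) | v. \<forall>i. letters (v i) \<subseteq> {..<k}}"
    then obtain v where v: "\<forall>i. letters (v i) \<subseteq> {..<k}" "g = word_value G s (word_subst v w)" by blast
    then have "g = f (word_value H t (word_subst v w))" using f letters_word_subst_le[of v k w] by simp
    then show "g \<in> f ` {word_value H t (word_subst v w) | v. \<forall>i. letters (v i) \<subseteq> {..<k}}" using v(1) by blast
  next
    fix g assume "g \<in> f ` {word_value H t (word_subst v w) | v. \<forall>i. letters (v i) \<subseteq> {..<k}}"
    then obtain v where v: "\<forall>i. letters (v i) \<subseteq> {..<k}" "g = f (word_value H t (word_subst v w))" by blast
    then have "g = word_value G s (word_subst v w)" using f letters_word_subst_le[of v k w] by simp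
    then show "g \<in> {word_value G s (word_subst v w) | v. \<forall>i. letters (v i) \<subseteq> {..<k}}" using v(1) by blast
  qed
  moreover have "f \<one>\<^bsub>H\<^esub> = \<one>\<^bsub>G\<^esub>" using f[of "[]"] by simp
  ultimately show ?thesis by blast
qed

lemma length_word_subst_letter: "length (word_subst (\<lambda>i. [(j i, b)]) w) = length w"
  by (induction w) (auto simp: word_subst_def)

text \<open>Left commutators in the generators of the marking all have the same length, since
  letters are substituted for letters. A marking late enough for this length inherits their
  triviality from \<open>H\<close>.\<close>

lemma marking_limit_fg_nilpotent:
  fixes G :: "('a, 'b) monoid_scheme"
  assumes "group G" "fg_nilpotent_group H" and lim: "marking_limit G H k t s"
  shows "fg_nilpotent_group G"
proof -
  interpret G: group G by fact
  interpret H: fg_nilpotent_group H by fact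
  note D = marking_limitD[OF lim]
  obtain c where "upper_central H {\<one>\<^bsub>H\<^esub>} c = carrier H" using H.nilpotent by blast
  then have c: "left_commutator c \<in> identities H" by (rule H.left_commutator_identity)
  obtain n where n: "same_relations G (s n) H t k (length (left_commutator c))"
    using eventually_happens[OF eventually_same_relations[of k G s H t "length (left_commutator c)", OF D(5)]] by auto
  have gen: "finite_generating_set G (s n ` {..<k})"
    using D(3,4) unfolding finite_generating_set_def by blast
  show ?thesis
  proof (rule fg_nilpotent_groupI[OF assms(1) gen])
    fix x :: "nat \<Rightarrow> 'a" assume "range x \<subseteq> s n ` {..<k}"
    then have "\<forall>i. \<exists>j. j < k \<and> x i = s n j" by blast
    then obtain j where j: "\<And>i. j i < k" "\<And>i. x i = s n (j i)" by metis
    define w where "w = word_subst (\<lambda>i. [(j i, True)]) (left_commutator c)"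
    have w: "letters w \<subseteq> {..<k}" unfolding w_def using j(1) by (intro letters_word_subst_le) simp
    have "word_value H t w = word_value H (\<lambda>i. t (j i)) (left_commutator c)"
      unfolding w_def H.word_value_subst[of t, OF D(1)] using D(1) by simp
    also have "\<dots> = \<one>\<^bsub>H\<^esub>" using c D(1) by (intro identitiesD)
    finally have "word_value G (s n) w = \<one>\<^bsub>G\<^esub>"
      using n w unfolding same_relations_def by (simp add: w_def length_word_subst_letter)
    moreover have "word_value G (s n) w = word_value G x (left_commutator c)"
    proof -
      have x: "x = (\<lambda>i. s n (j i))" by (rule ext) (rule j(2))
      show ?thesis unfolding w_def x G.word_value_subst[of "s n", OF D(3)] using D(3) by simp
    qed
    ultimately show "word_value G x (left_commutator c) = \<one>\<^bsub>G\<^esub>" by simp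
  qed
qed

text \<open>Passing to the limit gives one inclusion of identities and one inequality of
  cardinalities, the quotient map from \<open>H\<close> to \<open>G\<close> the other. Value sets
  are never empty, so \<open>card\<close> being 0 marks the infinite ones and finiteness is part of
  the invariant.\<close>

lemma preforms_invariants:
  assumes "group G" "group H" "preforms G H" "fg_nilpotent_group G \<or> fg_nilpotent_group H"
  shows "identities G = identities H" "card (word_values G w) = card (word_values H w)"
proof -
  obtain k t s where lim: "marking_limit G H k t s"
    using preforms_imp_marking_limit[OF assms(1-3)] by blast
  note D = marking_limitD[OF lim]
  have G: "fg_nilpotent_group G" using assms(4) marking_limit_fg_nilpotent[OF assms(1) _ lim] by blast
  obtain n where quot: "\<And>w. \<lbrakk>letters w \<subseteq> {..<k}; word_value H t w = \<one>\<^bsub>H\<^esub>\<rbrakk> \<Longrightarrow> word_value G (s n) w = \<one>\<^bsub>G\<^esub>"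
    using marking_limit_quotient[OF G assms(2) lim] by blast
  have img: "\<exists>f. word_values G w = f ` word_values H w \<and> f \<one>\<^bsub>H\<^esub> = \<one>\<^bsub>G\<^esub>" for w
    using quotient_word_values_le[of G H t k "s n" w, OF assms(1,2) D(1-4) quot] .
  have "w \<in> identities G" if "w \<in> identities H" for w
    using that img[of w] unfolding identities_iff_word_values by auto
  then show "identities G = identities H" using marking_limit_identities[OF assms(1,2) lim] by blast
  obtain f where f: "word_values G w = f ` word_values H w" using img by blast
  show "card (word_values G w) = card (word_values H w)"
  proof (cases "finite (word_values G w)")
    case True
    then have "finite (word_values H w)" "card (word_values H w) \<le> card (word_values G w)"
      using marking_limit_word_values_le[OF assms(1,2) lim] by blast+
    then show ?thesis using card_image_le[of "word_values H w" f] f by simp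
  next
    case False
    then have "infinite (word_values H w)" using f by auto
    then show ?thesis using False by simp
  qed
qed

section \<open>Isomorphism classes\<close>

lemma (in group) finite_generating_tuple:
  assumes "finite_generating_set G S"
  obtains d :: nat and g :: "nat \<Rightarrow> 'a" where "\<And>i. g i \<in> carrier G" "generate G (g ` {..<d}) = carrier G"
proof -
  define d where "d = card S"
  obtain g0 where "bij_betw g0 {0..<d} S"
    using assms ex_bij_betw_nat_finite[of S] unfolding finite_generating_set_def d_def by blast
  then have g0: "g0 ` {..<d} = S" unfolding atLeast0LessThan by (rule bij_betw_imp_surj_on)
  define g where "g i = (if i < d then g0 i else \<one>)" for i
  have "g ` {..<d} = g0 ` {..<d}" by (rule image_cong) (simp_all add: g_def)
  then have gS: "g ` {..<d} = S" using g0 by simp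
  have "g i \<in> carrier G" for i
    using assms gS by (cases "i < d") (auto simp: g_def finite_generating_set_def)
  then show ?thesis using that[of g d] gS assms by (simp add: finite_generating_set_def)
qed

lemma iso_word_values:
  assumes "group G" "group K" "h \<in> iso G K"
  shows "word_values K w = h ` word_values G w"
proof -
  interpret h: group_hom G K h
    using assms unfolding iso_def group_hom_def group_hom_axioms_def by blast
  have bij: "bij_betw h (carrier G) (carrier K)" using assms(3) by (simp add: iso_def)
  show ?thesis
  proof (intro equalityI subsetI)
    fix a assume "a \<in> word_values K w"
    then obtain y where y: "range y \<subseteq> carrier K" "a = word_value K y w" by (auto simp: word_values_def)
    define x where "x i = inv_into (carrier G) h (y i)" for i
    have hx: "h (x i) = y i" and xc: "x i \<in> carrier G" for i
    proof -
      have "y i \<in> h ` carrier G" using y(1) bij_betw_imp_surj_on[OF bij] by blast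
      then show "h (x i) = y i" "x i \<in> carrier G" unfolding x_def by (rule f_inv_into_f, rule inv_into_into)
    qed
    have "h (word_value G x w) = word_value K (\<lambda>i. h (x i)) w" by (rule h.hom_word_value[OF xc])
    then have "a = h (word_value G x w)" using y(2) hx by simp
    moreover have "word_value G x w \<in> word_values G w" unfolding word_values_def using xc by blast
    ultimately show "a \<in> h ` word_values G w" by blast
  next
    fix a assume "a \<in> h ` word_values G w"
    then obtain x where x: "range x \<subseteq> carrier G" "a = h (word_value G x w)" by (auto simp: word_values_def)
    have xc: "x i \<in> carrier G" for i using x(1) by blast
    have "a = word_value K (\<lambda>i. h (x i)) w" using x(2) h.hom_word_value[of x w, OF xc] by simp
    moreover have "range (\<lambda>i. h (x i)) \<subseteq> carrier K" using xc h.hom_closed by blast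
    ultimately show "a \<in> word_values K w" unfolding word_values_def by blast
  qed
qed

lemma word_values_subset: "group G \<Longrightarrow> word_values G w \<subseteq> carrier G"
  unfolding word_values_def by (auto intro!: group.word_value_closed)

lemma is_iso_invariants:
  assumes "group G" "group K" "G \<cong> K"
  shows "identities G = identities K" "card (word_values G w) = card (word_values K w)"
proof -
  obtain h where h: "h \<in> iso G K" using assms(3) by (auto simp: is_iso_def)
  have inj: "inj_on h (carrier G)" using h by (simp add: iso_def bij_betw_def)
  have one: "h \<one>\<^bsub>G\<^esub> = \<one>\<^bsub>K\<^esub>" using h assms by (simp add: iso_def hom_one)
  have img: "word_values K w = h ` word_values G w" for w using iso_word_values[OF assms(1,2) h] .
  have "word_values K w \<subseteq> {\<one>\<^bsub>K\<^esub>} \<longleftrightarrow> word_values G w \<subseteq> {\<one>\<^bsub>G\<^esub>}" for w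
  proof
    assume *: "word_values K w \<subseteq> {\<one>\<^bsub>K\<^esub>}"
    show "word_values G w \<subseteq> {\<one>\<^bsub>G\<^esub>}"
    proof
      fix a assume a: "a \<in> word_values G w"
      then have "h a \<in> word_values K w" unfolding img by (rule imageI)
      then have "h a = h \<one>\<^bsub>G\<^esub>" using * unfolding one by blast
      moreover have "a \<in> carrier G" using a word_values_subset[OF assms(1)] by blast
      moreover have "\<one>\<^bsub>G\<^esub> \<in> carrier G" using group.is_monoid[OF assms(1)] by (rule monoid.one_closed)
      ultimately have "a = \<one>\<^bsub>G\<^esub>" by (rule inj_onD[OF inj])
      then show "a \<in> {\<one>\<^bsub>G\<^esub>}" by simp
    qed
  next
    assume "word_values G w \<subseteq> {\<one>\<^bsub>G\<^esub>}"
    then show "word_values K w \<subseteq> {\<one>\<^bsub>K\<^esub>}" unfolding img using one by auto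
  qed
  then show "identities G = identities K" by (auto simp: identities_iff_word_values)
  have "inj_on h (word_values G w)" using inj word_values_subset[OF assms(1)] by (rule inj_on_subset)
  then show "card (word_values G w) = card (word_values K w)" unfolding img by (simp add: card_image)
qed

lemma fg_group_iso:
  assumes "fg_group G" "group K" "h \<in> iso G K"
  shows "fg_group K"
proof -
  obtain S where G: "group G" and S: "finite S" "S \<subseteq> carrier G" "generate G S = carrier G"
    using assms(1) by (auto simp: fg_group_def finite_generating_set_def)
  interpret h: group_hom G K h
    using assms G unfolding iso_def group_hom_def group_hom_axioms_def by blast
  have "h ` carrier G = carrier K" using assms(3) by (simp add: iso_def bij_betw_def)
  then have "generate K (h ` S) = carrier K" using h.generate_img[OF S(2)] S(3) by simp
  moreover have "h ` S \<subseteq> carrier K" using S(2) h.hom_closed by blast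
  ultimately have "finite_generating_set K (h ` S)" using S(1) by (simp add: finite_generating_set_def)
  then show ?thesis using assms(2) by (auto simp: fg_group_def)
qed

text \<open>Brings relatively free groups and direct products, whose elements have other types, back
  to the type over which isomorphism classes are formed.\<close>

lemma exists_nat_copy:
  assumes "fg_group G"
  shows "\<exists>(K :: nat monoid) h. h \<in> iso G K \<and> fg_group K"
proof -
  obtain S where S: "group G" "finite_generating_set G S" using assms by (auto simp: fg_group_def)
  interpret group G by fact
  obtain d :: nat and t :: "nat \<Rightarrow> 'a" where t: "\<And>i. t i \<in> carrier G" "generate G (t ` {..<d}) = carrier G"
    by (rule finite_generating_tuple[OF S(2)]) (rule that)
  have "carrier G = {word_value G t w | w. letters w \<subseteq> {..<d}}"
    using t(2) unfolding generate_word_value[of t, OF t(1)] by (rule sym)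
  then have "carrier G \<subseteq> range (word_value G t)" by blast
  then have "countable (carrier G)" by (rule countable_subset) simp
  then have inj: "inj_on (to_nat_on (carrier G)) (carrier G)" by (rule inj_on_to_nat_on)
  define f where "f = to_nat_on (carrier G)"
  define g where "g = inv_into (carrier G) f"
  have gf: "g (f a) = a" if "a \<in> carrier G" for a
    using inj that unfolding g_def f_def by (rule inv_into_f_f)
  define K :: "nat monoid" where
    "K = \<lparr>carrier = f ` carrier G, monoid.mult = (\<lambda>a b. f (g a \<otimes>\<^bsub>G\<^esub> g b)), one = f \<one>\<^bsub>G\<^esub>\<rparr>"
  have "f \<in> hom G K" by (rule homI) (simp_all add: K_def gf)
  moreover have "bij_betw f (carrier G) (carrier K)" using inj by (simp add: K_def f_def bij_betw_def)
  ultimately have f: "f \<in> iso G K" by (rule isoI)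
  then have "group (K\<lparr>one := f \<one>\<^bsub>G\<^esub>\<rparr>)" by (rule iso_imp_img_group)
  then have "group K" by (simp add: K_def)
  then show ?thesis using f fg_group_iso[OF assms _ f] by blast
qed

lemma iso_class_eqI:
  assumes "group G" "group K" "G \<cong> K" shows "iso_class G = iso_class K"
proof (intro equalityI subsetI)
  fix M assume "M \<in> iso_class G"
  then have "group M" "G \<cong> M" by (simp_all add: iso_class_def)
  then show "M \<in> iso_class K"
    using group.iso_sym[OF assms(1,3)] iso_trans[of K G M] by (simp add: iso_class_def)
next
  fix M assume "M \<in> iso_class K"
  then show "M \<in> iso_class G" using assms(3) iso_trans[of G K M] by (simp add: iso_class_def)
qed

lemma mem_iso_class: "group K \<Longrightarrow> K \<in> iso_class K"
  by (simp add: iso_class_def iso_refl)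

lemma is_iso_of_iso_class_eq:
  fixes L :: "nat monoid"
  assumes "group L" "iso_class K = iso_class L"
  shows "K \<cong> L"
proof -
  have "L \<in> iso_class K" unfolding assms(2) using assms(1) by (rule mem_iso_class)
  then show ?thesis by (simp add: iso_class_def)
qed

lemma equiv_preforms_connected: "equiv fg_classes preforms_connected"
proof (rule equivI)
  show "preforms_connected \<subseteq> fg_classes \<times> fg_classes" by (auto simp: preforms_connected_def)
  show "refl_on fg_classes preforms_connected"
    by (auto simp: refl_on_def preforms_connected_def equivclp_def)
  show "sym preforms_connected"
    by (auto simp: sym_def preforms_connected_def intro: equivclp_sym)
  show "trans preforms_connected"
    by (auto simp: trans_def preforms_connected_def intro: transpD[OF transp_equivclp])
qed

text \<open>Consecutive edges of a path may use different representatives of a class, so the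
  invariants are first carried along an isomorphism. Nilpotency of each representative follows from
  its identities, and makes both orientations of the next edge harmless.\<close>

lemma equivclp_preforms_class_invariants:
  assumes "fg_nilpotent_group K" "equivclp preforms_class (iso_class (K :: nat monoid)) D"
  shows "\<exists>L :: nat monoid. D = iso_class L \<and> fg_group L \<and> identities L = identities K \<and>
    (\<forall>w. card (word_values L w) = card (word_values K w))"
  using assms(2)
proof (induction rule: equivclp_induct)
  case base
  have "fg_group K"
    using assms(1) fg_nilpotent_group.finitely_generated[of K] fg_nilpotent_group.axioms(1)[of K]
    by (simp add: fg_group_def)
  then show ?case by blast
next
  case (step C D)
  obtain L :: "nat monoid" where L: "C = iso_class L" "fg_group L" "identities L = identities K"
    "\<And>w. card (word_values L w) = card (word_values K w)" using step.IH by blast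
  have gL: "group L" using L(2) by (simp add: fg_group_def)
  have inv: "identities A = identities K \<and> (\<forall>w. card (word_values A w) = card (word_values K w)) \<and>
      fg_nilpotent_group A" if A: "fg_group A" "C = iso_class A" for A :: "nat monoid"
  proof -
    have "group A" using A by (simp add: fg_group_def)
    moreover have "L \<cong> A" using L(1) A(2) \<open>group A\<close> by (intro is_iso_of_iso_class_eq) simp_all
    ultimately have "identities A = identities K" "\<And>w. card (word_values A w) = card (word_values K w)"
      using is_iso_invariants[OF gL, of A] L by simp_all
    then show ?thesis using fg_nilpotent_group_of_identities[OF assms(1) A(1)] by blast
  qed
  show ?case
    using step.hyps(2)
  proof
    assume "preforms_class C D"
    then obtain A B :: "nat monoid" where AB: "fg_group A" "fg_group B" "C = iso_class A" "D = iso_class B" "preforms A B"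
      unfolding preforms_class_def by blast
    then have "group A" "group B" by (simp_all add: fg_group_def)
    then show ?thesis
      using preforms_invariants[of A B] AB inv[OF AB(1,3)] by (intro exI[of _ B]) simp
  next
    assume "preforms_class D C"
    then obtain A B :: "nat monoid" where AB: "fg_group A" "fg_group B" "C = iso_class B" "D = iso_class A" "preforms A B"
      unfolding preforms_class_def by blast
    then have "group A" "group B" by (simp_all add: fg_group_def)
    then show ?thesis
      using preforms_invariants[of A B] AB inv[OF AB(2,3)] by (intro exI[of _ A]) simp
  qed
qed

section \<open>Torsion-free quotients generating the variety\<close>

lemma (in fg_nilpotent_group) identities_Mod_torsion:
  "w \<in> identities (G Mod torsion G) \<longleftrightarrow> (\<forall>x. (\<forall>i. x i \<in> carrier G) \<longrightarrow> word_value G x w \<in> torsion G)"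
proof -
  let ?T = "torsion G"
  interpret q: group_hom G "G Mod ?T" "(#>) ?T" using normal_torsion by (rule hom_Mod)
  have iff: "word_value G x w \<in> ?T \<longleftrightarrow> word_value (G Mod ?T) (\<lambda>i. ?T #> x i) w = \<one>\<^bsub>G Mod ?T\<^esub>"
    if "\<And>i. x i \<in> carrier G" for x
    using coset_one_iff[OF normal_torsion, of "word_value G x w"] q.hom_word_value[of x w, OF that] that by simp
  show ?thesis
  proof
    assume "w \<in> identities (G Mod ?T)"
    then show "\<forall>x. (\<forall>i. x i \<in> carrier G) \<longrightarrow> word_value G x w \<in> ?T"
      using iff identitiesD[of w "G Mod ?T"] by simp
  next
    assume *: "\<forall>x. (\<forall>i. x i \<in> carrier G) \<longrightarrow> word_value G x w \<in> ?T"
    show "w \<in> identities (G Mod ?T)"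
    proof (rule identitiesI)
      fix y :: "nat \<Rightarrow> 'a set" assume "\<And>i. y i \<in> carrier (G Mod ?T)"
      then have "\<forall>i. \<exists>a. a \<in> carrier G \<and> y i = ?T #> a" by (auto simp: carrier_FactGroup)
      then obtain x where x: "\<And>i. x i \<in> carrier G" "\<And>i. y i = ?T #> x i" by metis
      then have "y = (\<lambda>i. ?T #> x i)" by blast
      then show "word_value (G Mod ?T) y w = \<one>\<^bsub>G Mod ?T\<^esub>" using iff[of x] x(1) * by simp
    qed
  qed
qed

text \<open>If all values of \<open>w\<close> are torsion then \<open>w\<^sup>e\<close> is an identity, \<open>e\<close> being the exponent of the torsion.\<close>

lemma exists_nontorsion_value:
  fixes G :: "('a, 'b) monoid_scheme" and K :: "('c, 'd) monoid_scheme"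
  assumes "fg_nilpotent_group G" "generates_variety (G Mod torsion G) (variety_generated G)"
    and "fg_nilpotent_group K" "identities K = identities G" "w \<notin> identities K"
  shows "\<exists>y. (\<forall>i. y i \<in> carrier K) \<and> word_value K y w \<notin> torsion K"
proof (rule ccontr)
  interpret G: fg_nilpotent_group G by fact
  interpret K: fg_nilpotent_group K by fact
  assume no: "\<not> ?thesis"
  obtain e :: nat where e: "e > 0" "\<And>x. x \<in> torsion K \<Longrightarrow> x [^]\<^bsub>K\<^esub> e = \<one>\<^bsub>K\<^esub>"
    using K.torsion_exponent by blast
  have "concat (replicate e w) \<in> identities K"
  proof (rule identitiesI)
    fix x :: "nat \<Rightarrow> 'c" assume x: "\<And>i. x i \<in> carrier K"
    then have "word_value K x w \<in> torsion K" using no by blast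
    then show "word_value K x (concat (replicate e w)) = \<one>\<^bsub>K\<^esub>"
      using e(2) K.word_value_concat_replicate[of x e w, OF x] by simp
  qed
  then have we: "concat (replicate e w) \<in> identities G" using assms(4) by simp
  have "w \<in> identities (G Mod torsion G)"
    unfolding G.identities_Mod_torsion
  proof (intro allI impI)
    fix x :: "nat \<Rightarrow> 'a" assume x: "\<forall>i. x i \<in> carrier G"
    then have "word_value G x (concat (replicate e w)) = \<one>\<^bsub>G\<^esub>" using identitiesD[OF we] by blast
    then have "word_value G x w [^]\<^bsub>G\<^esub> e = \<one>\<^bsub>G\<^esub>" using x by (simp add: G.word_value_concat_replicate)
    moreover have "word_value G x w \<in> carrier G" using x by simp
    ultimately show "word_value G x w \<in> torsion G" using e(1) unfolding torsion_def by blast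
  qed
  then show False
    using assms(2,4,5) by (simp add: generates_variety_def variety_generated_def)
qed

text \<open>The marking with index \<open>n\<close> is chosen so that every word of length at most
  \<open>n\<close> that is not an identity has a value of infinite order. Identities vanish under
  every marking, so in the limit the relations are exactly the identities.\<close>

lemma marking_limit_relatively_free:
  fixes d k :: nat
  assumes "group G" "fg_nilpotent_group K" "identities K = identities G"
    and nt: "\<And>w. w \<notin> identities K \<Longrightarrow> \<exists>y. (\<forall>i. y i \<in> carrier K) \<and> word_value K y w \<notin> torsion K"
    and g: "\<And>i. g i \<in> carrier K" "generate K (g ` {..<d}) = carrier K" and k: "2 * d \<le> k"
  shows "\<exists>s. marking_limit K (relatively_free G k) k (free_generator G k) s"
proof -
  interpret G: group G by fact
  interpret K: fg_nilpotent_group K by fact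
  let ?\<Omega> = "\<lambda>n. {w \<in> {w. letters w \<subseteq> {..<k} \<and> length w \<le> n}. w \<notin> identities K}"
  have fin: "finite (?\<Omega> n)" for n by (rule finite_subset[OF _ finite_words[of k n]]) blast
  have "\<exists>s. (\<forall>i. s i \<in> carrier K) \<and> generate K (s ` {..<k}) = carrier K \<and>
    (\<forall>w\<in>?\<Omega> n. word_value K s w \<notin> torsion K)" for n
    using nt by (intro K.generating_nontorsion_tuple[of g d k "?\<Omega> n", OF g k fin]) blast
  then have "\<exists>s. \<forall>n. (\<forall>i. s n i \<in> carrier K) \<and> generate K (s n ` {..<k}) = carrier K \<and>
    (\<forall>w\<in>?\<Omega> n. word_value K (s n) w \<notin> torsion K)" by (intro choice allI)
  then obtain s where s: "\<And>n i. s n i \<in> carrier K" "\<And>n. generate K (s n ` {..<k}) = carrier K"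
    "\<And>n w. w \<in> ?\<Omega> n \<Longrightarrow> word_value K (s n) w \<notin> torsion K" by blast
  have "\<forall>\<^sub>F n in sequentially. word_value K (s n) w = \<one>\<^bsub>K\<^esub> \<longleftrightarrow>
    word_value (relatively_free G k) (free_generator G k) w = \<one>\<^bsub>relatively_free G k\<^esub>"
    if w: "letters w \<subseteq> {..<k}" for w
    unfolding G.word_value_free_generator[OF w] G.word_function_one_iff
    using eventually_ge_at_top[of "length w"]
  proof (rule eventually_mono)
    fix n assume n: "length w \<le> n"
    show "word_value K (s n) w = \<one>\<^bsub>K\<^esub> \<longleftrightarrow> w \<in> identities G"
    proof
      assume "word_value K (s n) w = \<one>\<^bsub>K\<^esub>"
      moreover have "\<one>\<^bsub>K\<^esub> \<in> torsion K"
        using subgroup.one_closed[OF normal_imp_subgroup[OF K.normal_torsion]] .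
      ultimately have "w \<notin> ?\<Omega> n" using s(3)[of w n] by auto
      then show "w \<in> identities G" using w n assms(3) by blast
    next
      assume "w \<in> identities G"
      then show "word_value K (s n) w = \<one>\<^bsub>K\<^esub>" using s(1) assms(3) by (intro identitiesD) simp_all
    qed
  qed
  then have "marking_limit K (relatively_free G k) k (free_generator G k) s"
    unfolding marking_limit_def
    using s(1,2) G.free_generator_closed G.generate_free_generator by blast
  then show ?thesis by blast
qed

lemma marking_limit_iso:
  assumes "group G" "group H" "group K" "marking_limit G H k t s" "h \<in> iso H K"
  shows "marking_limit G K k (\<lambda>i. h (t i)) s"
proof -
  interpret h: group_hom H K h
    using assms unfolding iso_def group_hom_def group_hom_axioms_def by blast
  note D = marking_limitD[OF assms(4)]
  have bij: "inj_on h (carrier H)" "h ` carrier H = carrier K"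
    using assms(5) by (simp_all add: iso_def bij_betw_def)
  have "t ` {..<k} \<subseteq> carrier H" using D(1) by blast
  from h.generate_img[OF this] have gen: "generate K ((\<lambda>i. h (t i)) ` {..<k}) = carrier K"
    unfolding D(2) bij(2) by (simp add: image_image)
  have "word_value K (\<lambda>i. h (t i)) w = \<one>\<^bsub>K\<^esub> \<longleftrightarrow> word_value H t w = \<one>\<^bsub>H\<^esub>" for w
    unfolding h.hom_word_value[of t, OF D(1), symmetric] h.hom_one[symmetric]
    by (rule inj_on_eq_iff[OF bij(1) h.G.word_value_closed[of t, OF D(1)] h.G.one_closed])
  then show ?thesis
    unfolding marking_limit_def using D gen h.hom_closed by simp
qed

text \<open>Both groups preform one relatively free group. Its rank is twice the larger of the two
  numbers of generators, which leaves room for two blocks in either group.\<close>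

lemma preforms_connected_of_same_identities:
  fixes K L :: "nat monoid"
  assumes G: "fg_nilpotent_group G" "generates_variety (G Mod torsion G) (variety_generated G)"
    and K: "fg_group K" "identities K = identities G" and L: "fg_group L" "identities L = identities G"
  shows "(iso_class K, iso_class L) \<in> preforms_connected"
proof -
  interpret G: fg_nilpotent_group G by fact
  have tuple: "\<exists>(d::nat) (g :: nat \<Rightarrow> nat). (\<forall>i. g i \<in> carrier M) \<and> generate M (g ` {..<d}) = carrier M"
    if M: "fg_group M" for M :: "nat monoid"
  proof -
    obtain S where "group M" "finite_generating_set M S" using M unfolding fg_group_def by blast
    then obtain d :: nat and g :: "nat \<Rightarrow> nat"
      where "\<And>i. g i \<in> carrier M" "generate M (g ` {..<d}) = carrier M"
      by (rule group.finite_generating_tuple) (rule that)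
    then show ?thesis by (intro exI[of _ d] exI[of _ g]) simp
  qed
  obtain d :: nat and g :: "nat \<Rightarrow> nat" where g: "\<And>i. g i \<in> carrier K" "generate K (g ` {..<d}) = carrier K"
    using tuple[OF K(1)] by auto
  obtain d' :: nat and g' :: "nat \<Rightarrow> nat" where g': "\<And>i. g' i \<in> carrier L" "generate L (g' ` {..<d'}) = carrier L"
    using tuple[OF L(1)] by auto
  define k where "k = 2 * max d d'"
  have k: "2 * d \<le> k" "2 * d' \<le> k" by (simp_all add: k_def)
  interpret F: fg_nilpotent_group "relatively_free G k" by (rule G.fg_nilpotent_relatively_free)
  have "fg_group (relatively_free G k)"
    using F.is_group F.finitely_generated by (simp add: fg_group_def)
  then obtain M :: "nat monoid" and h where M: "h \<in> iso (relatively_free G k) M" "fg_group M"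
    using exists_nat_copy by blast
  have gM: "group M" using M(2) by (simp add: fg_group_def)
  have pre: "preforms_class (iso_class N) (iso_class M)"
    if N: "fg_group N" "identities N = identities G" "\<And>i. b i \<in> carrier N"
      "generate N (b ` {..<c}) = carrier N" "2 * c \<le> k" for N :: "nat monoid" and b and c :: nat
  proof -
    have gN: "group N" using N(1) by (simp add: fg_group_def)
    have nN: "fg_nilpotent_group N"
      using fg_nilpotent_group_of_identities[OF G(1) N(1)] N(2) by simp
    obtain s where "marking_limit N (relatively_free G k) k (free_generator G k) s"
      using marking_limit_relatively_free[of G N b c k, OF G.is_group nN N(2) exists_nontorsion_value[OF G nN N(2)] N(3-5)]
      by blast
    then have "preforms N M"
      using marking_limit_imp_preforms[OF gN gM] marking_limit_iso[OF gN F.is_group gM _ M(1)] by blast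
    then show ?thesis unfolding preforms_class_def using N(1) M(2) by blast
  qed
  have "equivclp preforms_class (iso_class K) (iso_class M)"
    using pre[of K g d, OF K g k(1)] by (rule r_into_equivclp)
  moreover have "equivclp preforms_class (iso_class M) (iso_class L)"
    using pre[of L g' d', OF L g' k(2)] by (intro equivclp_sym[of _ "iso_class L"] r_into_equivclp)
  ultimately have "equivclp preforms_class (iso_class K) (iso_class L)"
    by (rule transpD[OF transp_equivclp])
  then show ?thesis using K(1) L(1) unfolding preforms_connected_def fg_classes_def by blast
qed

section \<open>Direct powers\<close>

lemma word_value_DirProd:
  assumes "group G" "group H" "\<And>i. x i \<in> carrier G" "\<And>i. y i \<in> carrier H"
  shows "word_value (G \<times>\<times> H) (\<lambda>i. (x i, y i)) w = (word_value G x w, word_value H y w)"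
proof (induction w)
  case (Cons l w)
  obtain i e where "l = (i, e)" by (cases l)
  then show ?case using Cons assms by simp
qed simp

lemma word_values_DirProd:
  assumes "group G" "group H"
  shows "word_values (G \<times>\<times> H) w = word_values G w \<times> word_values H w"
proof (intro equalityI subsetI)
  fix a assume "a \<in> word_values (G \<times>\<times> H) w"
  then obtain z where z: "range z \<subseteq> carrier G \<times> carrier H" "a = word_value (G \<times>\<times> H) z w"
    by (auto simp: word_values_def)
  then have zc: "fst (z i) \<in> carrier G" "snd (z i) \<in> carrier H" for i
    by (metis mem_Times_iff range_subsetD)+
  have "a = (word_value G (\<lambda>i. fst (z i)) w, word_value H (\<lambda>i. snd (z i)) w)"
    using word_value_DirProd[of G H "\<lambda>i. fst (z i)" "\<lambda>i. snd (z i)", OF assms zc] z(2) by simp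
  moreover have "word_value G (\<lambda>i. fst (z i)) w \<in> word_values G w" "word_value H (\<lambda>i. snd (z i)) w \<in> word_values H w"
    unfolding word_values_def using zc by blast+
  ultimately show "a \<in> word_values G w \<times> word_values H w" by blast
next
  fix a assume "a \<in> word_values G w \<times> word_values H w"
  then obtain x y where xy: "range x \<subseteq> carrier G" "range y \<subseteq> carrier H" "a = (word_value G x w, word_value H y w)"
    by (auto simp: word_values_def)
  then have "x i \<in> carrier G" "y i \<in> carrier H" for i by blast+
  from word_value_DirProd[of G H x y w, OF assms this]
  have "a = word_value (G \<times>\<times> H) (\<lambda>i. (x i, y i)) w" using xy(3) by simp
  moreover have "range (\<lambda>i. (x i, y i)) \<subseteq> carrier (G \<times>\<times> H)" using xy by auto
  ultimately show "a \<in> word_values (G \<times>\<times> H) w" unfolding word_values_def by blast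
qed

lemma fg_group_DirProd:
  assumes "fg_group G" "fg_group H" shows "fg_group (G \<times>\<times> H)"
proof -
  obtain S T where G: "group G" "finite S" "S \<subseteq> carrier G" "generate G S = carrier G"
    and H: "group H" "finite T" "T \<subseteq> carrier H" "generate H T = carrier H"
    using assms by (auto simp: fg_group_def finite_generating_set_def)
  interpret G: group G by fact
  interpret H: group H by fact
  interpret P: group "G \<times>\<times> H" by (rule DirProd_group) fact+
  let ?l = "\<lambda>a. (a, \<one>\<^bsub>H\<^esub>)" and ?r = "\<lambda>b. (\<one>\<^bsub>G\<^esub>, b)"
  let ?U = "?l ` S \<union> ?r ` T"
  have U: "?U \<subseteq> carrier (G \<times>\<times> H)" using G(3) H(3) by auto
  interpret l: group_hom G "G \<times>\<times> H" ?l by unfold_locales (auto simp: hom_def)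
  interpret r: group_hom H "G \<times>\<times> H" ?r by unfold_locales (auto simp: hom_def)
  have "generate (G \<times>\<times> H) (?l ` S) \<subseteq> generate (G \<times>\<times> H) ?U" "generate (G \<times>\<times> H) (?r ` T) \<subseteq> generate (G \<times>\<times> H) ?U"
    by (rule P.generate_mono_subgroup[OF _ U], blast)+
  then have sub: "?l ` carrier G \<subseteq> generate (G \<times>\<times> H) ?U" "?r ` carrier H \<subseteq> generate (G \<times>\<times> H) ?U"
    unfolding l.generate_img[OF G(3)] r.generate_img[OF H(3)] G(4) H(4) .
  have "carrier (G \<times>\<times> H) \<subseteq> generate (G \<times>\<times> H) ?U"
  proof
    fix c assume "c \<in> carrier (G \<times>\<times> H)"
    then obtain a b where c: "c = (a, b)" "a \<in> carrier G" "b \<in> carrier H" by auto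
    then have "c = ?l a \<otimes>\<^bsub>G \<times>\<times> H\<^esub> ?r b" by simp
    moreover have "?l a \<in> generate (G \<times>\<times> H) ?U" "?r b \<in> generate (G \<times>\<times> H) ?U" using sub c by blast+
    ultimately show "c \<in> generate (G \<times>\<times> H) ?U" by (simp only: generate.eng)
  qed
  then have "generate (G \<times>\<times> H) ?U = carrier (G \<times>\<times> H)" using P.generate_incl[OF U] by blast
  then have "finite_generating_set (G \<times>\<times> H) ?U"
    unfolding finite_generating_set_def using U G(2) H(2) by blast
  then show ?thesis using P.is_group by (auto simp: fg_group_def)
qed

text \<open>The value set of a word in a product is the product of the value sets. As each of these
  contains the unit, the product satisfies an identity only if both factors do.\<close>

lemma exists_direct_power:
  fixes K :: "nat monoid"
  assumes K: "fg_group K"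
  shows "\<exists>L :: nat monoid. fg_group L \<and> identities L = identities K \<and>
    card (word_values L w) = card (word_values K w) ^ Suc m"
proof (induction m)
  case 0
  then show ?case using K by (intro exI[of _ K]) simp
next
  case (Suc m)
  then obtain L :: "nat monoid" where L: "fg_group L" "identities L = identities K"
    "card (word_values L w) = card (word_values K w) ^ Suc m" by blast
  have g: "group K" "group L" using K L(1) by (simp_all add: fg_group_def)
  have P: "fg_group (K \<times>\<times> L)" using fg_group_DirProd[OF K L(1)] .
  then obtain M :: "nat monoid" and h where M: "h \<in> iso (K \<times>\<times> L) M" "fg_group M"
    using exists_nat_copy by blast
  have gM: "group (K \<times>\<times> L)" "group M" using P M(2) by (simp_all add: fg_group_def)
  have iso: "K \<times>\<times> L \<cong> M" using M(1) by (rule is_isoI)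
  have "v \<in> identities (K \<times>\<times> L) \<longleftrightarrow> v \<in> identities K" for v
    using L(2) group.one_mem_word_values[OF g(1), of v] group.one_mem_word_values[OF g(2), of v] identities_iff_word_values[of v K] identities_iff_word_values[of v L]
    unfolding identities_iff_word_values[of v "K \<times>\<times> L"] word_values_DirProd[OF g] one_DirProd by blast
  then have "identities M = identities K" using is_iso_invariants(1)[OF gM iso] by blast
  moreover have "card (word_values M w) = card (word_values K w) ^ Suc (Suc m)"
    unfolding is_iso_invariants(2)[OF gM iso, symmetric] word_values_DirProd[OF g]
    by (simp add: card_cartesian_product L(3))
  ultimately show ?case using M(2) by blast
qed

section \<open>The components of a variety\<close>

theorem corollary4p12:
  fixes G :: "('a, 'b) monoid_scheme"
  assumes "fg_group G" and "nilpotent_group G"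
  shows "(preforms_component (iso_class G) = generating_classes (variety_generated G) \<longleftrightarrow>
            generates_variety (G Mod torsion G) (variety_generated G)) \<and>
         (\<not> generates_variety (G Mod torsion G) (variety_generated G) \<longrightarrow>
            (\<exists>\<C>. \<C> \<subseteq> preforms_components \<and> infinite \<C> \<and>
               generating_classes (variety_generated G) = \<Union>\<C>))"
proof -
  have nG: "fg_nilpotent_group G" using assms fg_nilpotent_group_of_nilpotent_group by blast
  interpret G: fg_nilpotent_group G by fact
  obtain K0 :: "nat monoid" and h where h: "h \<in> iso G K0" "fg_group K0" using exists_nat_copy[OF assms(1)] by blast
  have g0: "group K0" using h(2) by (simp add: fg_group_def)
  have iso: "G \<cong> K0" using h(1) by (rule is_isoI)
  have c0: "iso_class G = iso_class K0" using iso_class_eqI[OF G.is_group g0 iso] .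
  have i0: "identities K0 = identities G" using is_iso_invariants(1)[OF G.is_group g0 iso] by simp
  let ?V = "generating_classes (variety_generated G)"
  let ?E = preforms_connected
  have V: "C \<in> ?V \<longleftrightarrow> (\<exists>K :: nat monoid. C = iso_class K \<and> fg_group K \<and> identities K = identities G)" for C
    unfolding generating_classes_def generates_variety_def variety_generated_def by blast
  have Vfg: "?V \<subseteq> fg_classes" unfolding generating_classes_def fg_classes_def by blast
  have refl: "(C, C) \<in> ?E" if "C \<in> fg_classes" for C
    using equiv_preforms_connected that by (meson equiv_class_self Image_singleton_iff)
  have inv: "\<exists>L :: nat monoid. D = iso_class L \<and> fg_group L \<and> identities L = identities G \<and>
      (\<forall>w. card (word_values L w) = card (word_values K w))"
    if "fg_group K" "identities K = identities G" "(iso_class K, D) \<in> ?E" for K :: "nat monoid" and D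
  proof -
    have "fg_nilpotent_group K" using fg_nilpotent_group_of_identities[OF nG that(1)] that(2) by simp
    then show ?thesis
      using equivclp_preforms_class_invariants[of K D] that by (simp add: preforms_connected_def)
  qed
  have closed: "D \<in> ?V" if "C \<in> ?V" "(C, D) \<in> ?E" for C D
    using that inv unfolding V by blast
  have V0: "iso_class G \<in> ?V" unfolding V c0 using h(2) i0 by blast
  have one: "preforms_component (iso_class G) = ?V" if "generates_variety (G Mod torsion G) (variety_generated G)"
  proof (intro equalityI subsetI)
    fix C assume "C \<in> preforms_component (iso_class G)"
    then show "C \<in> ?V" using closed[OF V0] by (simp add: preforms_component_def)
  next
    fix C assume "C \<in> ?V"
    then obtain K :: "nat monoid" where "C = iso_class K" "fg_group K" "identities K = identities G" unfolding V by blast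
    then show "C \<in> preforms_component (iso_class G)"
      using preforms_connected_of_same_identities[OF nG that h(2) i0] by (simp add: preforms_component_def c0)
  qed
  have many: "(\<exists>\<C>. \<C> \<subseteq> preforms_components \<and> infinite \<C> \<and> ?V = \<Union>\<C>) \<and> preforms_component (iso_class G) \<noteq> ?V"
    if not: "\<not> generates_variety (G Mod torsion G) (variety_generated G)"
  proof -
    have "identities G \<subseteq> identities (G Mod torsion G)"
    proof
      fix w assume w: "w \<in> identities G"
      have "\<one>\<^bsub>G\<^esub> \<in> torsion G"
        using subgroup.one_closed[OF normal_imp_subgroup[OF G.normal_torsion]] .
      then show "w \<in> identities (G Mod torsion G)"
        unfolding G.identities_Mod_torsion using identitiesD[OF w] by simp
    qed
    then obtain w where w: "w \<in> identities (G Mod torsion G)" "w \<notin> identities G"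
      using not unfolding generates_variety_def variety_generated_def by blast
    \<comment> \<open>This containment, together with the finiteness of the torsion, is what makes
      the number of values a usable invariant.\<close>
    have "word_values G w \<subseteq> torsion G"
      using w(1) unfolding G.identities_Mod_torsion word_values_def by blast
    then have fin: "finite (word_values G w)" using G.finite_torsion by (rule finite_subset)
    have "\<one>\<^bsub>G\<^esub> \<in> word_values G w" by (rule G.one_mem_word_values)
    moreover obtain a where "a \<in> word_values G w" "a \<noteq> \<one>\<^bsub>G\<^esub>"
      using w(2) unfolding identities_iff_word_values by blast
    ultimately have "card {\<one>\<^bsub>G\<^esub>, a} \<le> card (word_values G w)" using fin by (intro card_mono) auto
    then have "2 \<le> card (word_values G w)" using \<open>a \<noteq> \<one>\<^bsub>G\<^esub>\<close> by simp
    then have two: "2 \<le> card (word_values K0 w)"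
      using is_iso_invariants(2)[OF G.is_group g0 iso] by simp
    have "\<forall>m. \<exists>L :: nat monoid. fg_group L \<and> identities L = identities G \<and>
      card (word_values L w) = card (word_values K0 w) ^ Suc m"
      using exists_direct_power[OF h(2)] i0 by simp
    then obtain L :: "nat \<Rightarrow> nat monoid" where L: "\<And>m. fg_group (L m)" "\<And>m. identities (L m) = identities G"
      "\<And>m. card (word_values (L m) w) = card (word_values K0 w) ^ Suc m" by metis
    have gL: "group (L m)" for m using L(1)[of m] by (simp add: fg_group_def)
    have LV: "iso_class (L m) \<in> ?V" for m unfolding V using L(1,2) by blast
    have sep: "m = n" if mn: "(iso_class (L m), iso_class (L n)) \<in> ?E" for m n
    proof -
      obtain M :: "nat monoid" where M: "iso_class (L n) = iso_class M" "fg_group M"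
        "card (word_values M w) = card (word_values (L m) w)"
        using inv[OF L(1,2) mn] by blast
      have gM: "group M" using M(2) by (simp add: fg_group_def)
      have "card (word_values (L n) w) = card (word_values M w)"
        using is_iso_invariants(2)[OF gL gM is_iso_of_iso_class_eq[OF gM M(1)]] .
      then have "card (word_values K0 w) ^ Suc n = card (word_values K0 w) ^ Suc m"
        using M(3) L(3) by simp
      then show "m = n" using two by (simp add: power_inject_exp del: power_Suc)
    qed
    \<comment> \<open>Generating classes are closed under being connected, so these equivalence
      classes are whole components and their union adds nothing.\<close>
    define \<C> where "\<C> = ?V // ?E"
    have "\<C> \<subseteq> preforms_components"
      using Vfg unfolding \<C>_def preforms_components_def quotient_def by blast
    moreover have "infinite \<C>"
    proof
      assume "finite \<C>"
      moreover have "range (\<lambda>m. ?E `` {iso_class (L m)}) \<subseteq> \<C>"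
        using LV unfolding \<C>_def by (auto intro: quotientI)
      moreover have "inj (\<lambda>m. ?E `` {iso_class (L m)})"
      proof (rule injI)
        fix m n assume "?E `` {iso_class (L m)} = ?E `` {iso_class (L n)}"
        moreover have "(iso_class (L n), iso_class (L n)) \<in> ?E" using refl LV Vfg by blast
        ultimately show "m = n" using sep by blast
      qed
      ultimately show False using finite_subset range_inj_infinite by blast
    qed
    moreover have "?V = \<Union>\<C>"
    proof (intro equalityI subsetI)
      fix C assume "C \<in> ?V"
      then have "C \<in> ?E `` {C}" "?E `` {C} \<in> \<C>" using refl Vfg unfolding \<C>_def by (blast intro: quotientI)+
      then show "C \<in> \<Union>\<C>" by blast
    next
      fix D assume "D \<in> \<Union>\<C>"
      then show "D \<in> ?V" using closed unfolding \<C>_def quotient_def by blast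
    qed
    moreover have "preforms_component (iso_class G) \<noteq> ?V"
    proof
      \<comment> \<open>Otherwise all direct powers would be connected through \<open>G\<close>,
        although already the first two have different numbers of values of \<open>w\<close>.\<close>
      assume *: "preforms_component (iso_class G) = ?V"
      have "(iso_class G, iso_class (L m)) \<in> ?E" for m
        using LV[of m] unfolding *[symmetric] preforms_component_def by blast
      then have "(iso_class (L 0), iso_class (L 1)) \<in> ?E"
        using equiv_preforms_connected unfolding equiv_def by (meson symD transD)
      then show False using sep[of 0 1] by simp
    qed
    ultimately show ?thesis by blast
  qed
  show ?thesis using one many by blast
qed

end
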